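(* Let $r,g,\mathfrak{V}\geq 1$ be integers and let $0<\varepsilon,\delta<1$ be real numbers, all fixed. Put $\varepsilon_0:=\varepsilon/(50g)$. There exist a constant $c_0>0$ and implicit constants in $\gg$ below, all depending at most on $r,g,\mathfrak{V},\varepsilon,\delta$, such that the following holds for all irreducible polynomials $Q_1,\dots,Q_r\in\mathbb{Z}[X]$, pairwise coprime and without fixed divisor, whose product $Q$ has degree $g$, with associated quantities $\beta,D,\|Q\|,\rho_j,M$ (see context). (1) Uniformly for $x\geq c_0\|Q\|^{\delta}$, $x^{\varepsilon}<y\leq x$, and additive functions $f_1,\dots,f_r$ satisfying, for every $1\leq j\leq r$, \[\#\left\{f_j(n)\,:\ n\leq t^u,\ P^-(n)>t\right\}\leq\mathfrak{V}^{u}\qquad(t\geq x^{\varepsilon_0},\ u\geq 1),\] one has \[\sup_{k_1,\dots,k_r\in\mathbb{R}}\ \sum_{\substack{x<n\leq x+y\\ f_j(Q_j(n))=k_j\ (1\le j\le r)}}1\ \gg\ \frac{\mathrm{e}^{-M}y}{(\log x)^r}\ \sup_{k_1,\dots,k_r\in\mathbb{R}}\ \sum_{\substack{a_1,\dots,a_r\leq x^{\varepsilon_0}\\ f_j(a_j)=k_j\ (1\le j\le r)\\ (a_i,a_j)=1\ (i\neq j),\ (a_j,\beta D)=1\ (1\le j\le r)}}\ \prod_{1\leq j\leq r}\frac{\rho_j(a_j)\varphi(a_j)}{a_j^2},\] where $a_1,\dots,a_r$ run over positive integers. (2) In particular, writing $\omega_{y}(n)$ for the number of distinct prime factors of $n$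 that are at most $y$, one has, uniformly for $x\geq c_0\|Q\|^{\delta}$, $x^{\varepsilon}<y\leq x$ and $y_1,\dots,y_r\geq 1$, \[\sup_{k_1,\dots,k_r\in\mathbb{N}}\ \sum_{\substack{x<n\leq x+y\\ \omega_{y_j}(Q_j(n))=k_j\ (1\le j\le r)}}1\ \gg\ \left(\frac{\varphi(\beta D)}{\beta D}\right)^{g}\frac{\mathrm{e}^{-2M}y}{\sqrt{\prod_{1\leq j\leq r}E_{\omega_{y_j}}(x;\rho_j)}}.\]
   Context: Throughout, $p$ denotes a prime number and $n$ an integer; $\log_2=\log\log$; $\varphi$ is Euler's totient function; $\mathbb{N}$ includes $0$. $P^-(n)$ is the smallest prime factor of $n\ge 1$, with $P^-(1)=+\infty$. Additive functions are real-valued functions $f$ on the positive integers with $f(mn)=f(m)+f(n)$ whenever $(m,n)=1$. An additive or multiplicative function is extended to $\mathbb{Z}$ by parity ($f(-n)=f(n)$) and by giving it the value $0$ at $0$; the ratio $\varphi(\beta D)/(\beta D)$ is understood as $\varphi(|\beta D|)/|\beta D|$. For $f$ additive, $\rho\geq 0$ multiplicative and $x\geq 2$, \[E_f(x;\rho):=1+\sum_{p\leq x,\ f(p)\neq 0}\frac{\rho(p)}{p}.\] Setting on polynomials. $\{Q_j\}_{1\leq j\leq r}$ is a family of irreducible polynomials of $\mathbb{Z}[X]$, pairwise coprime and without fixed divisor (for each $j$, no prime divides $Q_j(n)$ for all $n\in\mathbb{Z}$). Put $Q:=\prod_{1\leq j\leq r}Q_j$, $g:=\deg Q$, $Q(X)=\sum_{0\leq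 i\leq g}\beta_iX^i$, $\beta:=\beta_g$, $\|Q\|:=\max_{0\leq i\leq g}|\beta_i|$. $D$ is the discriminant of $Q$. For $m\geq 1$ and $1\le j\le r$, $\rho_j(m)$ is the number of roots of $Q_j$ in $\mathbb{Z}/m\mathbb{Z}$. For $1\leq j\leq r$, $M_j\geq 1$ denotes a constant (depending on $Q_j$), whose existence is a known fact, such that for all $x\geq 2$ \[\left|\sum_{p\leq x}\frac{\rho_j(p)}{p}-\log_2x\right|\leq M_j.\] Put $M:=\sum_{1\leq j\leq r}M_j$. *)

theory Defs
  imports
    "Subresultants.Resultant_Prelim"
    "HOL-Number_Theory.Totient"
    "HOL-Library.Extended_Real"
    "HOL-Library.FuncSet"
begin

section \<open>Arithmetic functions\<close>

definition additive_fun :: "(nat \<Rightarrow> real) \<Rightarrow> bool" where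
  "additive_fun f \<longleftrightarrow>
     (\<forall>m n. m \<ge> 1 \<longrightarrow> n \<ge> 1 \<longrightarrow> coprime m n \<longrightarrow> f (m * n) = f m + f n)"

text \<open>The extension to the integers is by parity and by the value 0 at 0; the value of the
  argument function at 0 plays no role.\<close>

definition int_ext :: "(nat \<Rightarrow> real) \<Rightarrow> int \<Rightarrow> real" where
  "int_ext f n = (if n = 0 then 0 else f (nat \<bar>n\<bar>))"

text \<open>The infimum of the empty set of extended reals is \<open>\<infinity>\<close>, so \<open>P_minus 1 = \<infinity>\<close>.\<close>

definition P_minus :: "nat \<Rightarrow> ereal" where
  "P_minus n = (INF p\<in>prime_factors n. ereal (real p))"

lemma P_minus_1: "P_minus 1 = \<infinity>"
  by (simp add: P_minus_def top_ereal_def)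

definition omega_upto :: "real \<Rightarrow> nat \<Rightarrow> real" where
  "omega_upto y n = real (card {p \<in> prime_factors n. real p \<le> y})"

definition E_fun :: "(nat \<Rightarrow> real) \<Rightarrow> real \<Rightarrow> (nat \<Rightarrow> real) \<Rightarrow> real" where
  "E_fun f x \<rho> = 1 + (\<Sum>p | prime p \<and> real p \<le> x \<and> f p \<noteq> 0. \<rho> p / real p)"

text \<open>The sets counted here are finite because \<open>n\<close> is bounded by \<open>t powr u\<close>.\<close>

definition sparse_values :: "nat \<Rightarrow> real \<Rightarrow> (nat \<Rightarrow> real) \<Rightarrow> bool" where
  "sparse_values V z f \<longleftrightarrow>
     (\<forall>t u. t \<ge> z \<longrightarrow> u \<ge> 1 \<longrightarrow>
        real (card {f n | n. n \<ge> 1 \<and> real n \<le> t powr u \<and> P_minus n > ereal t}) \<le> real V powr u)"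


section \<open>Integer polynomials\<close>

definition height :: "int poly \<Rightarrow> int" where
  "height P = Max ((\<lambda>i. \<bar>poly.coeff P i\<bar>) ` {..degree P})"

text \<open>The division is exact, see \<open>poly_disc_mult_lead_coeff\<close> below.\<close>

definition poly_disc :: "int poly \<Rightarrow> int" where
  "poly_disc P =
     (-1) ^ (degree P * (degree P - 1) div 2) * (resultant P (pderiv P) div lead_coeff P)"

lemma lead_coeff_dvd_resultant_pderiv:
  fixes P :: "int poly"
  assumes "degree P \<ge> 1"
  shows "lead_coeff P dvd resultant P (pderiv P)"
proof -
  define A where "A = sylvester_mat P (pderiv P)"
  define N where "N = degree P + degree (pderiv P)"
  have A: "A \<in> carrier_mat N N"
    unfolding A_def N_def by (rule sylvester_carrier_mat)
  have "0 < N" using assms by (simp add: N_def)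
  have entry: "lead_coeff P dvd A $$ (i, 0)" if "i < N" for i
  proof (cases "i < degree (pderiv P)")
    case True
    then show ?thesis using \<open>0 < N\<close> that
      by (auto simp: A_def N_def sylvester_index_mat)
  next
    case False
    have "poly.coeff (pderiv P) (degree (pderiv P)) = of_nat (degree P) * lead_coeff P"
      using assms by (simp add: degree_pderiv coeff_pderiv del: of_nat_Suc)
    then show ?thesis using \<open>0 < N\<close> that False
      by (auto simp: A_def N_def sylvester_index_mat)
  qed
  have "det A = (\<Sum>i<N. A $$ (i, 0) * cofactor A i 0)"
    by (rule laplace_expansion_column[OF A \<open>0 < N\<close>])
  then show ?thesis
    unfolding resultant_def A_def[symmetric] using entry by (auto intro!: dvd_sum)
qed

lemma poly_disc_mult_lead_coeff:
  fixes P :: "int poly"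
  assumes "degree P \<ge> 1"
  shows "lead_coeff P * poly_disc P =
    (-1) ^ (degree P * (degree P - 1) div 2) * resultant P (pderiv P)"
  using lead_coeff_dvd_resultant_pderiv[OF assms] by (auto simp: poly_disc_def)

definition no_fixed_divisor :: "int poly \<Rightarrow> bool" where
  "no_fixed_divisor P \<longleftrightarrow> \<not> (\<exists>p::int. prime p \<and> (\<forall>n. p dvd poly P n))"

text \<open>Irreducibility is that of the ring of integer polynomials; constant primes are excluded
  by the absence of a fixed divisor.\<close>

definition poly_family :: "nat \<Rightarrow> (nat \<Rightarrow> int poly) \<Rightarrow> bool" where
  "poly_family r Q \<longleftrightarrow>
     (\<forall>j\<in>{1..r}. irreducible (Q j) \<and> no_fixed_divisor (Q j)) \<and>
     (\<forall>i\<in>{1..r}. \<forall>j\<in>{1..r}. i \<noteq> j \<longrightarrow> coprime (Q i) (Q j))"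

definition root_count :: "int poly \<Rightarrow> nat \<Rightarrow> real" where
  "root_count P m = real (card {a \<in> {0..<int m}. int m dvd poly P a})"

definition mertens_bound :: "int poly \<Rightarrow> real \<Rightarrow> bool" where
  "mertens_bound P M \<longleftrightarrow> M \<ge> 1 \<and>
     (\<forall>x\<ge>2. \<bar>(\<Sum>p | prime p \<and> real p \<le> x. root_count P p / real p) - ln (ln x)\<bar> \<le> M)"


section \<open>The two sums\<close>

definition value_count ::
  "nat \<Rightarrow> (nat \<Rightarrow> int poly) \<Rightarrow> (nat \<Rightarrow> nat \<Rightarrow> real) \<Rightarrow> real \<Rightarrow> real \<Rightarrow> (nat \<Rightarrow> real) \<Rightarrow> real" where
  "value_count r Q f x y k = real (card {n::int. x < of_int n \<and> of_int n \<le> x + y \<and>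
     (\<forall>j\<in>{1..r}. int_ext (f j) (poly (Q j) n) = k j)})"

text \<open>The tuples are extensional functions on \<open>{1..r}\<close>. The parameter \<open>N\<close> is the integer to which
  all the components are coprime.\<close>

definition coprime_tuples ::
  "nat \<Rightarrow> int \<Rightarrow> (nat \<Rightarrow> nat \<Rightarrow> real) \<Rightarrow> real \<Rightarrow> (nat \<Rightarrow> real) \<Rightarrow> (nat \<Rightarrow> nat) set" where
  "coprime_tuples r N f z k = {a \<in> {1..r} \<rightarrow>\<^sub>E {m. m \<ge> 1 \<and> real m \<le> z}.
     (\<forall>j\<in>{1..r}. f j (a j) = k j \<and> coprime (int (a j)) N) \<and>
     (\<forall>i\<in>{1..r}. \<forall>j\<in>{1..r}. i \<noteq> j \<longrightarrow> coprime (a i) (a j))}"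

definition tuple_sum ::
  "nat \<Rightarrow> (nat \<Rightarrow> int poly) \<Rightarrow> int \<Rightarrow> (nat \<Rightarrow> nat \<Rightarrow> real) \<Rightarrow> real \<Rightarrow> (nat \<Rightarrow> real) \<Rightarrow> real" where
  "tuple_sum r Q N f z k = (\<Sum>a\<in>coprime_tuples r N f z k.
     \<Prod>j\<in>{1..r}. root_count (Q j) (a j) * real (totient (a j)) / (real (a j))\<^sup>2)"

text \<open>Both quantities are bounded in \<open>k\<close>, so that their real suprema over \<open>k\<close> are genuine.\<close>

lemma bdd_above_value_count: "bdd_above (value_count r Q f x y ` K)"
proof (rule bdd_aboveI2)
  fix k
  have "finite {\<lfloor>x\<rfloor>..\<lceil>x + y\<rceil>}" by simp
  moreover have "{n::int. x < of_int n \<and> of_int n \<le> x + y \<and>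
     (\<forall>j\<in>{1..r}. int_ext (f j) (poly (Q j) n) = k j)} \<subseteq> {\<lfloor>x\<rfloor>..\<lceil>x + y\<rceil>}"
    by (auto simp: floor_le_iff le_ceiling_iff)
  ultimately show "value_count r Q f x y k \<le> real (card {\<lfloor>x\<rfloor>..\<lceil>x + y\<rceil>})"
    unfolding value_count_def by (intro of_nat_mono card_mono)
qed

lemma finite_tuples: "finite ({1..r::nat} \<rightarrow>\<^sub>E {m::nat. m \<ge> 1 \<and> real m \<le> z})"
proof (rule finite_PiE)
  fix i
  have "{m::nat. m \<ge> 1 \<and> real m \<le> z} \<subseteq> {..nat \<lfloor>z\<rfloor>}" by (auto simp: le_nat_floor)
  then show "finite {m::nat. m \<ge> 1 \<and> real m \<le> z}" by (rule finite_subset) simp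
qed (rule finite_atLeastAtMost)

lemma bdd_above_tuple_sum: "bdd_above (tuple_sum r Q N f z ` K)"
proof (rule bdd_aboveI2)
  fix k
  show "tuple_sum r Q N f z k \<le> (\<Sum>a\<in>{1..r} \<rightarrow>\<^sub>E {m. m \<ge> 1 \<and> real m \<le> z}.
     \<Prod>j\<in>{1..r}. root_count (Q j) (a j) * real (totient (a j)) / (real (a j))\<^sup>2)"
    unfolding tuple_sum_def
    by (rule sum_mono2[OF finite_tuples])
       (auto simp: coprime_tuples_def root_count_def intro!: prod_nonneg)
qed

end

theory Submission
  imports Defs
begin

text \<open>
  Fix \<open>k\<close> and put \<open>z = x powr \<epsilon>\<^sub>0\<close>. For a tuple \<open>a\<close> of the right-hand sum, count the \<open>n\<close> in \<open>(x, x + y]\<close>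
  with \<open>Q\<^sub>j(n) = a\<^sub>j s\<^sub>j b\<^sub>j\<close>, where \<open>a\<^sub>j\<close> is coprime to its cofactor, \<open>b\<^sub>j\<close> has no prime factor up to \<open>z\<close>, and
  \<open>s\<^sub>j\<close>, composed of primes below a constant \<open>w\<^sub>0\<close>, is frozen by a congruence on \<open>n\<close>. Since \<open>a\<^sub>j\<close> is coprime
  to the resultant of \<open>Q\<close> and \<open>Q'\<close>, its roots are simple, so the density of admissible classes is
  \<open>\<rho>\<^sub>j(a\<^sub>j) \<phi>(a\<^sub>j) / a\<^sub>j\<^sup>2\<close>; the Brun--Hooley sieve removes the primes in \<open>(w\<^sub>0, z]\<close> at the cost of a factor
  \<open>e\<^sup>-\<^sup>M / (log x)\<^sup>r\<close>. As \<open>b\<^sub>j\<close> is at most a bounded power of \<open>z\<close>, the vector of the \<open>f\<^sub>j(s\<^sub>j) + f\<^sub>j(b\<^sub>j)\<close> takes boundedly many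
  values, and the pigeonhole principle yields (1).

  For (2), take \<open>f\<^sub>j\<close> to be the truncated \<open>\<omega>\<close> in (1), and distribute the primes up to a small power of \<open>x\<close> at random among
  \<open>a\<^sub>1, \<dots>, a\<^sub>r\<close> and an unused class. By Chebyshev's inequality \<open>f\<^sub>j(a\<^sub>j)\<close> lies within \<open>O(\<surd>E\<^sub>j)\<close> of its mean, by Markov's
  inequality \<open>a\<^sub>j \<le> z\<close>, and some value vector therefore carries a proportion \<open>\<Prod> E\<^sub>j powr (-1/2)\<close> of the total mass.
\<close>


section \<open>Sums over primes\<close>

text \<open>The exponent \<open>50 g\<close> is a budget in powers of \<open>z\<close>. Up to
  constants, the modulus of the congruences costs at most \<open>z ^ (2 g)\<close> and the sieve
  product at most another \<open>z ^ (2 g)\<close>; the remaining \<open>z ^ (46 g)\<close>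
  dominates the sieve error \<open>z powr (30 g + 9)\<close>. Uniformity shapes the rest: thresholds
  may depend on \<open>g\<close> but not on \<open>M\<close>, so this comparison uses a crude bound
  for the sieve product that is free of \<open>M\<close>, and the Mertens constants enter only the
  final value. The sieve likewise uses only the bound \<open>g\<close> for the number of excluded
  classes modulo a prime, and Chebyshev-type estimates. In (2) the second factor
  \<open>exp (- M)\<close> and the power of \<open>\<phi>(\<beta>D) / (\<beta>D)\<close> come from
  the lower bound for the total mass of the tuples, in which the primes dividing
  \<open>\<beta>D\<close> are missing. That mass also contains a power \<open>(ln x) ^ r\<close> up
  to a constant, which cancels the logarithms of (1). Most of it lies in a box with sides of order
  \<open>sqrt E_j\<close>, hence the square root.\<close>

lemma prod_primes_dvd:
  fixes n :: nat
  assumes "finite A" "\<And>p. p \<in> A \<Longrightarrow> prime p" "\<And>p. p \<in> A \<Longrightarrow> p dvd n"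
  shows "\<Prod>A dvd n"
  using assms
proof (induction A)
  case (insert p A)
  have "coprime p (\<Prod>A)"
    using insert by (intro prod_coprime_right) (metis insertCI primes_coprime)
  then show ?case using insert by (simp add: divides_mult)
qed simp

lemma sum_le_sum_UNION:
  fixes f :: "'a \<Rightarrow> real"
  assumes "finite I" "\<And>i. i \<in> I \<Longrightarrow> finite (A i)" "\<And>x. f x \<ge> 0" "B \<subseteq> (\<Union>i\<in>I. A i)"
  shows "sum f B \<le> (\<Sum>i\<in>I. sum f (A i))"
proof -
  have "sum f (\<Union>i\<in>I. A i) \<le> (\<Sum>i\<in>I. sum f (A i))"
    using assms(1,2)
  proof (induction I)
    case (insert i I)
    have "sum f (A i \<union> (\<Union>i\<in>I. A i)) \<le> sum f (A i) + sum f (\<Union>i\<in>I. A i)"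
      using insert assms(3) by (subst sum_Un) (auto intro!: sum_nonneg)
    then show ?case using insert by simp
  qed simp
  moreover have "sum f B \<le> sum f (\<Union>i\<in>I. A i)"
    using assms by (intro sum_mono2) auto
  ultimately show ?thesis by linarith
qed

text \<open>All primes in \<open>(N, 2N]\<close> divide the central binomial coefficient, which is at most \<open>4\<^sup>N\<close>.\<close>
lemma sum_inverse_primes_dyadic:
  assumes "k \<ge> 1"
  shows "(\<Sum>p | prime p \<and> 2 ^ k < p \<and> p \<le> 2 ^ Suc k. 1 / real p) \<le> 2 / real k"
proof -
  define A where "A = {p::nat. prime p \<and> 2 ^ k < p \<and> p \<le> 2 ^ Suc k}"
  define N :: nat where "N = 2 ^ k"
  have fin: "finite A"
    by (rule finite_subset[of _ "{..2 ^ Suc k}"]) (auto simp: A_def)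
  have "p dvd (2 * N) choose N" if "p \<in> A" for p
  proof -
    have p: "prime p" "N < p" "p \<le> 2 * N" using that by (auto simp: A_def N_def)
    have "fact N * fact N * ((2 * N) choose N) = (fact (2 * N) :: nat)"
      using binomial_fact_lemma[of N "2 * N"] by (simp add: mult_2)
    moreover have "p dvd fact (2 * N)" using p by (simp add: prime_dvd_fact_iff)
    ultimately have "p dvd fact N * fact N * ((2 * N) choose N)" by metis
    moreover have "\<not> p dvd fact N" using p by (simp add: prime_dvd_fact_iff)
    ultimately show ?thesis using p(1) by (simp add: prime_dvd_mult_iff)
  qed
  then have "\<Prod>A dvd (2 * N) choose N" using fin by (intro prod_primes_dvd) (auto simp: A_def)
  then have "\<Prod>A \<le> (2 * N) choose N" by (intro dvd_imp_le) auto
  also have "\<dots> \<le> (\<Sum>i\<le>2 * N. (2 * N) choose i)"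
    by (rule member_le_sum) auto
  also have "\<dots> = 2 ^ (2 * N)" by (simp add: choose_row_sum)
  finally have *: "\<Prod>A \<le> 2 ^ (2 * N)" .
  have "2 ^ (k * card A) = (\<Prod>p\<in>A. N)" by (simp add: N_def power_mult)
  also have "\<dots> \<le> \<Prod>A" by (rule prod_mono) (auto simp: A_def N_def)
  finally have "(2::nat) ^ (k * card A) \<le> 2 ^ (2 * N)" using * by linarith
  then have "k * card A \<le> 2 * N" by simp
  then have **: "real k * real (card A) \<le> 2 * real N" by (metis of_nat_mono of_nat_mult of_nat_numeral)
  have "(\<Sum>p\<in>A. 1 / real p) \<le> (\<Sum>p\<in>A. 1 / real N)"
    by (rule sum_mono) (auto simp: A_def N_def field_simps)
  also have "\<dots> = real (card A) / real N" by simp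
  also have "\<dots> \<le> 2 / real k"
    using ** assms by (auto simp: N_def field_simps)
  finally show ?thesis by (simp add: A_def)
qed

lemma real_between_powers_of_two:
  fixes w :: real
  assumes "w \<ge> 1"
  obtains m :: nat where "2 ^ m \<le> w" "w < 2 ^ Suc m"
proof -
  have "nat \<lfloor>w\<rfloor> \<ge> 1" using assms by linarith
  then obtain m where m: "2 ^ m \<le> nat \<lfloor>w\<rfloor>" "nat \<lfloor>w\<rfloor> < 2 ^ (m + 1)"
    using ex_power_ivl1[of 2 "nat \<lfloor>w\<rfloor>"] by auto
  have "real (2 ^ m) \<le> w" using m(1) assms by linarith
  moreover have "w < real (2 ^ (m + 1))" using m(2) assms by linarith
  ultimately show ?thesis using that by simp
qed

lemma finite_primes_upto: "finite {p::nat. prime p \<and> real p \<le> t \<and> R p}"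
  by (rule finite_subset[of _ "{..nat \<lfloor>t\<rfloor>}"]) (auto simp: le_nat_floor)

text \<open>Tailored to one block \<open>(w, w\<^sup>2]\<close> of the sieve. The block is covered
  by \<open>m + 2\<close> dyadic intervals, each contributing at most \<open>2 / m\<close>, and
  \<open>16 / 7\<close> is the value of \<open>(m + 2) * 2 / m\<close> at
  \<open>m = 14\<close>.\<close>

lemma sum_inverse_primes_square:
  fixes w :: real
  assumes "w \<ge> 2 ^ 14"
  shows "(\<Sum>p | prime p \<and> w < real p \<and> real p \<le> w\<^sup>2. 1 / real p) \<le> 16 / 7"
proof -
  have w1: "w \<ge> 1" using assms by simp
  then obtain m :: nat where m: "2 ^ m \<le> w" "w < 2 ^ Suc m"
    by (rule real_between_powers_of_two)
  have "(2::real) ^ 14 < 2 ^ Suc m" using assms m by linarith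
  then have "14 < Suc m" by (rule power_less_imp_less_exp[rotated]) simp
  then have m14: "m \<ge> 14" by simp
  define A where "A k = {p::nat. prime p \<and> 2 ^ k < p \<and> p \<le> 2 ^ Suc k}" for k :: nat
  have sub: "{p. prime p \<and> w < real p \<and> real p \<le> w\<^sup>2} \<subseteq> (\<Union>k\<in>{m..2*m+1}. A k)"
  proof clarsimp
    fix p :: nat assume p: "prime p" "w < real p" "real p \<le> w\<^sup>2"
    have "p \<ge> 2" using p(1) prime_ge_2_nat by auto
    then obtain k where k: "2 ^ k < p" "p \<le> 2 ^ (k + 1)"
      using ex_power_ivl2[of 2 p] by auto
    have "w\<^sup>2 < (2 ^ Suc m)\<^sup>2" using m(2) w1 by (intro power_strict_mono) auto
    then have "real (2 ^ k) < 2 ^ (2 * Suc m)"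
      using of_nat_less_iff[where 'a = real, THEN iffD2, OF k(1)] p(3)
      unfolding power_mult power_mult[symmetric, of _ _ 2] mult.commute[of _ 2] by linarith
    then have "(2::real) ^ k < 2 ^ (2 * Suc m)" by (simp only: of_nat_power of_nat_numeral)
    then have "k < 2 * Suc m" by (rule power_less_imp_less_exp[rotated]) simp
    moreover have "(2::real) ^ m < 2 ^ (k + 1)"
    proof -
      have "real p \<le> real (2 ^ (k + 1))" using k(2) by (rule of_nat_mono)
      then show ?thesis using m(1) p(2) by simp
    qed
    then have "m < k + 1" by (rule power_less_imp_less_exp[rotated]) simp
    ultimately show "\<exists>k\<in>{m..Suc (2 * m)}. p \<in> A k"
      using k p(1) by (intro bexI[of _ k]) (auto simp: A_def)
  qed
  have "(\<Sum>p | prime p \<and> w < real p \<and> real p \<le> w\<^sup>2. 1 / real p) \<le> (\<Sum>k\<in>{m..2*m+1}. \<Sum>p\<in>A k. 1 / real p)"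
    using sub by (intro sum_le_sum_UNION) (auto simp: A_def intro: finite_subset[of _ "{..2 ^ Suc _}"])
  also have "\<dots> \<le> (\<Sum>k\<in>{m..2*m+1}. 2 / real m)"
  proof (rule sum_mono)
    fix k assume k: "k \<in> {m..2*m+1}"
    have "(\<Sum>p\<in>A k. 1 / real p) \<le> 2 / real k"
      unfolding A_def using k m14 by (intro sum_inverse_primes_dyadic) auto
    also have "\<dots> \<le> 2 / real m" using k m14 by (intro divide_left_mono) auto
    finally show "(\<Sum>p\<in>A k. 1 / real p) \<le> 2 / real m" .
  qed
  also have "\<dots> = (real m + 2) * (2 / real m)" by simp
  also have "\<dots> \<le> 16 / 7" using m14 by (simp add: field_simps)
  finally show ?thesis .
qed

text \<open>The upper half of Mertens' first theorem with a crude constant: above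
  \<open>2 ^ k\<close> the factor \<open>ln p \<le> (k + 1) ln 2\<close> cancels the denominator of
  the dyadic bound \<open>2 / k\<close>, so each dyadic interval contributes at most
  \<open>4 ln 2\<close>.\<close>

lemma sum_ln_primes_le:
  fixes t :: real
  assumes "t \<ge> 1"
  shows "(\<Sum>p | prime p \<and> real p \<le> t. ln (real p) / real p) \<le> 4 * (ln t + 1)"
proof -
  obtain m :: nat where m: "2 ^ m \<le> t" "t < 2 ^ Suc m"
    using assms by (rule real_between_powers_of_two)
  define A where "A k = {p::nat. prime p \<and> 2 ^ k < p \<and> p \<le> 2 ^ Suc k}" for k :: nat
  have finA: "finite (A k)" for k
    by (rule finite_subset[of _ "{..2 ^ Suc k}"]) (auto simp: A_def)
  have sub: "{p. prime p \<and> real p \<le> t} \<subseteq> (\<Union>k\<in>{..m}. A k)"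
  proof clarsimp
    fix p :: nat assume p: "prime p" "real p \<le> t"
    have "p \<ge> 2" using p(1) prime_ge_2_nat by auto
    then obtain k where k: "2 ^ k < p" "p \<le> 2 ^ (k + 1)"
      using ex_power_ivl2[of 2 p] by auto
    have "real (2 ^ k) < 2 ^ Suc m" using k(1) p(2) m(2) by linarith
    then have "(2::real) ^ k < 2 ^ Suc m" by simp
    then have "k < Suc m" by (rule power_less_imp_less_exp[rotated]) simp
    then show "\<exists>k\<in>{..m}. p \<in> A k"
      using k p(1) by (intro bexI[of _ k]) (auto simp: A_def)
  qed
  have bound: "(\<Sum>p\<in>A k. ln (real p) / real p) \<le> 4 * ln 2" for k
  proof -
    have "(\<Sum>p\<in>A k. ln (real p) / real p) \<le> (\<Sum>p\<in>A k. (real (Suc k) * ln 2) * (1 / real p))"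
    proof (rule sum_mono)
      fix p assume p: "p \<in> A k"
      then have "p > 0" by (auto simp: A_def prime_gt_0_nat)
      moreover have "real p \<le> real (2 ^ Suc k)" using p unfolding A_def by (intro of_nat_mono) simp
      ultimately have "ln (real p) \<le> ln (2 ^ Suc k)" by (subst ln_le_cancel_iff) auto
      also have "\<dots> = real (Suc k) * ln 2" by (subst ln_realpow) auto
      finally show "ln (real p) / real p \<le> (real (Suc k) * ln 2) * (1 / real p)"
        using \<open>p > 0\<close> by (simp add: field_simps)
    qed
    also have "\<dots> = (real (Suc k) * ln 2) * (\<Sum>p\<in>A k. 1 / real p)"
      by (simp add: sum_distrib_left)
    also have "\<dots> \<le> 4 * ln 2"
    \<comment> \<open>The dyadic estimate starts at \<open>k = 1\<close>; for \<open>k = 0\<close>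
      the only prime is 2.\<close>
    proof (cases "k = 0")
      case True
      have "A k \<subseteq> {2}" using True by (auto simp: A_def)
      then have "(\<Sum>p\<in>A k. 1 / real p) \<le> (\<Sum>p\<in>{2}. 1 / real p)" by (intro sum_mono2) auto
      then have "(\<Sum>p\<in>A k. 1 / real p) \<le> 4" by simp
      then have "ln 2 * (\<Sum>p\<in>A k. 1 / real p) \<le> ln 2 * 4" by (intro mult_left_mono) auto
      then show ?thesis using True by simp
    next
      case False
      have "(\<Sum>p\<in>A k. 1 / real p) \<le> 2 / real k"
        unfolding A_def using False by (intro sum_inverse_primes_dyadic) auto
      then have "(real (Suc k) * ln 2) * (\<Sum>p\<in>A k. 1 / real p) \<le> (real (Suc k) * ln 2) * (2 / real k)"
        by (intro mult_left_mono) auto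
      also have "\<dots> = ln 2 * (2 * real (Suc k) / real k)" by simp
      also have "\<dots> \<le> ln 2 * 4" using False by (intro mult_left_mono) (auto simp: field_simps)
      finally show ?thesis by simp
    qed
    finally show ?thesis .
  qed
  have "(\<Sum>p | prime p \<and> real p \<le> t. ln (real p) / real p) \<le> (\<Sum>k\<in>{..m}. \<Sum>p\<in>A k. ln (real p) / real p)"
  proof (rule sum_le_sum_UNION[OF _ finA _ sub])
    fix p :: nat show "0 \<le> ln (real p) / real p" by (cases "p = 0") auto
  qed auto
  also have "\<dots> \<le> (\<Sum>k\<in>{..m}. 4 * ln 2)" by (rule sum_mono) (rule bound)
  also have "\<dots> = 4 * (real m * ln 2 + ln 2)" by (simp add: algebra_simps)
  also have "\<dots> \<le> 4 * (ln t + 1)"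
  proof -
    have "real m * ln 2 = ln (2 ^ m)" by (subst ln_realpow) auto
    also have "\<dots> \<le> ln t" using m assms by (subst ln_le_cancel_iff) auto
    finally show ?thesis using ln_2_less_1 by simp
  qed
  finally show ?thesis .
qed


section \<open>Integer polynomials modulo an integer\<close>

lemma diff_dvd_poly_diff:
  fixes P :: "'a::comm_ring_1 poly"
  shows "x - y dvd poly P x - poly P y"
proof (induction P)
  case (pCons a P)
  have "poly (pCons a P) x - poly (pCons a P) y = x * (poly P x - poly P y) + (x - y) * poly P y"
    by (simp add: algebra_simps)
  then show ?case using pCons by simp
qed simp

lemma dvd_poly_iff_of_dvd_diff:
  fixes P :: "int poly"
  assumes "m dvd x - y"
  shows "m dvd poly P x \<longleftrightarrow> m dvd poly P y"
  using dvd_trans[OF assms diff_dvd_poly_diff[of x y P]] by (metis dvd_diff_right_iff dvd_diff_commute dvd_minus_iff diff_add_cancel dvd_add_right_iff)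

text \<open>Taylor's formula with the remainder expressed as divisibility; induction on the
  coefficients avoids dividing the second derivative by 2.\<close>

lemma poly_second_order:
  fixes P :: "'a::idom poly"
  shows "h\<^sup>2 dvd poly P (x + h) - poly P x - h * poly (pderiv P) x"
proof (induction P)
  case (pCons a P)
  obtain k where k: "poly P (x + h) - poly P x - h * poly (pderiv P) x = h\<^sup>2 * k"
    using pCons by (auto simp: dvd_def)
  have "poly (pCons a P) (x + h) - poly (pCons a P) x - h * poly (pderiv (pCons a P)) x
      = x * (poly P (x + h) - poly P x - h * poly (pderiv P) x)
        + h * (poly P (x + h) - poly P x)"
    by (simp add: pderiv_pCons algebra_simps)
  also have "\<dots> = x * (h\<^sup>2 * k) + h * (h\<^sup>2 * k + h * poly (pderiv P) x)"
    unfolding k[symmetric] by (simp add: algebra_simps)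
  also have "\<dots> = h\<^sup>2 * (x * k + h * k + poly (pderiv P) x)"
    by (simp add: power2_eq_square algebra_simps)
  finally show ?case by (metis dvd_triv_left)
qed simp

text \<open>Lagrange's theorem carried out over the integers: modulo \<open>p\<close> the constant
  in \<open>P = (X - a) R + P(a)\<close> vanishes, so \<open>R\<close> inherits the hypothesis and
  all the other roots.\<close>

lemma card_roots_mod_prime:
  fixes P :: "int poly"
  assumes "prime p" "\<not> [:int p:] dvd P"
  shows "card {a \<in> {0..<int p}. int p dvd poly P a} \<le> degree P"
  using assms(2)
proof (induction "degree P" arbitrary: P)
  case 0
  then obtain c where c: "P = [:c:]" by (metis degree_eq_zeroE)
  then have "\<not> int p dvd c" using 0 by simp
  then have "{a \<in> {0..<int p}. int p dvd poly P a} = {}" using c by auto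
  then show ?case by (metis card.empty zero_le)
next
  case (Suc n)
  show ?case
  proof (cases "\<exists>a\<in>{0..<int p}. int p dvd poly P a")
    case True
    then obtain a where a: "a \<in> {0..<int p}" "int p dvd poly P a" by auto
    define R where "R = synthetic_div P a"
    have P: "P = [:-a, 1:] * R + [:poly P a:]"
      unfolding R_def by (rule synthetic_div_correct'[symmetric])
    have "degree R = n" using Suc(2) by (simp add: R_def degree_synthetic_div)
    moreover have "\<not> [:int p:] dvd R"
    proof
      assume "[:int p:] dvd R"
      then have "[:int p:] dvd [:-a, 1:] * R" by (rule dvd_mult)
      moreover have "[:int p:] dvd [:poly P a:]" using a(2) by simp
      ultimately show False using Suc(3) P by (metis dvd_add)
    qed
    ultimately have IH: "card {b \<in> {0..<int p}. int p dvd poly R b} \<le> n" using Suc(1) by metis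
    have "{b \<in> {0..<int p}. int p dvd poly P b} \<subseteq> insert a {b \<in> {0..<int p}. int p dvd poly R b}"
    proof clarsimp
      fix b assume b: "0 \<le> b" "b < int p" "int p dvd poly P b" "b \<noteq> a"
      have "poly P b = (b - a) * poly R b + poly P a"
        by (subst P) (simp add: algebra_simps)
      then have "int p dvd (b - a) * poly R b" using b(3) a(2) by (metis dvd_add_left_iff)
      moreover have "\<not> int p dvd b - a"
      proof
        assume "int p dvd b - a"
        then have "b mod int p = a mod int p" by (simp add: mod_eq_dvd_iff)
        then show False using a(1) b by simp
      qed
      ultimately show "int p dvd poly R b" using assms(1) by (simp add: prime_dvd_mult_iff)
    qed
    then have "card {b \<in> {0..<int p}. int p dvd poly P b} \<le> card (insert a {b \<in> {0..<int p}. int p dvd poly R b})"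
      by (intro card_mono) (auto intro: finite_subset[of _ "{0..<int p}"])
    also have "\<dots> \<le> Suc (card {b \<in> {0..<int p}. int p dvd poly R b})" 
    proof -
      have "finite {b \<in> {0..<int p}. int p dvd poly R b}"
        by (rule finite_subset[of _ "{0..<int p}"]) auto
      then show ?thesis by (simp only: card_insert_if) simp
    qed
    finally show ?thesis using IH Suc(2) by linarith
  next
    case False
    then have "{a \<in> {0..<int p}. int p dvd poly P a} = {}" by auto
    then show ?thesis by (metis card.empty zero_le)
  qed
qed

text \<open>The Chinese remainder theorem for unions of residue classes, which is what the
  periodicity hypotheses on \<open>A\<close> and \<open>B\<close> encode. Multiplicativity of root
  counts and the densities in the sieve both rest on it.\<close>

lemma card_inter_periodic:
  fixes A B :: "int set" and m n :: nat
  assumes "coprime m n" "m > 0" "n > 0"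
    and A: "\<And>x. x \<in> A \<longleftrightarrow> x mod int m \<in> A" and B: "\<And>x. x \<in> B \<longleftrightarrow> x mod int n \<in> B"
  shows "card (A \<inter> B \<inter> {0..<int (m * n)}) = card (A \<inter> {0..<int m}) * card (B \<inter> {0..<int n})"
proof -
  have "bij_betw (\<lambda>x. (x mod int m, x mod int n)) (A \<inter> B \<inter> {0..<int (m * n)})
          ((A \<inter> {0..<int m}) \<times> (B \<inter> {0..<int n}))"
    unfolding bij_betw_def
  proof
    show "inj_on (\<lambda>x. (x mod int m, x mod int n)) (A \<inter> B \<inter> {0..<int (m * n)})"
    proof (rule inj_onI)
      fix x y assume xy: "x \<in> A \<inter> B \<inter> {0..<int (m * n)}" "y \<in> A \<inter> B \<inter> {0..<int (m * n)}"
        "(x mod int m, x mod int n) = (y mod int m, y mod int n)"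
      then have "int m dvd x - y" "int n dvd x - y" by (auto simp: mod_eq_dvd_iff)
      then have "int m * int n dvd x - y" using assms(1) by (intro divides_mult) auto
      then have "x mod int (m * n) = y mod int (m * n)" by (simp add: mod_eq_dvd_iff)
      then show "x = y" using xy(1,2) by simp
    qed
    show "(\<lambda>x. (x mod int m, x mod int n)) ` (A \<inter> B \<inter> {0..<int (m * n)}) = (A \<inter> {0..<int m}) \<times> (B \<inter> {0..<int n})"
    proof safe
      fix u v assume uv: "u \<in> A" "v \<in> B" "u \<in> {0..<int m}" "v \<in> {0..<int n}"
      have "coprime (int m) (int n)" using assms(1) by simp
      then obtain x0 where x0: "[x0 = u] (mod int m)" "[x0 = v] (mod int n)"
        using binary_chinese_remainder_int by blast
      define x where "x = x0 mod int (m * n)"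
      have "x mod int m = u"
        using x0(1) uv unfolding x_def cong_def by (simp add: mod_mod_cancel)
      moreover have "x mod int n = v"
        using x0(2) uv unfolding x_def cong_def by (simp add: mod_mod_cancel)
      moreover have "x \<in> {0..<int (m * n)}" using assms by (auto simp: x_def)
      ultimately have "x \<in> A \<inter> B \<inter> {0..<int (m * n)}" "(u, v) = (x mod int m, x mod int n)"
        using A[of x] B[of x] uv by auto
      then show "(u, v) \<in> (\<lambda>x. (x mod int m, x mod int n)) ` (A \<inter> B \<inter> {0..<int (m * n)})" by blast
    qed (use assms A B in auto)
  qed
  from bij_betw_same_card[OF this] show ?thesis by (simp only: card_cartesian_product)
qed

lemma root_count_mult:
  assumes "coprime m n" "m > 0" "n > 0"
  shows "root_count P (m * n) = root_count P m * root_count P n"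
proof -
  define A where "A d = {x. int d dvd poly P x}" for d :: nat
  have per: "x \<in> A d \<longleftrightarrow> x mod int d \<in> A d" for x d
    unfolding A_def mem_Collect_eq by (rule dvd_poly_iff_of_dvd_diff) (simp add: minus_mod_eq_mult_div)
  have rc: "root_count P d = real (card (A d \<inter> {0..<int d}))" for d
    unfolding root_count_def A_def by (rule arg_cong[where f = "\<lambda>s. real (card s)"]) auto
  have "A (m * n) = A m \<inter> A n"
    using assms(1) by (auto simp: A_def intro: dvd_mult_left dvd_mult_right divides_mult)
  then show ?thesis
    unfolding rc using card_inter_periodic[OF assms per per] by simp
qed

lemma root_count_nonneg [simp]: "root_count P m \<ge> 0"
  by (simp add: root_count_def)

lemma root_count_1 [simp]: "root_count P (Suc 0) = 1"
proof -
  have "{a \<in> {0..<int (Suc 0)}. int (Suc 0) dvd poly P a} = {0}" by auto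
  then show ?thesis by (simp add: root_count_def)
qed

section \<open>Residue classes in intervals\<close>

lemma card_residue_interval:
  fixes \<alpha> \<beta> :: real and a d :: int
  assumes "d > 0" "0 \<le> a" "a < d" "\<alpha> \<le> \<beta>"
  shows "\<bar>real (card {m::int. \<alpha> < of_int m \<and> of_int m \<le> \<beta> \<and> m mod d = a}) - (\<beta> - \<alpha>) / of_int d\<bar> \<le> 1"
proof -
  \<comment> \<open>With \<open>m = a + d k\<close> the condition on \<open>m\<close> becomes
    \<open>u < k \<le> v\<close>, and each floor differs from its argument by less than 1.\<close>
  define u v where "u = \<lfloor>(\<alpha> - of_int a) / of_int d\<rfloor>" and "v = \<lfloor>(\<beta> - of_int a) / of_int d\<rfloor>"
  have iff: "\<alpha> < of_int (a + d * k) \<and> of_int (a + d * k) \<le> \<beta> \<longleftrightarrow> u < k \<and> k \<le> v" for k :: int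
    using assms(1) unfolding u_def v_def floor_less_iff le_floor_iff by (simp add: field_simps)
  have "{m::int. \<alpha> < of_int m \<and> of_int m \<le> \<beta> \<and> m mod d = a} = (\<lambda>k. a + d * k) ` {u<..v}"
  proof (intro equalityI subsetI)
    fix m assume "m \<in> {m::int. \<alpha> < of_int m \<and> of_int m \<le> \<beta> \<and> m mod d = a}"
    then have m: "\<alpha> < of_int m" "of_int m \<le> \<beta>" "m mod d = a" by auto
    have eq: "m = a + d * (m div d)" using m(3) by (metis mod_mult_div_eq)
    then have "m div d \<in> {u<..v}" using iff[of "m div d"] m by simp
    then show "m \<in> (\<lambda>k. a + d * k) ` {u<..v}" using eq by blast
  next
    fix m assume "m \<in> (\<lambda>k. a + d * k) ` {u<..v}"
    then obtain k where k: "m = a + d * k" "k \<in> {u<..v}" by blast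
    then show "m \<in> {m::int. \<alpha> < of_int m \<and> of_int m \<le> \<beta> \<and> m mod d = a}"
      using iff[of k] assms(1-3) by simp
  qed
  moreover have "inj_on (\<lambda>k. a + d * k) {u<..v}" using assms by (intro inj_onI) auto
  ultimately have "card {m::int. \<alpha> < of_int m \<and> of_int m \<le> \<beta> \<and> m mod d = a} = nat (v - u)"
    by (simp add: card_image)
  moreover have "u \<le> v" unfolding u_def v_def using assms by (intro floor_mono divide_right_mono) auto
  ultimately have "real (card {m::int. \<alpha> < of_int m \<and> of_int m \<le> \<beta> \<and> m mod d = a}) = of_int v - of_int u"
    by simp
  moreover have "(\<beta> - \<alpha>) / of_int d = (\<beta> - of_int a) / of_int d - (\<alpha> - of_int a) / of_int d"
    by (simp add: diff_divide_distrib)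
  ultimately show ?thesis unfolding u_def v_def by linarith
qed

lemma finite_int_interval:
  fixes \<alpha> \<beta> :: real
  shows "finite {m::int. \<alpha> < of_int m \<and> of_int m \<le> \<beta> \<and> R m}"
  by (rule finite_subset[of _ "{\<lfloor>\<alpha>\<rfloor>..\<lceil>\<beta>\<rceil>}"]) (auto simp: floor_le_iff le_ceiling_iff)

lemma card_periodic_interval:
  fixes \<alpha> \<beta> :: real and d :: nat
  assumes "d > 0" "\<alpha> \<le> \<beta>" "\<And>x. x \<in> A \<longleftrightarrow> x mod int d \<in> A"
  shows "\<bar>real (card {m::int. \<alpha> < of_int m \<and> of_int m \<le> \<beta> \<and> m \<in> A})
      - (\<beta> - \<alpha>) * (real (card (A \<inter> {0..<int d})) / real d)\<bar> \<le> real (card (A \<inter> {0..<int d}))"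
proof -
  define T where "T = A \<inter> {0..<int d}"
  define C where "C a = {m::int. \<alpha> < of_int m \<and> of_int m \<le> \<beta> \<and> m mod int d = a}" for a
  have "{m::int. \<alpha> < of_int m \<and> of_int m \<le> \<beta> \<and> m \<in> A} = (\<Union>a\<in>T. C a)"
  proof (intro equalityI subsetI)
    fix m assume m: "m \<in> {m::int. \<alpha> < of_int m \<and> of_int m \<le> \<beta> \<and> m \<in> A}"
    then have "m mod int d \<in> T" using assms(1) assms(3)[of m] by (auto simp: T_def)
    moreover have "m \<in> C (m mod int d)" using m by (auto simp: C_def)
    ultimately show "m \<in> (\<Union>a\<in>T. C a)" by blast
  next
    fix m assume "m \<in> (\<Union>a\<in>T. C a)"
    then show "m \<in> {m::int. \<alpha> < of_int m \<and> of_int m \<le> \<beta> \<and> m \<in> A}"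
      using assms(3)[of m] by (auto simp: T_def C_def)
  qed
  moreover have "card (\<Union>a\<in>T. C a) = (\<Sum>a\<in>T. card (C a))"
    by (rule card_UN_disjoint) (auto simp: T_def C_def intro: finite_int_interval)
  ultimately have "real (card {m::int. \<alpha> < of_int m \<and> of_int m \<le> \<beta> \<and> m \<in> A}) = (\<Sum>a\<in>T. real (card (C a)))"
    by simp
  moreover have "(\<beta> - \<alpha>) * (real (card T) / real d) = (\<Sum>a\<in>T. (\<beta> - \<alpha>) / real d)" by simp
  ultimately have "\<bar>real (card {m::int. \<alpha> < of_int m \<and> of_int m \<le> \<beta> \<and> m \<in> A})
      - (\<beta> - \<alpha>) * (real (card T) / real d)\<bar> = \<bar>\<Sum>a\<in>T. real (card (C a)) - (\<beta> - \<alpha>) / real d\<bar>"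
    by (simp only: sum_subtractf)
  also have "\<dots> \<le> (\<Sum>a\<in>T. \<bar>real (card (C a)) - (\<beta> - \<alpha>) / real d\<bar>)" by (rule sum_abs)
  also have "\<dots> \<le> (\<Sum>a\<in>T. 1)"
    unfolding C_def using assms card_residue_interval[of "int d" _ \<alpha> \<beta>]
    by (intro sum_mono) (auto simp: T_def)
  finally show ?thesis by (simp add: T_def)
qed

text \<open>Divide by \<open>X - a\<close> at the last point \<open>a = d + 1\<close>. At a smaller
  point \<open>i\<close> the product \<open>(i - a) R(i)\<close> is divisible by \<open>m\<close>,
  and \<open>a - i\<close> divides the factorial of \<open>d + 1\<close>; so that factorial times
  \<open>R\<close> satisfies the hypothesis for \<open>d\<close>. The factorials collected on the
  way form the multiplier.\<close>

lemma dvd_superfactorial_smult: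
  fixes P :: "int poly" and m :: int
  assumes "degree P \<le> d" "\<And>i. i \<in> {0..int d} \<Longrightarrow> m dvd poly P i"
  shows "[:m:] dvd smult (\<Prod>i\<le>d. fact i) P"
  using assms
proof (induction d arbitrary: P)
  case 0
  then obtain c where c: "P = [:c:]" by (metis degree_eq_zeroE le_zero_eq)
  have "m dvd c" using 0(2)[of 0] c by simp
  then show ?case using c by simp
next
  case (Suc d)
  define a where "a = int (Suc d)"
  define R where "R = synthetic_div P a"
  define F :: int where "F = (\<Prod>i\<le>d. fact i)"
  have P: "P = [:-a, 1:] * R + [:poly P a:]"
    unfolding R_def by (rule synthetic_div_correct'[symmetric])
  have ma: "m dvd poly P a" using Suc(3)[of a] by (simp add: a_def)
  have "m dvd poly (smult (fact (Suc d)) R) i" if i: "i \<in> {0..int d}" for i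
  proof -
    have "poly P i = (i - a) * poly R i + poly P a" by (subst P) (simp add: algebra_simps)
    moreover have "m dvd poly P i" using Suc(3)[of i] i by auto
    ultimately have 1: "m dvd (i - a) * poly R i" using ma by (metis dvd_add_left_iff)
    have "nat (a - i) dvd fact (Suc d)" by (rule dvd_fact) (use i in \<open>auto simp: a_def\<close>)
    then have "int (nat (a - i)) dvd int (fact (Suc d))" by (simp only: int_dvd_int_iff)
    then have "a - i dvd fact (Suc d)" using i by (simp del: fact_Suc add: a_def)
    then obtain k where "fact (Suc d) = (a - i) * k" by (auto simp: dvd_def)
    then have "poly (smult (fact (Suc d)) R) i = - k * ((i - a) * poly R i)"
      by (simp only: poly_smult) (simp add: algebra_simps)
    then show ?thesis using 1 by (metis dvd_mult)
  qed
  moreover have "degree (smult (fact (Suc d)) R) \<le> d"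
    using Suc(2) degree_smult_le[of "fact (Suc d)" R] unfolding R_def degree_synthetic_div by linarith
  ultimately have "[:m:] dvd smult F (smult (fact (Suc d)) R)" unfolding F_def by (intro Suc(1)) auto
  then have "[:m:] dvd [:-a, 1:] * smult (F * fact (Suc d)) R" by (intro dvd_mult) simp
  moreover have "[:m:] dvd [:(F * fact (Suc d)) * poly P a:]"
    using ma by simp
  ultimately have "[:m:] dvd [:-a, 1:] * smult (F * fact (Suc d)) R + [:(F * fact (Suc d)) * poly P a:]"
    by (rule dvd_add)
  also have "\<dots> = smult (F * fact (Suc d)) ([:-a, 1:] * R + [:poly P a:])"
    by (simp add: smult_add_right)
  also have "\<dots> = smult (F * fact (Suc d)) P" using P by metis
  finally show ?case by (simp only: F_def prod.atMost_Suc)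
qed

text \<open>A product of polynomials without fixed divisor may have one, like \<open>X (X + 1)\<close>, but it is bounded
  in terms of the degree alone.\<close>
lemma ex_not_prime_power_dvd_poly:
  fixes P :: "int poly"
  assumes "prime p" "\<not> [:int p:] dvd P" "degree P \<le> d"
  shows "\<exists>n. \<not> int p ^ (\<Prod>i\<le>d. fact i) dvd poly P n"
proof (rule ccontr)
  define F :: nat where "F = (\<Prod>i\<le>d. fact i)"
  assume "\<not> (\<exists>n. \<not> int p ^ (\<Prod>i\<le>d. fact i) dvd poly P n)"
  then have "[:int p ^ F:] dvd smult (\<Prod>i\<le>d. fact i) P"
    unfolding F_def using assms(3) by (intro dvd_superfactorial_smult) auto
  moreover have "(\<Prod>i\<le>d. fact i) = int F" by (simp add: F_def)
  ultimately have *: "[:int p ^ F:] dvd smult (int F) P" by simp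
  obtain k where k: "\<not> int p dvd coeff P k" using assms(2) by (auto simp: const_poly_dvd_iff)
  have "int p ^ F dvd int F * coeff P k" using * by (auto simp: const_poly_dvd_iff)
  moreover have "coprime (int p ^ F) (coeff P k)"
    using k assms(1) by (intro coprime_power_left_iff[THEN iffD2] disjI1 prime_imp_coprime) auto
  ultimately have "int p ^ F dvd int F" by (simp add: coprime_dvd_mult_left_iff)
  then have "int (p ^ F) dvd int F" by simp
  then have "p ^ F dvd F" by (simp only: int_dvd_int_iff)
  moreover have "F > 0" unfolding F_def by (intro prod_pos) auto
  ultimately have "p ^ F \<le> F" by (intro dvd_imp_le)
  \<comment> \<open>The superfactorial can serve as its own exponent because \<open>p ^ F\<close>
    exceeds \<open>F\<close> and so cannot divide it.\<close>
  moreover have "F < p ^ F" using assms(1) by (intro power_gt_expt) (auto simp: prime_gt_Suc_0_nat prime_gt_1_nat)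
  ultimately show False by simp
qed

section \<open>Roots with coprime cofactor\<close>

lemma coprime_add_mult_self:
  fixes a u k :: int
  shows "coprime (u + a * k) a \<longleftrightarrow> coprime u a"
  by (metis coprime_iff_gcd_eq_1 gcd_add_mult gcd.commute mult.commute add.commute)

text \<open>Since \<open>v\<close> is a unit modulo \<open>a\<close>, the map
  \<open>t \<mapsto> u + t v\<close> permutes the residues, so it hits the units exactly
  \<open>totient a\<close> times.\<close>

lemma card_coprime_affine:
  fixes a :: nat and u v :: int
  assumes "a > 0" "coprime v (int a)"
  shows "card {t \<in> {0..<int a}. coprime (u + t * v) (int a)} = totient a"
proof -
  have "bij_betw (\<lambda>t. (u + t * v) mod int a) {0..<int a} {0..<int a}"
  proof (rule bij_betwI')
    fix s t assume st: "s \<in> {0..<int a}" "t \<in> {0..<int a}"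
    show "((u + s * v) mod int a = (u + t * v) mod int a) = (s = t)"
    proof
      assume "(u + s * v) mod int a = (u + t * v) mod int a"
      then have "int a dvd (u + s * v) - (u + t * v)" by (simp add: mod_eq_dvd_iff)
      then have "int a dvd (s - t) * v" by (simp add: algebra_simps)
      then have "int a dvd s - t" using assms(2) by (simp add: coprime_dvd_mult_left_iff coprime_commute)
      then have "s mod int a = t mod int a" by (simp add: mod_eq_dvd_iff)
      then show "s = t" using st by simp
    qed simp
  next
    fix y assume "y \<in> {0..<int a}"
    obtain w where w: "[v * w = 1] (mod int a)" using assms(2) by (auto dest: cong_solve_coprime_int)
    define t where "t = ((y - u) * w) mod int a"
    have "[t = (y - u) * w] (mod int a)" by (simp add: t_def cong_def)
    then have "[u + t * v = u + (y - u) * w * v] (mod int a)"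
      by (rule cong_add[OF cong_refl cong_mult[OF _ cong_refl]])
    also have "u + (y - u) * w * v = u + (y - u) * (v * w)" by simp
    also have "[u + (y - u) * (v * w) = u + (y - u) * 1] (mod int a)" 
      by (rule cong_add[OF cong_refl cong_mult[OF cong_refl w]])
    finally have "(u + t * v) mod int a = y mod int a" by (simp add: cong_def)
    then show "\<exists>x\<in>{0..<int a}. y = (u + x * v) mod int a"
      using \<open>y \<in> _\<close> assms(1) by (intro bexI[of _ t]) (auto simp: t_def)
  qed (use assms in auto)
  then have "bij_betw (\<lambda>t. (u + t * v) mod int a) {t \<in> {0..<int a}. coprime (u + t * v) (int a)}
      {y \<in> {0..<int a}. coprime y (int a)}"
    by (rule bij_betw_Collect) (simp add: coprime_mod_left_iff assms)
  then have "card {t \<in> {0..<int a}. coprime (u + t * v) (int a)} = card {y \<in> {0..<int a}. coprime y (int a)}"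
    by (rule bij_betw_same_card)
  also have "{y \<in> {0..<int a}. coprime y (int a)} = int ` {y \<in> {0..<a}. coprime y a}"
  proof (intro equalityI subsetI)
    fix y assume "y \<in> {y \<in> {0..<int a}. coprime y (int a)}"
    then show "y \<in> int ` {y \<in> {0..<a}. coprime y a}"
      by (intro image_eqI[of _ _ "nat y"]) (auto simp flip: coprime_int_iff)
  qed auto
  also have "card \<dots> = card {y \<in> {0..<a}. coprime y a}" by (rule card_image) auto
  also have "\<dots> = totient a"
  \<comment> \<open>Residues are represented from 0, totatives from 1; the two sets differ only for
    \<open>a = 1\<close>, where each has one element.\<close>
  proof (cases "a = 1")
    case True
    have "{y \<in> {0..<Suc 0}. coprime y (Suc 0)} = {0}" by auto
    then show ?thesis using True by simp
  next
    case False
    have "{y \<in> {0..<a}. coprime y a} = totatives a"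
      using False assms(1) by (auto simp: totatives_def le_less intro!: Nat.gr0I)
    then show ?thesis by (simp add: totient_def)
  qed
  finally show ?thesis .
qed

text \<open>Along the lifts \<open>c + a t\<close> of a root \<open>c\<close> modulo \<open>a\<close>, the cofactor \<open>P(c + a t) / a\<close> is affine in \<open>t\<close>
  modulo \<open>a\<close>, with slope \<open>P'(c)\<close>.\<close>
lemma card_exact_roots_ge:
  fixes P :: "int poly" and a :: nat
  assumes "a > 0" "\<And>c. int a dvd poly P c \<Longrightarrow> coprime (poly (pderiv P) c) (int a)"
  shows "root_count P a * real (totient a) \<le>
    real (card {c \<in> {0..<int a ^ 2}. int a dvd poly P c \<and> coprime (poly P c div int a) (int a)})"
proof -
  define X where "X = {c \<in> {0..<int a}. int a dvd poly P c}"
  define T where "T c = {t \<in> {0..<int a}. coprime (poly P c div int a + t * poly (pderiv P) c) (int a)}" for c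
  have val: "int a dvd poly P (c + int a * t) \<and>
      (coprime (poly P (c + int a * t) div int a) (int a) \<longleftrightarrow> coprime (poly P c div int a + t * poly (pderiv P) c) (int a))"
    if c: "int a dvd poly P c" for c t
  proof -
    obtain u where u: "poly P c = int a * u" using c by (auto simp: dvd_def)
    obtain k where "poly P (c + int a * t) - poly P c - int a * t * poly (pderiv P) c = (int a * t)\<^sup>2 * k"
      using poly_second_order[of "int a * t" P c] by (auto simp: dvd_def)
    then have eq: "poly P (c + int a * t) = int a * (u + t * poly (pderiv P) c + int a * (t\<^sup>2 * k))"
      using u by (simp add: power2_eq_square algebra_simps)
    have "coprime (u + t * poly (pderiv P) c + int a * (t\<^sup>2 * k)) (int a) \<longleftrightarrow> coprime (u + t * poly (pderiv P) c) (int a)"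
      by (rule coprime_add_mult_self)
    then show ?thesis using eq u assms(1) by simp
  qed
  have "card (Sigma X T) = (\<Sum>c\<in>X. card (T c))"
    by (rule card_SigmaI) (auto simp: X_def T_def intro: finite_subset[of _ "{0..<int a}"])
  also have "\<dots> = (\<Sum>c\<in>X. totient a)"
    unfolding T_def using assms by (intro sum.cong refl card_coprime_affine) (auto simp: X_def)
  finally have cardS: "card (Sigma X T) = card X * totient a" by simp
  have "inj_on (\<lambda>(c, t). c + int a * t) (Sigma X T)"
  proof (rule inj_onI, clarify)
    fix c t c' t' assume h: "c \<in> X" "t \<in> T c" "c' \<in> X" "t' \<in> T c'" "c + int a * t = c' + int a * t'"
    have "(c + int a * t) mod int a = (c' + int a * t') mod int a" using h(5) by (rule arg_cong)
    then have "c = c'" using h(1,3) by (simp add: X_def)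
    then show "c = c' \<and> t = t'" using h(5) assms(1) by simp
  qed
  moreover have "(\<lambda>(c, t). c + int a * t) ` Sigma X T \<subseteq>
      {c \<in> {0..<int a ^ 2}. int a dvd poly P c \<and> coprime (poly P c div int a) (int a)}"
  proof clarify
    fix c t assume h: "c \<in> X" "t \<in> T c"
    have "int a dvd poly P c" using h(1) by (simp add: X_def)
    moreover have "c + int a * t \<in> {0..<int a ^ 2}"
    proof -
      have "int a * t \<le> int a * (int a - 1)" using h by (intro mult_left_mono) (auto simp: T_def)
      then show ?thesis using h by (auto simp: X_def T_def power2_eq_square algebra_simps)
    qed
    ultimately show "c + int a * t \<in> {0..<int a ^ 2} \<and> int a dvd poly P (c + int a * t)
        \<and> coprime (poly P (c + int a * t) div int a) (int a)"
      using val[of c t] h(2) by (auto simp: T_def)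
  qed
  ultimately have "card (Sigma X T) \<le> card {c \<in> {0..<int a ^ 2}. int a dvd poly P c \<and> coprime (poly P c div int a) (int a)}"
    by (intro card_inj_on_le) (auto intro: finite_subset[of _ "{0..<int a ^ 2}"])
  then have "real (card X * totient a) \<le> real (card {c \<in> {0..<int a ^ 2}. int a dvd poly P c \<and> coprime (poly P c div int a) (int a)})"
    using cardS by (metis of_nat_mono)
  then show ?thesis by (simp add: root_count_def X_def)
qed

section \<open>Common roots and the resultant\<close>

lemma poly_eq_sum_lessThan:
  fixes p :: "'a::comm_semiring_1 poly"
  assumes "degree p < N"
  shows "poly p x = (\<Sum>i<N. coeff p i * x ^ i)"
proof -
  have "{..degree p} \<subseteq> {..<N}" using assms by auto
  then show ?thesis
    unfolding poly_altdef by (intro sum.mono_neutral_left) (auto simp: coeff_eq_0)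
qed

text \<open>The Sylvester matrix maps the vector of descending powers of \<open>x\<close> to
  multiples of \<open>P(x)\<close> and \<open>Q(x)\<close>, all divisible by \<open>m\<close>.
  Multiplying by the adjugate gives the determinant times that vector, whose last entry is
  \<open>x ^ 0 = 1\<close>.\<close>

lemma dvd_resultant:
  fixes P Q :: "int poly"
  assumes "m dvd poly P x" "m dvd poly Q x" "degree P + degree Q > 0"
  shows "m dvd resultant P Q"
proof -
  define N where "N = degree P + degree Q"
  define A where "A = sylvester_mat P Q"
  have A: "A \<in> carrier_mat N N" unfolding A_def N_def by (rule sylvester_carrier_mat)
  define v where "v = vec N (\<lambda>j. x ^ (N - Suc j))"
  have v: "v \<in> carrier_vec N" by (simp add: v_def)
  have N: "N > 0" using assms(3) by (simp add: N_def)
  have row: "m dvd (A *\<^sub>v v) $ i" if i: "i < N" for i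
  proof -
    define R where "R = (if i < degree Q then monom 1 (degree Q - Suc i) * P else monom 1 (N - Suc i) * Q)"
    have ent: "A $$ (i, j) = coeff R (N - Suc j)" if "j < N" for j
    proof -
      have "N - j = Suc (N - Suc j)" using that by simp
      moreover have "degree Q - i = Suc (degree Q - Suc i)" if "i < degree Q" using that by simp
      moreover have "N - i = Suc (N - Suc i)" using i by simp
      ultimately show ?thesis
        using i that unfolding A_def N_def
        by (subst sylvester_index_mat2) (auto simp: R_def N_def coeff_monom_mult)
    qed
    have degR: "degree R < N"
    proof (cases "i < degree Q")
      case True
      have "degree (monom 1 (degree Q - Suc i) * P) \<le> degree (monom (1::int) (degree Q - Suc i)) + degree P"
        by (rule degree_mult_le)
      then show ?thesis using True N by (simp add: R_def N_def degree_monom_eq)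
    next
      case False
      have "degree (monom 1 (N - Suc i) * Q) \<le> degree (monom (1::int) (N - Suc i)) + degree Q"
        by (rule degree_mult_le)
      then show ?thesis using False i N by (simp add: R_def N_def degree_monom_eq)
    qed
    have "(A *\<^sub>v v) $ i = (\<Sum>j<N. A $$ (i, j) * x ^ (N - Suc j))"
      using A i by (simp add: scalar_prod_def v_def atLeast0LessThan)
    also have "\<dots> = (\<Sum>j<N. coeff R (N - Suc j) * x ^ (N - Suc j))"
      by (intro sum.cong refl) (simp add: ent)
    also have "\<dots> = poly R x"
      unfolding poly_eq_sum_lessThan[OF degR] by (rule sum.nat_diff_reindex)
    finally show ?thesis using assms by (auto simp: R_def poly_monom)
  qed
  have "(adj_mat A * A) *\<^sub>v v = adj_mat A *\<^sub>v (A *\<^sub>v v)"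
    by (rule assoc_mult_mat_vec[OF adj_mat(1)[OF A] A v])
  then have "adj_mat A *\<^sub>v (A *\<^sub>v v) = (det A \<cdot>\<^sub>m 1\<^sub>m N) *\<^sub>v v" using adj_mat(3)[OF A] by simp
  also have "\<dots> = det A \<cdot>\<^sub>v v" using v by (intro eq_vecI) (auto simp: scalar_prod_def if_distrib[of "\<lambda>x. _ * x"] if_distrib[of "\<lambda>x. x * _"] cong: if_cong)
  finally have eq: "adj_mat A *\<^sub>v (A *\<^sub>v v) = det A \<cdot>\<^sub>v v" .
  have "det A = (det A \<cdot>\<^sub>v v) $ (N - 1)" using N by (simp add: v_def)
  also have "\<dots> = (adj_mat A *\<^sub>v (A *\<^sub>v v)) $ (N - 1)" by (simp add: eq)
  also have "\<dots> = (\<Sum>j<N. adj_mat A $$ (N - 1, j) * (A *\<^sub>v v) $ j)"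
    using adj_mat(1)[OF A] A N
    by (subst index_mult_mat_vec) (auto simp: scalar_prod_def atLeast0LessThan simp del: index_mult_mat_vec)
  also have "m dvd \<dots>" by (intro dvd_sum dvd_mult row) auto
  finally show ?thesis by (simp add: resultant_def A_def)
qed


section \<open>The Brun--Hooley sieve\<close>

definition esym :: "nat \<Rightarrow> 'a set \<Rightarrow> ('a \<Rightarrow> real) \<Rightarrow> real" where
  "esym n S h = (\<Sum>D | D \<subseteq> S \<and> card D = n. \<Prod>p\<in>D. h p)"

text \<open>Inclusion-exclusion for the product of the \<open>1 - h p\<close>, cut off before degree
  \<open>n\<close>. Because the bound on \<open>card D\<close> is strict, odd \<open>n\<close> gives
  an upper bound and even \<open>n\<close> a lower bound when the weights lie in
  \<open>[0, 1]\<close>.\<close>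

definition alt_esym :: "nat \<Rightarrow> 'a set \<Rightarrow> ('a \<Rightarrow> real) \<Rightarrow> real" where
  "alt_esym n S h = (\<Sum>D | D \<subseteq> S \<and> card D < n. (-1) ^ card D * (\<Prod>p\<in>D. h p))"

lemma esym_0 [simp]: "finite S \<Longrightarrow> esym 0 S h = 1"
proof -
  assume "finite S"
  then have "{D. D \<subseteq> S \<and> card D = 0} = {{}}" by (auto dest: finite_subset)
  then show ?thesis by (simp add: esym_def)
qed

lemma alt_esym_0 [simp]: "alt_esym 0 S h = 0"
  by (simp add: alt_esym_def)

lemma alt_esym_Suc:
  assumes "finite S"
  shows "alt_esym (Suc n) S h = alt_esym n S h + (-1) ^ n * esym n S h"
proof -
  have "{D. D \<subseteq> S \<and> card D < Suc n} = {D. D \<subseteq> S \<and> card D < n} \<union> {D. D \<subseteq> S \<and> card D = n}" by auto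
  then have "alt_esym (Suc n) S h = alt_esym n S h + (\<Sum>D | D \<subseteq> S \<and> card D = n. (-1) ^ card D * (\<Prod>p\<in>D. h p))"
    unfolding alt_esym_def using assms by (simp add: sum.union_disjoint disjoint_iff)
  then show ?thesis by (simp add: esym_def sum_distrib_left)
qed

lemma esym_insert:
  assumes "finite S" "p \<notin> S"
  shows "esym (Suc n) (insert p S) h = esym (Suc n) S h + h p * esym n S h"
proof -
  have fin: "finite D" if "D \<subseteq> S" for D using that assms finite_subset by blast
  have "{D. D \<subseteq> insert p S \<and> card D = Suc n} =
      {D. D \<subseteq> S \<and> card D = Suc n} \<union> insert p ` {D. D \<subseteq> S \<and> card D = n}"
  proof (intro equalityI subsetI)
    fix D assume D: "D \<in> {D. D \<subseteq> insert p S \<and> card D = Suc n}"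
    show "D \<in> {D. D \<subseteq> S \<and> card D = Suc n} \<union> insert p ` {D. D \<subseteq> S \<and> card D = n}"
    proof (cases "p \<in> D")
      case True
      then have "D = insert p (D - {p})" "D - {p} \<subseteq> S" "card (D - {p}) = n" using D by auto
      then show ?thesis by blast
    qed (use D in auto)
  next
    fix D assume "D \<in> {D. D \<subseteq> S \<and> card D = Suc n} \<union> insert p ` {D. D \<subseteq> S \<and> card D = n}"
    then show "D \<in> {D. D \<subseteq> insert p S \<and> card D = Suc n}"
      using assms fin by (auto simp: card_insert_if)
  qed
  then have "esym (Suc n) (insert p S) h = esym (Suc n) S h + (\<Sum>D\<in>insert p ` {D. D \<subseteq> S \<and> card D = n}. \<Prod>q\<in>D. h q)"
    unfolding esym_def using assms by (simp add: sum.union_disjoint disjoint_iff image_iff) (auto intro!: sum.union_disjoint)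
  also have "(\<Sum>D\<in>insert p ` {D. D \<subseteq> S \<and> card D = n}. \<Prod>q\<in>D. h q) = (\<Sum>D | D \<subseteq> S \<and> card D = n. \<Prod>q\<in>insert p D. h q)"
    by (rule sum.reindex[unfolded o_def]) (use assms(2) in \<open>auto intro!: inj_onI\<close>)
  also have "\<dots> = (\<Sum>D | D \<subseteq> S \<and> card D = n. h p * (\<Prod>q\<in>D. h q))"
    using assms fin by (intro sum.cong refl prod.insert) auto
  finally show ?thesis by (simp add: esym_def sum_distrib_left)
qed

lemma alt_esym_insert:
  assumes "finite S" "p \<notin> S"
  shows "alt_esym (Suc n) (insert p S) h = alt_esym (Suc n) S h - h p * alt_esym n S h"
proof (induction n)
  case 0
  show ?case using assms by (simp add: alt_esym_Suc)
next
  case (Suc n)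
  have "alt_esym (Suc (Suc n)) (insert p S) h =
      alt_esym (Suc n) (insert p S) h + (-1) ^ Suc n * esym (Suc n) (insert p S) h"
    using assms by (intro alt_esym_Suc) simp
  also have "\<dots> = alt_esym (Suc (Suc n)) S h - h p * alt_esym (Suc n) S h"
    unfolding Suc esym_insert[OF assms] alt_esym_Suc[OF assms(1), of "Suc n"] alt_esym_Suc[OF assms(1), of n]
    by (simp add: algebra_simps)
  finally show ?case .
qed

lemma alt_esym_empty: "n > 0 \<Longrightarrow> alt_esym n {} h = 1"
proof -
  assume "n > 0"
  then have "{D. D \<subseteq> ({}::'a set) \<and> card D < n} = {{}}" by auto
  then show ?thesis by (simp add: alt_esym_def)
qed

text \<open>Bonferroni's inequalities for weights in \<open>[0, 1]\<close>, to be applied both to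
  indicators and to densities. In the recursion for \<open>insert p S\<close> the term of index
  \<open>k\<close> enters with a negative sign and has parity opposite to \<open>Suc k\<close>, so
  both induction hypotheses point the same way.\<close>

lemma bonferroni_alt_esym:
  assumes "finite S" "\<And>p. p \<in> S \<Longrightarrow> 0 \<le> h p \<and> h p \<le> 1"
  shows "(odd n \<longrightarrow> (\<Prod>p\<in>S. 1 - h p) \<le> alt_esym n S h) \<and> (even n \<longrightarrow> alt_esym n S h \<le> (\<Prod>p\<in>S. 1 - h p))"
  using assms
proof (induction S arbitrary: n)
  case empty
  then show ?case by (cases "n = 0") (auto simp: alt_esym_empty)
next
  case (insert p S)
  have e: "0 \<le> (\<Prod>p\<in>insert p S. 1 - h p)" using insert(4) by (intro prod_nonneg) auto
  show ?case
  proof (cases n)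
    case 0
    then show ?thesis using e by simp
  next
    case (Suc k)
    have IH: "(odd n \<longrightarrow> (\<Prod>p\<in>S. 1 - h p) \<le> alt_esym n S h) \<and> (even n \<longrightarrow> alt_esym n S h \<le> (\<Prod>p\<in>S. 1 - h p))" for n
      using insert by simp
    have hp: "h p \<ge> 0" using insert(4) by simp
    have eq: "(\<Prod>p\<in>insert p S. 1 - h p) = (\<Prod>p\<in>S. 1 - h p) - h p * (\<Prod>p\<in>S. 1 - h p)"
      using insert by (simp add: algebra_simps)
    show ?thesis unfolding eq unfolding Suc alt_esym_insert[OF insert(1,2)]
      using IH[of "Suc k"] IH[of k] mult_left_mono[OF _ hp, of "alt_esym k S h" "\<Prod>p\<in>S. 1 - h p"]
        mult_left_mono[OF _ hp, of "\<Prod>p\<in>S. 1 - h p" "alt_esym k S h"]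
      by fastforce
  qed
qed

lemma power_add_ge_two_terms:
  fixes s w :: real
  assumes "s \<ge> 0" "w \<ge> 0"
  shows "s ^ Suc k + real (Suc k) * w * s ^ k \<le> (s + w) ^ Suc k"
proof (induction k)
  case (Suc k)
  have "s ^ Suc (Suc k) + real (Suc (Suc k)) * w * s ^ Suc k
      \<le> s ^ Suc (Suc k) + real (Suc (Suc k)) * w * s ^ Suc k + real (Suc k) * w\<^sup>2 * s ^ k"
    using assms by simp
  also have "\<dots> = (s + w) * (s ^ Suc k + real (Suc k) * w * s ^ k)"
    by (simp add: algebra_simps power2_eq_square)
  also have "\<dots> \<le> (s + w) * (s + w) ^ Suc k" using assms by (intro mult_left_mono Suc) auto
  finally show ?case by simp
qed simp

text \<open>The power of the sum contains each product over an \<open>n\<close>-element subset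
  \<open>fact n\<close> times; in the induction on \<open>S\<close> this reduces to keeping two
  terms of the binomial expansion.\<close>

lemma esym_le:
  assumes "finite S" "\<And>p. p \<in> S \<Longrightarrow> h p \<ge> 0"
  shows "esym n S h \<le> (\<Sum>p\<in>S. h p) ^ n / fact n"
  using assms
proof (induction S arbitrary: n)
  case empty
  have "{D. D \<subseteq> ({}::'a set) \<and> card D = n} = (if n = 0 then {{}} else {})" by auto
  then show ?case by (simp add: esym_def)
next
  case (insert p S)
  define s where "s = (\<Sum>p\<in>S. h p)"
  have s: "s \<ge> 0" "h p \<ge> 0" unfolding s_def using insert by (auto intro: sum_nonneg)
  show ?case
  proof (cases n)
    case 0
    then show ?thesis using insert by simp
  next
    case (Suc k)
    have IH: "esym n S h \<le> s ^ n / fact n" for n using insert unfolding s_def by auto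
    have "esym n (insert p S) h \<le> s ^ Suc k / fact (Suc k) + h p * (s ^ k / fact k)"
      unfolding Suc esym_insert[OF insert(1,2)]
      by (intro add_mono mult_left_mono IH s)
    also have "\<dots> = (s ^ Suc k + real (Suc k) * h p * s ^ k) / fact (Suc k)"
      by (simp add: add_divide_distrib del: of_nat_Suc power_Suc)
    also have "\<dots> \<le> (s + h p) ^ Suc k / fact (Suc k)"
      using power_add_ge_two_terms[OF s] by (intro divide_right_mono) auto
    finally show ?thesis using insert by (simp add: s_def Suc add.commute)
  qed
qed

text \<open>Replacing \<open>h\<close> by \<open>- w\<close> makes all signs positive, so the left
  side sums the products of \<open>w\<close> over all sets of fewer than \<open>n\<close> elements.
  When \<open>w\<close> counts residue classes, this is the accumulated error of the truncated
  inclusion-exclusion.\<close>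

lemma alt_esym_uminus_le:
  assumes "finite S" "\<And>p. p \<in> S \<Longrightarrow> w p \<ge> 0"
  shows "alt_esym n S (\<lambda>p. - w p) \<le> (1 + (\<Sum>p\<in>S. w p)) ^ n"
  using assms
proof (induction S arbitrary: n)
  case empty
  then show ?case by (cases "n = 0") (auto simp: alt_esym_empty)
next
  case (insert p S)
  define s where "s = (\<Sum>p\<in>S. w p)"
  have s: "s \<ge> 0" "w p \<ge> 0" unfolding s_def using insert by (auto intro: sum_nonneg)
  show ?case
  proof (cases n)
    case (Suc k)
    have "alt_esym n (insert p S) (\<lambda>p. - w p) \<le> (1 + s) ^ Suc k + w p * (1 + s) ^ k"
      unfolding Suc alt_esym_insert[OF insert(1,2)] s_def using insert
      by (auto intro!: add_mono mult_left_mono simp del: power_Suc)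
    also have "\<dots> = (1 + s) ^ k * (1 + s + w p)" by (simp add: algebra_simps)
    also have "\<dots> \<le> (1 + s + w p) ^ k * (1 + s + w p)"
      using s by (intro mult_right_mono power_mono) auto
    finally show ?thesis using insert by (simp add: s_def Suc add_ac mult.commute)
  qed simp
qed

text \<open>\<open>F\<close> is a combination of the indicators of the sets \<open>\<Inter>p\<in>D. A p\<close>; if \<open>A p\<close> consists of \<open>w p\<close> residue classes
  modulo \<open>p\<close>, then \<open>d\<close> is the mean value of \<open>F\<close>, and \<open>c\<close> bounds the error made in summing \<open>F\<close> over an interval.\<close>
definition sieve_expansion ::
  "nat set \<Rightarrow> (nat \<Rightarrow> int set) \<Rightarrow> (nat \<Rightarrow> real) \<Rightarrow> (int \<Rightarrow> real) \<Rightarrow> real \<Rightarrow> real \<Rightarrow> bool" where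
  "sieve_expansion S A w F d c \<longleftrightarrow> (\<exists>\<mu> :: nat set \<Rightarrow> real.
     (\<forall>m. F m = (\<Sum>D\<in>Pow S. \<mu> D * (\<Prod>p\<in>D. of_bool (m \<in> A p)))) \<and>
     d = (\<Sum>D\<in>Pow S. \<mu> D * (\<Prod>p\<in>D. w p / real p)) \<and>
     (\<Sum>D\<in>Pow S. \<bar>\<mu> D\<bar> * (\<Prod>p\<in>D. w p)) \<le> c)"

lemma sum_Pow_Un_prod:
  fixes f g :: "nat set \<Rightarrow> real"
  assumes "finite S" "finite T" "S \<inter> T = {}"
  shows "(\<Sum>D\<in>Pow (S \<union> T). (f (D \<inter> S) * g (D \<inter> T)) * (\<Prod>p\<in>D. h p)) =
    (\<Sum>D\<in>Pow S. f D * (\<Prod>p\<in>D. h p)) * (\<Sum>D\<in>Pow T. g D * (\<Prod>p\<in>D. h p))"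
proof -
  have "(\<Sum>D\<in>Pow S. f D * (\<Prod>p\<in>D. h p)) * (\<Sum>D\<in>Pow T. g D * (\<Prod>p\<in>D. h p)) =
      (\<Sum>(D, E)\<in>Pow S \<times> Pow T. (f D * (\<Prod>p\<in>D. h p)) * (g E * (\<Prod>p\<in>E. h p)))"
    by (simp add: sum_product sum.cartesian_product)
  also have "\<dots> = (\<Sum>D\<in>Pow (S \<union> T). (f (D \<inter> S) * g (D \<inter> T)) * (\<Prod>p\<in>D. h p))"
  proof (rule sum.reindex_bij_witness[of _ "\<lambda>D. (D \<inter> S, D \<inter> T)" "\<lambda>(D, E). D \<union> E"])
    fix x assume x: "x \<in> Pow S \<times> Pow T"
    obtain D E where DE: "x = (D, E)" "D \<subseteq> S" "E \<subseteq> T" using x by auto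
    have "(D \<union> E) \<inter> S = D" "(D \<union> E) \<inter> T = E" using DE assms(3) by auto
    moreover have "(\<Prod>p\<in>D \<union> E. h p) = (\<Prod>p\<in>D. h p) * (\<Prod>p\<in>E. h p)"
      using DE assms by (intro prod.union_disjoint) (auto dest: finite_subset)
    ultimately show "f ((case x of (D, E) \<Rightarrow> D \<union> E) \<inter> S) * g ((case x of (D, E) \<Rightarrow> D \<union> E) \<inter> T) *
        prod h (case x of (D, E) \<Rightarrow> D \<union> E) = (case x of (D, E) \<Rightarrow> f D * prod h D * (g E * prod h E))"
      using DE by simp
  qed (use assms in auto)
  finally show ?thesis by simp
qed

lemma sieve_expansion_mult:
  assumes "finite S" "finite T" "S \<inter> T = {}" "\<And>p. p \<in> S \<union> T \<Longrightarrow> w p \<ge> 0"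
    and "sieve_expansion S A w F a c" "sieve_expansion T A w G b d"
  shows "sieve_expansion (S \<union> T) A w (\<lambda>m. F m * G m) (a * b) (c * d)"
proof -
  obtain \<mu> where \<mu>: "\<And>m. F m = (\<Sum>D\<in>Pow S. \<mu> D * (\<Prod>p\<in>D. of_bool (m \<in> A p)))"
    "a = (\<Sum>D\<in>Pow S. \<mu> D * (\<Prod>p\<in>D. w p / real p))" "(\<Sum>D\<in>Pow S. \<bar>\<mu> D\<bar> * (\<Prod>p\<in>D. w p)) \<le> c"
    using assms(5) by (auto simp: sieve_expansion_def)
  obtain \<nu> where \<nu>: "\<And>m. G m = (\<Sum>D\<in>Pow T. \<nu> D * (\<Prod>p\<in>D. of_bool (m \<in> A p)))"
    "b = (\<Sum>D\<in>Pow T. \<nu> D * (\<Prod>p\<in>D. w p / real p))" "(\<Sum>D\<in>Pow T. \<bar>\<nu> D\<bar> * (\<Prod>p\<in>D. w p)) \<le> d"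
    using assms(6) by (auto simp: sieve_expansion_def)
  have nn: "0 \<le> (\<Sum>D\<in>Pow S. \<bar>\<mu> D\<bar> * (\<Prod>p\<in>D. w p))" "0 \<le> (\<Sum>D\<in>Pow T. \<bar>\<nu> D\<bar> * (\<Prod>p\<in>D. w p))"
    using assms(4) by (auto intro!: sum_nonneg mult_nonneg_nonneg prod_nonneg)
  have "(\<Sum>D\<in>Pow (S \<union> T). \<bar>\<mu> (D \<inter> S) * \<nu> (D \<inter> T)\<bar> * (\<Prod>p\<in>D. w p)) =
      (\<Sum>D\<in>Pow (S \<union> T). (\<bar>\<mu> (D \<inter> S)\<bar> * \<bar>\<nu> (D \<inter> T)\<bar>) * (\<Prod>p\<in>D. w p))" by (simp add: abs_mult)
  also have "\<dots> = (\<Sum>D\<in>Pow S. \<bar>\<mu> D\<bar> * (\<Prod>p\<in>D. w p)) * (\<Sum>D\<in>Pow T. \<bar>\<nu> D\<bar> * (\<Prod>p\<in>D. w p))"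
    by (rule sum_Pow_Un_prod[OF assms(1-3), of "\<lambda>D. \<bar>\<mu> D\<bar>" "\<lambda>D. \<bar>\<nu> D\<bar>"])
  also have "\<dots> \<le> c * d" using \<mu>(3) \<nu>(3) nn by (intro mult_mono) auto
  finally show ?thesis
    unfolding sieve_expansion_def \<mu>(1,2) \<nu>(1,2)
    by (intro exI[of _ "\<lambda>D. \<mu> (D \<inter> S) * \<nu> (D \<inter> T)"]) (simp add: sum_Pow_Un_prod[OF assms(1-3)])
qed

lemma sieve_expansion_diff:
  assumes "\<And>p. p \<in> S \<Longrightarrow> w p \<ge> 0"
    and "sieve_expansion S A w F a c" "sieve_expansion S A w G b d"
  shows "sieve_expansion S A w (\<lambda>m. F m - G m) (a - b) (c + d)"
proof -
  obtain \<mu> where \<mu>: "\<And>m. F m = (\<Sum>D\<in>Pow S. \<mu> D * (\<Prod>p\<in>D. of_bool (m \<in> A p)))"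
    "a = (\<Sum>D\<in>Pow S. \<mu> D * (\<Prod>p\<in>D. w p / real p))" "(\<Sum>D\<in>Pow S. \<bar>\<mu> D\<bar> * (\<Prod>p\<in>D. w p)) \<le> c"
    using assms(2) by (auto simp: sieve_expansion_def)
  obtain \<nu> where \<nu>: "\<And>m. G m = (\<Sum>D\<in>Pow S. \<nu> D * (\<Prod>p\<in>D. of_bool (m \<in> A p)))"
    "b = (\<Sum>D\<in>Pow S. \<nu> D * (\<Prod>p\<in>D. w p / real p))" "(\<Sum>D\<in>Pow S. \<bar>\<nu> D\<bar> * (\<Prod>p\<in>D. w p)) \<le> d"
    using assms(3) by (auto simp: sieve_expansion_def)
  have "(\<Sum>D\<in>Pow S. \<bar>\<mu> D - \<nu> D\<bar> * (\<Prod>p\<in>D. w p)) \<le>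
      (\<Sum>D\<in>Pow S. \<bar>\<mu> D\<bar> * (\<Prod>p\<in>D. w p) + \<bar>\<nu> D\<bar> * (\<Prod>p\<in>D. w p))"
    unfolding distrib_right[symmetric] using assms(1)
    by (intro sum_mono mult_right_mono abs_triangle_ineq4 prod_nonneg) auto
  also have "\<dots> \<le> c + d" using \<mu>(3) \<nu>(3) by (simp add: sum.distrib)
  finally show ?thesis
    unfolding sieve_expansion_def \<mu>(1,2) \<nu>(1,2)
    by (intro exI[of _ "\<lambda>D. \<mu> D - \<nu> D"]) (simp add: sum_subtractf left_diff_distrib)
qed

lemma sieve_expansion_alt_esym:
  assumes "finite S" "\<And>p. p \<in> S \<Longrightarrow> w p \<ge> 0"
  shows "sieve_expansion S A w (\<lambda>m. alt_esym n S (\<lambda>p. of_bool (m \<in> A p)))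
    (alt_esym n S (\<lambda>p. w p / real p)) ((1 + (\<Sum>p\<in>S. w p)) ^ n)"
proof -
  have eq: "alt_esym n S h = (\<Sum>D\<in>Pow S. (if card D < n then (-1) ^ card D else 0) * (\<Prod>p\<in>D. h p))" for h
    unfolding alt_esym_def using assms(1) by (intro sum.mono_neutral_cong_left) auto
  have "(\<Sum>D\<in>Pow S. \<bar>if card D < n then (-1) ^ card D else 0\<bar> * (\<Prod>p\<in>D. w p)) = alt_esym n S (\<lambda>p. - w p)"
    unfolding eq by (intro sum.cong refl) (auto simp: prod_uminus power_mult_distrib[symmetric] simp flip: mult.assoc)
  then show ?thesis
    unfolding sieve_expansion_def eq using alt_esym_uminus_le[OF assms, where n = n]
    by (intro exI[of _ "\<lambda>D. if card D < n then (-1) ^ card D else 0"]) (auto simp: eq)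
qed

text \<open>The error bound is kept equal to the one for \<open>alt_esym\<close>, so that a single
  \<open>C i\<close> serves both when the blocks are combined.\<close>

lemma sieve_expansion_esym:
  assumes "finite S" "\<And>p. p \<in> S \<Longrightarrow> w p \<ge> 0"
  shows "sieve_expansion S A w (\<lambda>m. esym n S (\<lambda>p. of_bool (m \<in> A p)))
    (esym n S (\<lambda>p. w p / real p)) ((1 + (\<Sum>p\<in>S. w p)) ^ n)"
proof -
  have eq: "esym n S h = (\<Sum>D\<in>Pow S. (if card D = n then 1 else 0) * (\<Prod>p\<in>D. h p))" for h
    unfolding esym_def using assms(1) by (intro sum.mono_neutral_cong_left) auto
  have s: "(\<Sum>p\<in>S. w p) \<ge> 0" using assms by (intro sum_nonneg)
  have "(\<Sum>D\<in>Pow S. \<bar>if card D = n then 1 else 0\<bar> * (\<Prod>p\<in>D. w p)) = esym n S w"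
    unfolding eq by (intro sum.cong refl) auto
  also have "\<dots> \<le> (\<Sum>p\<in>S. w p) ^ n / fact n" by (rule esym_le[OF assms])
  also have "\<dots> \<le> (\<Sum>p\<in>S. w p) ^ n / 1" using s by (intro divide_left_mono) auto
  also have "\<dots> \<le> (1 + (\<Sum>p\<in>S. w p)) ^ n" using s by (simp add: power_mono)
  finally show ?thesis
    unfolding sieve_expansion_def
    by (intro exI[of _ "\<lambda>D. if card D = n then 1 else 0"]) (auto simp: eq)
qed

lemma sieve_expansion_mono:
  assumes "sieve_expansion T A w F d c" "c \<le> c'"
  shows "sieve_expansion T A w F d c'"
proof -
  obtain \<mu> where \<mu>: "\<And>m. F m = (\<Sum>D\<in>Pow T. \<mu> D * (\<Prod>p\<in>D. of_bool (m \<in> A p)))"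
    "d = (\<Sum>D\<in>Pow T. \<mu> D * (\<Prod>p\<in>D. w p / real p))" "(\<Sum>D\<in>Pow T. \<bar>\<mu> D\<bar> * (\<Prod>p\<in>D. w p)) \<le> c"
    using assms(1) by (auto simp: sieve_expansion_def)
  show ?thesis
    unfolding sieve_expansion_def using \<mu> assms(2) by (intro exI[of _ \<mu>]) simp
qed

text \<open>Hooley's combination of blocks: if \<open>E \<le> U\<close> and \<open>L \<le> E\<close> for the first blocks and \<open>U' - Z' \<le> E' \<le> U'\<close> for
  the next one, then \<open>L U' - U Z' \<le> E E'\<close>.\<close>
lemma brun_hooley_expansion:
  fixes B :: "nat \<Rightarrow> nat set"
  assumes "\<And>i. odd (n i)" "\<And>i. i < t \<Longrightarrow> finite (B i)"
    and "\<And>i j. i < j \<Longrightarrow> j < t \<Longrightarrow> B i \<inter> B j = {}"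
    and "\<And>i p. i < t \<Longrightarrow> p \<in> B i \<Longrightarrow> 0 \<le> w p \<and> w p / real p \<le> 1"
    and "\<And>i. i < t \<Longrightarrow> (1 + (\<Sum>p\<in>B i. w p)) ^ n i \<le> C i"
    and "\<And>i. i < t \<Longrightarrow> esym (n i) (B i) (\<lambda>p. w p / real p) \<le> \<eta> i * (\<Prod>p\<in>B i. 1 - w p / real p)"
    and "\<And>i. \<eta> i \<ge> 0"
  shows "\<exists>L l. sieve_expansion (\<Union>i<t. B i) A w L l (real (t + 1) * (\<Prod>i<t. C i)) \<and>
    sieve_expansion (\<Union>i<t. B i) A w (\<lambda>m. \<Prod>i<t. alt_esym (n i) (B i) (\<lambda>p. of_bool (m \<in> A p)))
      (\<Prod>i<t. alt_esym (n i) (B i) (\<lambda>p. w p / real p)) (\<Prod>i<t. C i) \<and>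
    (\<forall>m. L m \<le> (\<Prod>i<t. \<Prod>p\<in>B i. 1 - of_bool (m \<in> A p))) \<and>
    (\<Prod>i<t. alt_esym (n i) (B i) (\<lambda>p. w p / real p)) * (1 - (\<Sum>i<t. \<eta> i)) \<le> l"
  using assms(2-6)
proof (induction t)
  case 0
  have "sieve_expansion {} A w (\<lambda>m. 1) 1 1"
    unfolding sieve_expansion_def by (intro exI[of _ "\<lambda>_. 1"]) simp
  then show ?case by (intro exI[of _ "\<lambda>_. 1"] exI[of _ 1]) simp
next
  case (Suc t)
  define S where "S = (\<Union>i<t. B i)"
  define U where "U m = (\<Prod>i<t. alt_esym (n i) (B i) (\<lambda>p. of_bool (m \<in> A p)))" for m
  define u where "u = (\<Prod>i<t. alt_esym (n i) (B i) (\<lambda>p. w p / real p))"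
  define E where "E m = (\<Prod>i<t. \<Prod>p\<in>B i. 1 - of_bool (m \<in> A p) :: real)" for m
  define U' where "U' m = alt_esym (n t) (B t) (\<lambda>p. of_bool (m \<in> A p))" for m
  define u' where "u' = alt_esym (n t) (B t) (\<lambda>p. w p / real p)"
  define E' where "E' m = (\<Prod>p\<in>B t. 1 - of_bool (m \<in> A p) :: real)" for m
  define Z where "Z m = esym (n t) (B t) (\<lambda>p. of_bool (m \<in> A p))" for m
  define \<zeta> where "\<zeta> = esym (n t) (B t) (\<lambda>p. w p / real p)"
  define K where "K = (\<Prod>i<t. C i)"
  have "\<exists>L l. sieve_expansion S A w L l (real (t + 1) * K) \<and> sieve_expansion S A w U u K \<and>
      (\<forall>m. L m \<le> E m) \<and> u * (1 - (\<Sum>i<t. \<eta> i)) \<le> l"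
    unfolding S_def U_def u_def E_def K_def
    by (rule Suc(1); (rule Suc(2-6); (rule less_SucI)?; assumption)?)
  then obtain L l where L: "sieve_expansion S A w L l (real (t + 1) * K)" "sieve_expansion S A w U u K"
    "\<And>m. L m \<le> E m" "u * (1 - (\<Sum>i<t. \<eta> i)) \<le> l"
    by blast
  have finB: "finite (B t)" using Suc(2) by blast
  have wB: "w p \<ge> 0" if "p \<in> B t" for p using Suc(4)[of t p] that by simp
  have finS: "finite S" using Suc(2) unfolding S_def by auto
  have disj: "S \<inter> B t = {}" using Suc(3)[of _ t] unfolding S_def by auto
  have wS: "w p \<ge> 0" if p: "p \<in> S \<union> B t" for p
  proof -
    obtain i where "i < Suc t" "p \<in> B i" using p unfolding S_def by (auto simp: less_Suc_eq)
    then show ?thesis using Suc(4)[of i p] by simp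
  qed
  have Ct: "(1 + (\<Sum>p\<in>B t. w p)) ^ n t \<le> C t" using Suc(5)[of t] by simp
  have mono: "sieve_expansion T A w F d c'" if "sieve_expansion T A w F d c" "c \<le> c'" for T F d c c'
    using that by (rule sieve_expansion_mono)
  have expU': "sieve_expansion (B t) A w U' u' (C t)"
    unfolding U'_def u'_def by (rule mono[OF sieve_expansion_alt_esym[OF finB wB] Ct])
  have expZ: "sieve_expansion (B t) A w Z \<zeta> (C t)"
    unfolding Z_def \<zeta>_def by (rule mono[OF sieve_expansion_esym[OF finB wB] Ct])
  have ind: "0 \<le> (of_bool (m \<in> A p) :: real) \<and> (of_bool (m \<in> A p) :: real) \<le> 1" for p m
    by auto
  have EU: "0 \<le> (\<Prod>p\<in>B i. 1 - of_bool (m \<in> A p) :: real)"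
    "(\<Prod>p\<in>B i. 1 - of_bool (m \<in> A p)) \<le> alt_esym (n i) (B i) (\<lambda>p. of_bool (m \<in> A p))"
    if "i < Suc t" for i m
    using bonferroni_alt_esym[of "B i" "\<lambda>p. of_bool (m \<in> A p)" "n i"] ind assms(1) Suc(2)[OF that]
    by (auto intro!: prod_nonneg)
  have 1: "0 \<le> E' m" "E' m \<le> U' m" "0 \<le> E m" "E m \<le> U m" for m
    unfolding E'_def U'_def E_def U_def using EU by (auto intro!: prod_nonneg prod_mono)
  \<comment> \<open>One more term of inclusion-exclusion, of even index \<open>Suc (n t)\<close>,
    turns the upper bound \<open>U'\<close> into a lower bound.\<close>
  have 2: "U' m - Z m \<le> E' m" for m
  proof -
    have "alt_esym (Suc (n t)) (B t) (\<lambda>p. of_bool (m \<in> A p)) \<le> E' m"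
      unfolding E'_def using bonferroni_alt_esym[of "B t" "\<lambda>p. of_bool (m \<in> A p)" "Suc (n t)"] ind assms(1) finB
      by auto
    then show ?thesis using assms(1)[of t] by (simp add: alt_esym_Suc[OF finB] U'_def Z_def)
  qed
  have "sieve_expansion (S \<union> B t) A w (\<lambda>m. L m * U' m - U m * Z m) (l * u' - u * \<zeta>)
      (real (t + 1) * K * C t + K * C t)"
    by (intro sieve_expansion_diff sieve_expansion_mult L expU' expZ finS finB disj wS) auto
  moreover have "sieve_expansion (S \<union> B t) A w (\<lambda>m. U m * U' m) (u * u') (K * C t)"
    by (intro sieve_expansion_mult L expU' finS finB disj wS)
  moreover have "L m * U' m - U m * Z m \<le> E m * E' m" for m
  proof -
    have "L m * U' m \<le> E m * U' m" using 1[of m] L(3)[of m] by (intro mult_right_mono) auto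
    moreover have "E m * (U' m - E' m) \<le> U m * Z m"
      using 1[of m] 2[of m] by (intro mult_mono) auto
    ultimately show ?thesis by (simp add: algebra_simps)
  qed
  \<comment> \<open>The same combination in terms of densities. Since \<open>\<zeta>\<close> is at
    most \<open>\<eta> t * u'\<close>, the new block adds \<open>\<eta> t\<close> to the relative
    loss, so the losses of the blocks simply add up.\<close>
  moreover have "(u * u') * (1 - (\<Sum>i<Suc t. \<eta> i)) \<le> l * u' - u * \<zeta>"
  proof -
    have bd: "0 \<le> w p / real p \<and> w p / real p \<le> 1" if "i < Suc t" "p \<in> B i" for i p
      using Suc(4)[OF that] by auto
    have pos: "(\<Prod>p\<in>B i. 1 - w p / real p) \<le> alt_esym (n i) (B i) (\<lambda>p. w p / real p)"
       "0 \<le> (\<Prod>p\<in>B i. 1 - w p / real p)" if "i < Suc t" for i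
      using bonferroni_alt_esym[of "B i" "\<lambda>p. w p / real p" "n i"] bd[OF that] assms(1) Suc(2)[OF that]
      by (auto intro!: prod_nonneg)
    have u': "0 \<le> u'" using pos[of t] by (simp add: u'_def)
    have u: "0 \<le> u" unfolding u_def using pos by (intro prod_nonneg) (meson lessThan_iff less_SucI order_trans)
    have "\<zeta> \<le> \<eta> t * (\<Prod>p\<in>B t. 1 - w p / real p)" unfolding \<zeta>_def using Suc(6)[of t] by simp
    also have "\<dots> \<le> \<eta> t * u'" unfolding u'_def using pos[of t] assms(7) by (intro mult_left_mono) auto
    finally have "u * \<zeta> \<le> u * (\<eta> t * u')" using u by (intro mult_left_mono)
    moreover have "u * (1 - (\<Sum>i<t. \<eta> i)) * u' \<le> l * u'" using L(4) u' by (intro mult_right_mono)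
    ultimately show ?thesis by (simp add: algebra_simps)
  qed
  moreover have "real (t + 1) * K * C t + K * C t = real (Suc t + 1) * (K * C t)" by (simp add: algebra_simps)
  moreover have "(\<Union>i<Suc t. B i) = S \<union> B t" unfolding S_def by (auto simp: less_Suc_eq)
  ultimately show ?case
    by (intro exI[of _ "\<lambda>m. L m * U' m - U m * Z m"] exI[of _ "l * u' - u * \<zeta>"])
       (simp add: U_def U'_def u_def u'_def E_def E'_def K_def)
qed

lemma card_Inter_periodic:
  fixes A :: "nat \<Rightarrow> int set"
  assumes "finite D" "\<And>p. p \<in> D \<Longrightarrow> prime p" "\<And>p x. p \<in> D \<Longrightarrow> x \<in> A p \<longleftrightarrow> x mod int p \<in> A p"
  shows "(\<forall>x. x \<in> (\<Inter>p\<in>D. A p) \<longleftrightarrow> x mod int (\<Prod>D) \<in> (\<Inter>p\<in>D. A p)) \<and>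
    card ((\<Inter>p\<in>D. A p) \<inter> {0..<int (\<Prod>D)}) = (\<Prod>p\<in>D. card (A p \<inter> {0..<int p}))"
  using assms
proof (induction D)
  case empty
  have "{0..<1::int} = {0}" by auto
  then show ?case by simp
next
  case (insert p D)
  define T where "T = (\<Inter>p\<in>D. A p)"
  have IH0: "(\<forall>x. x \<in> (\<Inter>p\<in>D. A p) \<longleftrightarrow> x mod int (\<Prod>D) \<in> (\<Inter>p\<in>D. A p)) \<and>
    card ((\<Inter>p\<in>D. A p) \<inter> {0..<int (\<Prod>D)}) = (\<Prod>p\<in>D. card (A p \<inter> {0..<int p}))"
  proof (rule insert(3))
    show "prime q" if "q \<in> D" for q using insert(4) that by blast
    show "x \<in> A q \<longleftrightarrow> x mod int q \<in> A q" if "q \<in> D" for q x using that by (intro insert(5)) blast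
  qed
  have IH: "x \<in> T \<longleftrightarrow> x mod int (\<Prod>D) \<in> T" "card (T \<inter> {0..<int (\<Prod>D)}) = (\<Prod>p\<in>D. card (A p \<inter> {0..<int p}))" for x
    using IH0 unfolding T_def by blast+
  have per: "x \<in> A p \<longleftrightarrow> x mod int p \<in> A p" for x by (rule insert(5)) simp
  have cop: "coprime p (\<Prod>D)"
    using insert(2,4) by (intro prod_coprime_right) (metis insertCI primes_coprime)
  have pos: "p > 0" "\<Prod>D > 0" using insert(4) by (auto intro!: prod_pos simp: prime_gt_0_nat)
  have "card (A p \<inter> T \<inter> {0..<int (p * \<Prod>D)}) = card (A p \<inter> {0..<int p}) * card (T \<inter> {0..<int (\<Prod>D)})"
    by (rule card_inter_periodic[OF cop pos per IH(1)])
  moreover have "x \<in> A p \<inter> T \<longleftrightarrow> x mod int (p * \<Prod>D) \<in> A p \<inter> T" for x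
  proof -
    have "x mod int (p * \<Prod>D) mod int p = x mod int p" "x mod int (p * \<Prod>D) mod int (\<Prod>D) = x mod int (\<Prod>D)"
      by (simp_all add: mod_mod_cancel del: of_nat_prod)
    then show ?thesis by (metis per IH(1) Int_iff)
  qed
  moreover have "(\<Inter>p\<in>insert p D. A p) = A p \<inter> T" "\<Prod>(insert p D) = p * \<Prod>D"
    using insert(1,2) by (auto simp: T_def)
  ultimately show ?case using insert(1,2) IH(2) by simp
qed

text \<open>Sum \<open>L\<close> over the interval. The intersection of the \<open>A p\<close> over
  \<open>p \<in> D\<close> is periodic modulo the product of \<open>D\<close> with the expected
  number of classes, so its count deviates from the mean by at most that number; weighted with the
  coefficients, these errors total at most \<open>c\<close>.\<close>

lemma card_sifted_ge:
  fixes A :: "nat \<Rightarrow> int set" and \<alpha> \<beta> :: real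
  assumes "finite S" "\<And>p. p \<in> S \<Longrightarrow> prime p" "\<And>p x. p \<in> S \<Longrightarrow> x \<in> A p \<longleftrightarrow> x mod int p \<in> A p"
    and "sieve_expansion S A (\<lambda>p. real (card (A p \<inter> {0..<int p}))) L l c" "\<alpha> \<le> \<beta>"
    and "\<And>m. L m \<le> (if \<forall>p\<in>S. m \<notin> A p then 1 else 0)"
  shows "l * (\<beta> - \<alpha>) - c \<le> real (card {m::int. \<alpha> < of_int m \<and> of_int m \<le> \<beta> \<and> (\<forall>p\<in>S. m \<notin> A p)})"
proof -
  define w where "w p = real (card (A p \<inter> {0..<int p}))" for p
  define J where "J = {m::int. \<alpha> < of_int m \<and> of_int m \<le> \<beta>}"
  have finJ: "finite J" unfolding J_def using finite_int_interval[of \<alpha> \<beta> "\<lambda>_. True"] by simp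
  obtain \<mu> where \<mu>: "\<And>m. L m = (\<Sum>D\<in>Pow S. \<mu> D * (\<Prod>p\<in>D. of_bool (m \<in> A p)))"
    "l = (\<Sum>D\<in>Pow S. \<mu> D * (\<Prod>p\<in>D. w p / real p))" "(\<Sum>D\<in>Pow S. \<bar>\<mu> D\<bar> * (\<Prod>p\<in>D. w p)) \<le> c"
    using assms(4) unfolding sieve_expansion_def w_def by blast
  define N where "N D = real (card {m::int. \<alpha> < of_int m \<and> of_int m \<le> \<beta> \<and> m \<in> (\<Inter>p\<in>D. A p)})" for D
  have N: "\<bar>N D - (\<beta> - \<alpha>) * (\<Prod>p\<in>D. w p / real p)\<bar> \<le> (\<Prod>p\<in>D. w p)" if "D \<in> Pow S" for D
  proof -
    have D: "finite D" "\<And>p. p \<in> D \<Longrightarrow> prime p" "\<And>p x. p \<in> D \<Longrightarrow> x \<in> A p \<longleftrightarrow> x mod int p \<in> A p"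
      using that assms(1-3) finite_subset by blast+
    have pos: "\<Prod>D > 0" using D(2) by (auto intro!: prod_pos simp: prime_gt_0_nat)
    have per: "x \<in> (\<Inter>p\<in>D. A p) \<longleftrightarrow> x mod int (\<Prod>D) \<in> (\<Inter>p\<in>D. A p)" for x
      using card_Inter_periodic[OF D] by blast
    have "card ((\<Inter>p\<in>D. A p) \<inter> {0..<int (\<Prod>D)}) = (\<Prod>p\<in>D. card (A p \<inter> {0..<int p}))"
      using card_Inter_periodic[OF D] by blast
    then have c: "real (card ((\<Inter>p\<in>D. A p) \<inter> {0..<int (\<Prod>D)})) = (\<Prod>p\<in>D. w p)"
      by (simp add: w_def)
    have "(\<Prod>p\<in>D. w p / real p) = (\<Prod>p\<in>D. w p) / real (\<Prod>D)" by (simp add: prod_dividef)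
    then show ?thesis
      using card_periodic_interval[OF pos assms(5) per] unfolding N_def c by simp
  qed
  have count: "(\<Sum>m\<in>J. \<Prod>p\<in>D. of_bool (m \<in> A p)) = N D" if "D \<in> Pow S" for D
  proof -
    have fD: "finite D" using that assms(1) finite_subset by auto
    have "(\<Prod>p\<in>D. of_bool (m \<in> A p) :: real) = (if m \<in> (\<Inter>p\<in>D. A p) then 1 else 0)" for m
      using fD by auto
    then have "(\<Sum>m\<in>J. \<Prod>p\<in>D. of_bool (m \<in> A p) :: real) = (\<Sum>m\<in>J. if m \<in> (\<Inter>p\<in>D. A p) then 1 else 0)" by simp
    also have "\<dots> = real (card {m \<in> J. m \<in> (\<Inter>p\<in>D. A p)})"
      using finJ by (simp add: sum.If_cases Int_def)
    also have "{m \<in> J. m \<in> (\<Inter>p\<in>D. A p)} = {m::int. \<alpha> < of_int m \<and> of_int m \<le> \<beta> \<and> m \<in> (\<Inter>p\<in>D. A p)}"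
      by (auto simp: J_def)
    finally show ?thesis by (simp add: N_def)
  qed
  have "l * (\<beta> - \<alpha>) - c \<le> (\<Sum>D\<in>Pow S. \<mu> D * ((\<beta> - \<alpha>) * (\<Prod>p\<in>D. w p / real p))) - (\<Sum>D\<in>Pow S. \<bar>\<mu> D\<bar> * (\<Prod>p\<in>D. w p))"
  proof -
    have "l * (\<beta> - \<alpha>) = (\<Sum>D\<in>Pow S. \<mu> D * ((\<beta> - \<alpha>) * (\<Prod>p\<in>D. w p / real p)))"
      unfolding \<mu>(2) sum_distrib_right by (intro sum.cong refl) (simp add: mult_ac)
    then show ?thesis using \<mu>(3) by linarith
  qed
  also have "\<dots> = (\<Sum>D\<in>Pow S. \<mu> D * ((\<beta> - \<alpha>) * (\<Prod>p\<in>D. w p / real p)) - \<bar>\<mu> D\<bar> * (\<Prod>p\<in>D. w p))"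
    by (simp add: sum_subtractf)
  also have "\<dots> \<le> (\<Sum>D\<in>Pow S. \<mu> D * N D)"
  proof (rule sum_mono)
    fix D assume D: "D \<in> Pow S"
    have "\<mu> D * ((\<beta> - \<alpha>) * (\<Prod>p\<in>D. w p / real p)) - \<mu> D * N D \<le> \<bar>\<mu> D * ((\<beta> - \<alpha>) * (\<Prod>p\<in>D. w p / real p)) - \<mu> D * N D\<bar>"
      by simp
    also have "\<dots> = \<bar>\<mu> D\<bar> * \<bar>N D - (\<beta> - \<alpha>) * (\<Prod>p\<in>D. w p / real p)\<bar>"
      by (simp add: abs_mult[symmetric] right_diff_distrib abs_minus_commute)
    also have "\<dots> \<le> \<bar>\<mu> D\<bar> * (\<Prod>p\<in>D. w p)" using N[OF D] by (intro mult_left_mono) auto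
    finally show "\<mu> D * ((\<beta> - \<alpha>) * (\<Prod>p\<in>D. w p / real p)) - \<bar>\<mu> D\<bar> * (\<Prod>p\<in>D. w p) \<le> \<mu> D * N D" by simp
  qed
  also have "\<dots> = (\<Sum>D\<in>Pow S. \<Sum>m\<in>J. \<mu> D * (\<Prod>p\<in>D. of_bool (m \<in> A p)))"
    by (intro sum.cong refl) (simp add: count[symmetric] sum_distrib_left)
  also have "\<dots> = (\<Sum>m\<in>J. L m)" unfolding \<mu>(1) by (rule sum.swap)
  also have "\<dots> \<le> (\<Sum>m\<in>J. if \<forall>p\<in>S. m \<notin> A p then 1 else 0)" by (intro sum_mono assms(6))
  also have "\<dots> = real (card {m \<in> J. \<forall>p\<in>S. m \<notin> A p})"
    using finJ by (simp add: sum.If_cases Int_def)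
  also have "{m \<in> J. \<forall>p\<in>S. m \<notin> A p} = {m::int. \<alpha> < of_int m \<and> of_int m \<le> \<beta> \<and> (\<forall>p\<in>S. m \<notin> A p)}"
    by (auto simp: J_def)
  finally show ?thesis .
qed

lemma exp_minus_two_le:
  fixes x :: real
  assumes "0 \<le> x" "x \<le> 1/2"
  shows "exp (- 2 * x) \<le> 1 - x"
proof -
  have "- 2 * x \<le> - x - 2 * x\<^sup>2"
    using mult_left_mono[OF assms(2,1)] by (simp add: power2_eq_square)
  also have "\<dots> \<le> ln (1 - x)" using assms by (intro ln_one_minus_pos_lower_bound)
  finally show ?thesis using assms by (subst (asm) ln_ge_iff) auto
qed

text \<open>Evaluates the exponent of the sieve error: block \<open>i\<close> is truncated at an
  index of the form \<open>N + 2 i\<close>, and its primes are at most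
  \<open>z powr (1 / 2 ^ i)\<close>.\<close>

lemma sum_arith_geometric:
  "(\<Sum>i<t. (N + 2 * real i) / 2 ^ i) = 2 * N + 4 - (2 * N + 4 + 4 * real t) / 2 ^ t"
proof (induction t)
  case (Suc t)
  show ?case unfolding sum.lessThan_Suc Suc by (simp add: field_simps)
qed simp

lemma double_le_of_fourth_power:
  fixes g :: nat and w :: real
  assumes "w \<ge> 2 ^ 28" "w \<ge> real g ^ 4"
  shows "2 * real g \<le> w"
proof (cases "g \<le> 1")
  case True
  then show ?thesis using assms(1) by simp
next
  case False
  then have "2 * real g \<le> real g * real g" by (intro mult_right_mono) auto
  also have "\<dots> \<le> real g ^ 4" using False power_increasing[of 2 4 "real g"] by (simp add: power2_eq_square)
  finally show ?thesis using assms(2) by linarith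
qed

text \<open>The endpoints \<open>z powr (1 / 2 ^ i)\<close> make every block of the form
  \<open>(w, w\<^sup>2]\<close>. The condition \<open>w0 \<ge> 2 ^ 28\<close> forces
  \<open>w \<ge> 2 ^ 14\<close> there, and \<open>w0 \<ge> g ^ 4\<close> lets a factor
  \<open>g\<close> be absorbed by the power \<open>1/4\<close> of the upper endpoint. The resulting
  exponents \<open>5/4 (12 g + 1 + 2 i) / 2 ^ i\<close> sum to less than \<open>30 g + 8\<close>,
  and one further unit pays for the factor \<open>t + 1\<close> of the combination of
  \<open>t\<close> blocks. The factor \<open>1/2\<close> is what the summed losses
  \<open>\<eta> i\<close> leave over.\<close>

lemma brun_hooley_sieve:
  fixes g :: nat and S :: "nat set" and A :: "nat \<Rightarrow> int set" and z w0 \<alpha> \<beta> :: real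
  assumes "g \<ge> 1" "w0 \<ge> 2 ^ 28" "w0 \<ge> real g ^ 4" "z \<ge> w0"
    and S: "\<And>p. p \<in> S \<Longrightarrow> prime p \<and> w0 < real p \<and> real p \<le> z"
    and per: "\<And>p x. p \<in> S \<Longrightarrow> x \<in> A p \<longleftrightarrow> x mod int p \<in> A p"
    and card_le: "\<And>p. p \<in> S \<Longrightarrow> card (A p \<inter> {0..<int p}) \<le> g"
    and "\<alpha> \<le> \<beta>"
  shows "(\<beta> - \<alpha>) / 2 * (\<Prod>p\<in>S. 1 - real (card (A p \<inter> {0..<int p})) / real p) - z powr (30 * real g + 9)
    \<le> real (card {m::int. \<alpha> < of_int m \<and> of_int m \<le> \<beta> \<and> (\<forall>p\<in>S. m \<notin> A p)})"
proof -
  define w where "w p = real (card (A p \<inter> {0..<int p}))" for p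
  define h where "h p = w p / real p" for p
  have w: "0 \<le> w p" "p \<in> S \<Longrightarrow> w p \<le> real g" for p
    using card_le by (auto simp: w_def)
  have w0: "w0 \<ge> 2" "w0 > 0" using assms(2) by auto
  have h: "0 \<le> h p" "h p \<le> 1/2" if p: "p \<in> S" for p
  proof -
    have "2 * w p \<le> real p" using double_le_of_fourth_power[OF assms(2,3)] S[OF p] w(2)[OF p] by linarith
    then show "h p \<le> 1/2" using S[OF p] w0 by (simp add: h_def field_simps)
  qed (simp add: h_def w)
  have finS: "finite S"
    by (rule finite_subset[OF _ finite_primes_upto[of z "\<lambda>_. True"]]) (use S in auto)
  have z: "z \<ge> 2" "z > 0" using assms(4) w0 by auto
  define zs where "zs i = z powr (1 / 2 ^ i)" for i :: nat
  have zs_pos: "zs i > 0" for i using z by (simp add: zs_def)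
  have zs_sq: "(zs (Suc i))\<^sup>2 = zs i" for i
    unfolding zs_def power2_eq_square powr_add[symmetric] by (simp add: field_simps)
  have zs_anti: "zs j \<le> zs i" if "i \<le> j" for i j
    unfolding zs_def using that z by (intro powr_mono divide_left_mono power_increasing) auto
  have "\<exists>t. zs t \<le> w0"
  proof -
    obtain t :: nat where t: "ln z / ln w0 < 2 ^ t" using real_arch_pow[of 2 "ln z / ln w0"] by auto
    have "ln w0 > 0" using w0 by simp
    then have "ln (zs t) \<le> ln w0" using t z by (simp add: zs_def ln_powr field_simps)
    then show ?thesis using zs_pos w0 by (auto simp: ln_le_cancel_iff)
  qed
  \<comment> \<open>The first index whose endpoint is at most \<open>w0\<close>; all earlier
    endpoints exceed \<open>w0\<close>, as the estimates for each block require.\<close>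
  define t where "t = (LEAST t. zs t \<le> w0)"
  have t: "zs t \<le> w0" unfolding t_def using \<open>\<exists>t. zs t \<le> w0\<close> by (rule LeastI_ex)
  have t_less: "w0 < zs i" if "i < t" for i
    using not_less_Least[of i "\<lambda>t. zs t \<le> w0"] that unfolding t_def by simp
  have zs_1: "zs i \<ge> 1" for i unfolding zs_def using z by (intro ge_one_powr_ge_zero) auto
  define B where "B i = {p \<in> S. zs (Suc i) < real p \<and> real p \<le> zs i}" for i
  have BS: "B i \<subseteq> S" and finB: "finite (B i)" for i using finS by (auto simp: B_def)
  have union: "(\<Union>i<t. B i) = S"
  proof (intro equalityI subsetI)
    fix p assume p: "p \<in> S"
    have ex: "zs t < real p" using S[OF p] t by linarith
    define j where "j = (LEAST j. zs j < real p)"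
    have j: "zs j < real p" "j \<le> t" unfolding j_def using ex by (auto intro: LeastI Least_le)
    have "j \<noteq> 0"
    proof
      assume "j = 0"
      then show False using j(1) S[OF p] z by (simp add: zs_def)
    qed
    then obtain i where i: "j = Suc i" by (cases j) auto
    have "\<not> zs i < real p" using not_less_Least[of i "\<lambda>j. zs j < real p"] i unfolding j_def by simp
    then have "p \<in> B i" using j i p by (auto simp: B_def)
    then show "p \<in> (\<Union>i<t. B i)" using i j by auto
  qed (use BS in auto)
  have disj: "B i \<inter> B j = {}" if "i < j" for i j
    using zs_anti[of "Suc i" j] that by (auto simp: B_def)
  \<comment> \<open>A block has \<open>\<Sum>h \<le> 16 g / 7\<close>, so truncating at \<open>12 g\<close> costs at most \<open>exp (16 g) / 5 ^ (12 g) \<le> 1\<close>; the term \<open>2 i\<close>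
    makes the losses summable over the blocks while keeping \<open>\<Sum>i. n i / 2 ^ i\<close> finite.\<close>
  define n :: "nat \<Rightarrow> nat" where "n i = 12 * g + 1 + 2 * i" for i
  define \<eta> :: "nat \<Rightarrow> real" where "\<eta> i = 1/5 * (1/25) ^ i" for i
  define C where "C i = zs i powr (5/4 * real (n i))" for i
  have prod_split: "(\<Prod>i<t. \<Prod>p\<in>B i. f p) = (\<Prod>p\<in>S. f p)" for f :: "nat \<Rightarrow> real"
    unfolding union[symmetric] using disj finB
    by (intro prod.UNION_disjoint[symmetric]) (auto, metis Int_iff empty_iff linorder_neqE_nat)
  have cost: "(1 + (\<Sum>p\<in>B i. w p)) ^ n i \<le> C i" if i: "i < t" for i
  proof -
    have "card (B i) \<le> card {2..nat \<lfloor>zs i\<rfloor>}"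
      using S zs_1[of i] BS[of i] by (intro card_mono) (auto simp: B_def le_nat_floor prime_ge_2_nat)
    then have "card (B i) + 1 \<le> nat \<lfloor>zs i\<rfloor>" using zs_1[of i] by simp linarith
    then have cB: "real (card (B i)) + 1 \<le> zs i" using zs_1[of i] by linarith
    have "1 + (\<Sum>p\<in>B i. w p) \<le> real g + (\<Sum>p\<in>B i. real g)"
      using assms(1) w BS by (intro add_mono sum_mono) auto
    also have "\<dots> = real g * (real (card (B i)) + 1)" by (simp add: algebra_simps)
    also have "\<dots> \<le> zs i powr (1/4) * zs i"
    proof (rule mult_mono)
      have "real g = (real g powr 4) powr (1/4)" unfolding powr_powr by simp
      also have "real g powr 4 = real g ^ 4" using assms(1) by (subst powr_numeral) auto
      also have "(real g ^ 4) powr (1/4) \<le> zs i powr (1/4)" using t_less[OF i] assms(3) by (intro powr_mono2) auto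
      finally show "real g \<le> zs i powr (1/4)" .
    qed (use cB in auto)
    also have "\<dots> = zs i powr (1/4) * zs i powr 1" using zs_pos[of i] by simp
    also have "\<dots> = zs i powr (5/4)" by (subst powr_add[symmetric]) simp
    finally have "(1 + (\<Sum>p\<in>B i. w p)) ^ n i \<le> (zs i powr (5/4)) ^ n i"
      using w by (intro power_mono) (auto intro!: add_nonneg_nonneg sum_nonneg)
    also have "\<dots> = C i" using zs_pos[of i] by (simp add: C_def powr_powr flip: powr_realpow)
    finally show ?thesis .
  qed
  have dens: "esym (n i) (B i) h \<le> \<eta> i * (\<Prod>p\<in>B i. 1 - h p)" if i: "i < t" for i
  proof -
    define L where "L = (\<Sum>p\<in>B i. h p)"
    have hB: "0 \<le> h p" "h p \<le> 1/2" if "p \<in> B i" for p using h BS that by auto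
    have L0: "0 \<le> L" unfolding L_def using hB by (intro sum_nonneg)
    have "L \<le> (\<Sum>p\<in>B i. real g * (1 / real p))"
      unfolding L_def h_def using w BS by (intro sum_mono) (auto simp: field_simps intro!: divide_right_mono)
    also have "\<dots> = real g * (\<Sum>p\<in>B i. 1 / real p)" by (simp add: sum_distrib_left)
    also have "\<dots> \<le> real g * (\<Sum>p | prime p \<and> zs (Suc i) < real p \<and> real p \<le> (zs (Suc i))\<^sup>2. 1 / real p)"
      unfolding zs_sq using S
      by (intro mult_left_mono sum_mono2)
         (auto simp: B_def intro: finite_subset[OF _ finite_primes_upto[of "zs i" "\<lambda>_. True"]])
    also have "\<dots> \<le> real g * (16/7)"
    proof (intro mult_left_mono sum_inverse_primes_square)
      have "(2 ^ 14)\<^sup>2 \<le> (zs (Suc i))\<^sup>2" using t_less[OF i] assms(2) by (simp add: zs_sq)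
      then show "2 ^ 14 \<le> zs (Suc i)" by (rule power2_le_imp_le) (use zs_pos in \<open>auto intro: less_imp_le\<close>)
    qed simp
    finally have L: "7 * L \<le> 16 * real g" by simp
    \<comment> \<open>A single term of the exponential series is at most \<open>exp (5 L)\<close>,
      which yields a saving of \<open>5 ^ n i\<close>. Writing \<open>5 L = 7 L - 2 L\<close>, the
      part \<open>7 L \<le> 16 g\<close> is paid for by \<open>5 ^ (12 g)\<close>, and
      \<open>exp (- 2 L)\<close> is at most the product of the \<open>1 - h p\<close>.\<close>
    have "L ^ n i / fact (n i) * 5 ^ n i = (5 * L) ^ n i / fact (n i)" by (simp add: power_mult_distrib)
    also have "\<dots> \<le> exp (5 * L)"
    proof -
      have "(5 * L) ^ n i / fact (n i) = (5 * L) ^ n i /\<^sub>R fact (n i)"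
        by (simp add: divide_inverse mult.commute)
      also have "\<dots> \<le> (\<Sum>k<Suc (n i). (5 * L) ^ k /\<^sub>R fact k)"
        using L0 by (intro member_le_sum[of "n i" "{..<Suc (n i)}" "\<lambda>k. (5 * L) ^ k /\<^sub>R fact k"]) auto
      also have "\<dots> \<le> exp (5 * L)"
        unfolding exp_def using L0 by (intro sum_le_suminf summable_exp_generic) auto
      finally show ?thesis .
    qed
    finally have e: "L ^ n i / fact (n i) \<le> exp (5 * L) / 5 ^ n i" by (simp add: field_simps)
    have "exp (5 * L) / 5 ^ n i = exp (7 * L) * exp (- 2 * L) / 5 ^ n i"
      by (simp flip: exp_add)
    also have "\<dots> \<le> exp (16 * real g) * exp (- 2 * L) / 5 ^ n i"
      using L by (intro divide_right_mono mult_right_mono) auto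
    also have "exp (16 * real g) \<le> (5 ^ 12) ^ g"
    proof -
      have "exp (16::real) = exp 1 ^ 16" by (simp flip: exp_of_nat_mult)
      also have "\<dots> \<le> 3 ^ 16" using exp_le by (intro power_mono) auto
      also have "\<dots> \<le> (5 ^ 12 :: real)" by simp
      finally have "exp (16::real) ^ g \<le> (5 ^ 12) ^ g" by (intro power_mono) auto
      then show ?thesis by (simp add: mult.commute flip: exp_of_nat_mult)
    qed
    then have "exp (16 * real g) * exp (- 2 * L) / 5 ^ n i \<le> (5 ^ 12) ^ g * exp (- 2 * L) / 5 ^ n i"
      by (intro divide_right_mono mult_right_mono) auto
    also have "\<dots> = \<eta> i * exp (- 2 * L)"
    proof -
      have "(5::real) ^ n i = (5 ^ 12) ^ g * (5 * 25 ^ i)"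
        by (simp add: n_def power_add power_mult)
      then show ?thesis by (simp add: \<eta>_def field_simps)
    qed
    also have "exp (- 2 * L) = (\<Prod>p\<in>B i. exp (- 2 * h p))"
      unfolding L_def by (simp add: exp_sum[OF finB] sum_distrib_left)
    also have "\<eta> i * \<dots> \<le> \<eta> i * (\<Prod>p\<in>B i. 1 - h p)"
      using hB by (intro mult_left_mono prod_mono conjI exp_minus_two_le) (auto simp: \<eta>_def)
    finally have "exp (5 * L) / 5 ^ n i \<le> \<eta> i * (\<Prod>p\<in>B i. 1 - h p)" .
    moreover have "esym (n i) (B i) h \<le> L ^ n i / fact (n i)"
      unfolding L_def using hB finB by (intro esym_le) auto
    ultimately show ?thesis using e by linarith
  qed
  have "\<exists>L l. sieve_expansion (\<Union>i<t. B i) A w L l (real (t + 1) * (\<Prod>i<t. C i)) \<and>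
    sieve_expansion (\<Union>i<t. B i) A w (\<lambda>m. \<Prod>i<t. alt_esym (n i) (B i) (\<lambda>p. of_bool (m \<in> A p)))
      (\<Prod>i<t. alt_esym (n i) (B i) (\<lambda>p. w p / real p)) (\<Prod>i<t. C i) \<and>
    (\<forall>m. L m \<le> (\<Prod>i<t. \<Prod>p\<in>B i. 1 - of_bool (m \<in> A p))) \<and>
    (\<Prod>i<t. alt_esym (n i) (B i) (\<lambda>p. w p / real p)) * (1 - (\<Sum>i<t. \<eta> i)) \<le> l"
  proof (rule brun_hooley_expansion)
    show "0 \<le> w p \<and> w p / real p \<le> 1" if "p \<in> B i" for i p
    proof -
      have "p \<in> S" using BS that by blast
      then have "w p / real p \<le> 1/2" using h(2)[of p] by (simp only: h_def)
      then show ?thesis using w(1)[of p] by linarith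
    qed
    show "esym (n i) (B i) (\<lambda>p. w p / real p) \<le> \<eta> i * (\<Prod>p\<in>B i. 1 - w p / real p)" if "i < t" for i
      using dens[OF that] by (simp add: h_def[abs_def])
  qed (use cost disj finB in \<open>auto simp: n_def \<eta>_def\<close>)
  then obtain L l where L: "sieve_expansion S A w L l (real (t + 1) * (\<Prod>i<t. C i))"
    "\<And>m. L m \<le> (\<Prod>i<t. \<Prod>p\<in>B i. 1 - of_bool (m \<in> A p))"
    "(\<Prod>i<t. alt_esym (n i) (B i) h) * (1 - (\<Sum>i<t. \<eta> i)) \<le> l"
    unfolding union h_def by blast
  have "L m \<le> (if \<forall>p\<in>S. m \<notin> A p then 1 else 0)" for m
  proof -
    have "(\<Prod>p\<in>S. 1 - of_bool (m \<in> A p) :: real) = (if \<forall>p\<in>S. m \<notin> A p then 1 else 0)"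
      using finS by (auto intro!: prod.neutral simp: prod_zero_iff)
    then show ?thesis using L(2)[of m] unfolding prod_split by simp
  qed
  from card_sifted_ge[OF finS _ per L(1)[unfolded w_def] \<open>\<alpha> \<le> \<beta>\<close> this] S
  have count: "l * (\<beta> - \<alpha>) - real (t + 1) * (\<Prod>i<t. C i)
    \<le> real (card {m::int. \<alpha> < of_int m \<and> of_int m \<le> \<beta> \<and> (\<forall>p\<in>S. m \<notin> A p)})" by blast
  have \<eta>_sum: "(\<Sum>i<t. \<eta> i) \<le> 1/2"
  proof -
    have "(\<Sum>i<t. \<eta> i) = 1/5 * ((1 - (1/25) ^ t) / (1 - 1/25))"
      unfolding \<eta>_def sum_distrib_left[symmetric] by (subst sum_gp_strict) auto
    also have "\<dots> \<le> 1/2" by (simp add: field_simps)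
    finally show ?thesis .
  qed
  have P: "(\<Prod>p\<in>S. 1 - h p) \<ge> 0" 
  proof (rule prod_nonneg)
    show "0 \<le> 1 - h p" if "p \<in> S" for p using h(2)[OF that] by linarith
  qed
  have "(\<Prod>p\<in>S. 1 - h p) = (\<Prod>i<t. \<Prod>p\<in>B i. 1 - h p)" by (rule prod_split[symmetric])
  also have "\<dots> \<le> (\<Prod>i<t. alt_esym (n i) (B i) h)"
  proof (rule prod_mono, intro conjI)
    fix i
    have hB: "0 \<le> h p \<and> h p \<le> 1" if "p \<in> B i" for p 
    proof -
      have "p \<in> S" using BS that by blast
      then show ?thesis using h[of p] by simp
    qed
    show "0 \<le> (\<Prod>p\<in>B i. 1 - h p)" using hB by (intro prod_nonneg) auto
    show "(\<Prod>p\<in>B i. 1 - h p) \<le> alt_esym (n i) (B i) h"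
      using bonferroni_alt_esym[of "B i" h "n i"] finB hB by (simp add: n_def)
  qed
  finally have "(\<Prod>p\<in>S. 1 - h p) * (1/2) \<le> (\<Prod>i<t. alt_esym (n i) (B i) h) * (1 - (\<Sum>i<t. \<eta> i))"
    using P \<eta>_sum by (intro mult_mono) auto
  then have "(\<Prod>p\<in>S. 1 - h p) / 2 \<le> l" using L(3) by simp
  then have "(\<Prod>p\<in>S. 1 - h p) / 2 * (\<beta> - \<alpha>) \<le> l * (\<beta> - \<alpha>)"
    using assms(8) by (intro mult_right_mono) auto
  moreover have "real (t + 1) * (\<Prod>i<t. C i) \<le> z powr (30 * real g + 9)"
  proof -
    have "(\<Prod>i<t. C i) = (\<Prod>i<t. z powr (5/4 * ((12 * real g + 1 + 2 * real i) / 2 ^ i)))"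
      by (intro prod.cong refl) (simp add: C_def zs_def powr_powr n_def field_simps)
    also have "\<dots> = z powr (\<Sum>i<t. 5/4 * ((12 * real g + 1 + 2 * real i) / 2 ^ i))"
      using z by (simp add: powr_sum)
    also have "\<dots> \<le> z powr (30 * real g + 8)"
    proof (rule powr_mono)
      define q where "q = (2 * (12 * real g + 1) + 4 + 4 * real t) / 2 ^ t"
      have "0 \<le> q" by (simp add: q_def)
      then show "(\<Sum>i<t. 5/4 * ((12 * real g + 1 + 2 * real i) / 2 ^ i)) \<le> 30 * real g + 8"
        unfolding sum_distrib_left[symmetric] sum_arith_geometric q_def[symmetric] by (simp add: algebra_simps)
    qed (use z in simp)
    finally have 1: "(\<Prod>i<t. C i) \<le> z powr (30 * real g + 8)" .
    \<comment> \<open>The number of blocks is doubly logarithmic: for \<open>i = t - 1\<close>,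
      \<open>z\<close> is the \<open>2 ^ i\<close>-th power of \<open>zs i\<close>, which exceeds
      \<open>w0 \<ge> 2\<close>.\<close>
    have 2: "real (t + 1) \<le> z powr 1"
    proof (cases t)
      case (Suc i)
      have "w0 \<le> zs i" using t_less[of i] Suc by simp
      then have "2 ^ (2 ^ i) \<le> zs i ^ (2 ^ i)" using w0 by (intro power_mono) auto
      also have "\<dots> = z" using z by (simp add: zs_def powr_powr flip: powr_realpow)
      finally have "(2::real) ^ (2 ^ i) \<le> z" .
      moreover have "real (t + 1) \<le> 2 ^ (2 ^ i)"
      proof -
        have "i + 2 \<le> 2 ^ Suc i" using Suc_leI[OF less_exp[of "Suc i"]] by simp
        moreover have "Suc i \<le> 2 ^ i" by (rule Suc_leI[OF less_exp])
        then have "(2::nat) ^ Suc i \<le> 2 ^ (2 ^ i)" by (intro power_increasing) auto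
        ultimately have "t + 1 \<le> 2 ^ (2 ^ i)" using Suc by linarith
        then show ?thesis by (metis of_nat_le_iff of_nat_numeral of_nat_power)
      qed
      ultimately show ?thesis using z by simp
    qed (use z in simp)
    have "real (t + 1) * (\<Prod>i<t. C i) \<le> z powr 1 * z powr (30 * real g + 8)"
      using 1 2 by (intro mult_mono) (auto simp: C_def intro!: prod_nonneg)
    also have "\<dots> = z powr (30 * real g + 9)" by (subst powr_add[symmetric]) (simp add: algebra_simps)
    finally show ?thesis .
  qed
  ultimately show ?thesis using count unfolding h_def w_def by (simp add: mult.commute)
qed


section \<open>Polynomial values with prescribed factors\<close>

lemma crt_family:
  fixes m u :: "'i \<Rightarrow> int"
  assumes "finite J" "\<And>i j. i \<in> J \<Longrightarrow> j \<in> J \<Longrightarrow> i \<noteq> j \<Longrightarrow> coprime (m i) (m j)"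
  shows "\<exists>c. \<forall>j\<in>J. m j dvd c - u j"
  using assms
proof (induction J)
  case (insert j J)
  then obtain c where c: "\<forall>i\<in>J. m i dvd c - u i" by auto
  have "coprime (m j) (\<Prod>i\<in>J. m i)"
    using insert by (intro prod_coprime_right) auto
  then obtain x where x: "[x = u j] (mod m j)" "[x = c] (mod (\<Prod>i\<in>J. m i))"
    using binary_chinese_remainder_int by blast
  have "m i dvd x - u i" if i: "i \<in> J" for i
  proof -
    have "m i dvd (\<Prod>i\<in>J. m i)" using insert(1) i by (rule dvd_prodI)
    also have "\<dots> dvd x - c" using x(2) by (simp add: cong_iff_dvd_diff)
    finally have "m i dvd (x - c) + (c - u i)" using c i by (intro dvd_add) auto
    then show ?thesis by simp
  qed
  then show ?case using x(1) by (auto simp: cong_iff_dvd_diff)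
qed simp

lemma prod_prime_powers_dvd:
  fixes n :: int and e :: "nat \<Rightarrow> nat"
  assumes "finite A" "\<And>p. p \<in> A \<Longrightarrow> prime p" "\<And>p. p \<in> A \<Longrightarrow> int p ^ e p dvd n"
  shows "(\<Prod>p\<in>A. int p ^ e p) dvd n"
  using assms
proof (induction A)
  case (insert p A)
  have "coprime (int p ^ e p) (\<Prod>p\<in>A. int p ^ e p)"
  proof (rule prod_coprime_right)
    fix q assume "q \<in> A"
    then have "coprime p q" using insert by (metis insertCI primes_coprime)
    then show "coprime (int p ^ e p) (int q ^ e q)" by (intro coprime_power_left_iff[THEN iffD2] disjI1 coprime_power_right_iff[THEN iffD2]) simp
  qed
  then show ?case using insert by (simp add: divides_mult)
qed simp

locale polynomial_family =
  fixes r :: nat and Q :: "nat \<Rightarrow> int poly"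
  assumes family: "poly_family r Q"
    and degree_pos: "degree (\<Prod>j\<in>{1..r}. Q j) \<ge> 1"
begin

abbreviation Qprod :: "int poly" where "Qprod \<equiv> (\<Prod>j\<in>{1..r}. Q j)"

abbreviation g :: nat where "g \<equiv> degree Qprod"

text \<open>This is \<open>\<beta> D\<close>, up to sign the resultant of the product and its
  derivative. Modulo a prime not dividing it, the product has no multiple root.\<close>

definition N :: int where "N = lead_coeff Qprod * poly_disc Qprod"

lemma prime_not_dvd_Q:
  assumes "j \<in> {1..r}" "prime p"
  shows "\<not> [:int p:] dvd Q j"
proof
  assume "[:int p:] dvd Q j"
  then obtain R where "Q j = [:int p:] * R" by (auto simp: dvd_def)
  then have "int p dvd poly (Q j) n" for n by simp
  moreover have "prime (int p)" using assms(2) by simp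
  ultimately show False using family assms(1) unfolding poly_family_def no_fixed_divisor_def by blast
qed

lemma prime_not_dvd_Qprod:
  assumes "prime p"
  shows "\<not> [:int p:] dvd Qprod"
proof -
  have pr: "prime_elem [:int p:]" using assms by (intro lift_prime_elem_poly prime_imp_prime_elem) simp
  have "\<not> [:int p:] dvd (\<Prod>j\<in>J. Q j)" if "finite J" "J \<subseteq> {1..r}" for J
    using that
  proof (induction J)
    case empty
    have "\<not> is_unit [:int p:]" using pr by (rule prime_elem_not_unit)
    then show ?case by simp
  next
    case (insert j J)
    then show ?case using prime_not_dvd_Q[OF _ assms, of j] by (simp add: prime_elem_dvd_mult_iff[OF pr])
  qed
  then show ?thesis by simp
qed

lemma Q_nonzero: "j \<in> {1..r} \<Longrightarrow> Q j \<noteq> 0"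
  using prime_not_dvd_Q[of j 2] by auto

lemma degree_Qprod: "g = (\<Sum>j\<in>{1..r}. degree (Q j))"
  using Q_nonzero by (intro degree_prod_eq_sum_degree) auto

text \<open>An irreducible constant is not a unit, so a prime divides it, and that prime would be a
  fixed divisor.\<close>

lemma degree_Q_pos:
  assumes "j \<in> {1..r}"
  shows "degree (Q j) \<ge> 1"
proof (rule ccontr)
  assume "\<not> degree (Q j) \<ge> 1"
  then obtain c where c: "Q j = [:c:]" by (metis degree_eq_zeroE not_less_eq_eq One_nat_def le_zero_eq not_less le_numeral_extra(3) less_one)
  have "irreducible (Q j)" using family assms unfolding poly_family_def by blast
  then have "\<not> is_unit c" using c by (auto dest: irreducible_not_unit simp: is_unit_const_poly_iff)
  then have "\<not> is_unit (nat \<bar>c\<bar>)" by simp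
  then obtain p where p: "prime p" "p dvd nat \<bar>c\<bar>" using prime_factor_nat[of "nat \<bar>c\<bar>"] by auto
  then have "int p dvd c" by simp
  then have "[:int p:] dvd Q j" using c by simp
  then show False using prime_not_dvd_Q[OF assms p(1)] by blast
qed

lemma r_le_g: "r \<le> g"
proof -
  have "(\<Sum>j\<in>{1..r}. 1) \<le> (\<Sum>j\<in>{1..r}. degree (Q j))" by (intro sum_mono degree_Q_pos)
  then show ?thesis unfolding degree_Qprod by simp
qed

lemma root_count_prime_le:
  assumes "j \<in> {1..r}" "prime p"
  shows "root_count (Q j) p \<le> real (degree (Q j))"
  unfolding root_count_def using card_roots_mod_prime[OF assms(2) prime_not_dvd_Q[OF assms]] by simp

lemma sum_root_count_le: "prime p \<Longrightarrow> (\<Sum>j\<in>{1..r}. root_count (Q j) p) \<le> real g"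
  unfolding degree_Qprod of_nat_sum by (intro sum_mono root_count_prime_le)

lemma root_count_Qprod_le_g: "prime p \<Longrightarrow> root_count Qprod p \<le> real g"
  unfolding root_count_def using card_roots_mod_prime[OF _ prime_not_dvd_Qprod, of p] by simp

lemma root_count_Qprod_le:
  assumes "prime p"
  shows "root_count Qprod p \<le> (\<Sum>j\<in>{1..r}. root_count (Q j) p)"
proof -
  define X where "X j = {a \<in> {0..<int p}. int p dvd poly (Q j) a}" for j
  have finX: "finite (X j)" for j unfolding X_def by (rule finite_subset[of _ "{0..<int p}"]) auto
  have "{a \<in> {0..<int p}. int p dvd poly Qprod a} \<subseteq> (\<Union>j\<in>{1..r}. X j)"
    using assms by (auto simp: X_def poly_prod prime_dvd_prod_iff)
  then have "card {a \<in> {0..<int p}. int p dvd poly Qprod a} \<le> card (\<Union>j\<in>{1..r}. X j)"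
    using finX by (intro card_mono) auto
  also have "\<dots> \<le> (\<Sum>j\<in>{1..r}. card (X j))" by (rule card_UN_le) simp
  finally have "real (card {a \<in> {0..<int p}. int p dvd poly Qprod a}) \<le> real (\<Sum>j\<in>{1..r}. card (X j))"
    by (rule of_nat_mono)
  then show ?thesis unfolding root_count_def X_def of_nat_sum .
qed

lemma poly_Q_dvd_Qprod: "j \<in> {1..r} \<Longrightarrow> poly (Q j) n dvd poly Qprod n"
  unfolding poly_prod by (rule dvd_prodI) auto

lemma dvd_N:
  assumes "m dvd poly Qprod n" "m dvd poly (pderiv Qprod) n"
  shows "m dvd N"
proof -
  have "m dvd resultant Qprod (pderiv Qprod)"
    using assms degree_pos by (intro dvd_resultant) auto
  then show ?thesis unfolding N_def poly_disc_mult_lead_coeff[OF degree_pos] by (rule dvd_mult)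
qed

lemma prime_dvd_Q_pderiv:
  assumes "j \<in> {1..r}" "prime p" "\<not> int p dvd N" "int p dvd poly (Q j) n"
  shows "\<not> int p dvd poly (pderiv (Q j)) n"
proof
  assume h: "int p dvd poly (pderiv (Q j)) n"
  define R where "R = (\<Prod>i\<in>{1..r} - {j}. Q i)"
  have eq: "Qprod = Q j * R" unfolding R_def using assms(1) by (intro prod.remove) auto
  have "int p dvd poly (pderiv Qprod) n"
    unfolding eq pderiv_mult using h assms(4) by simp
  moreover have "int p dvd poly Qprod n" unfolding eq using assms(4) by simp
  ultimately show False using dvd_N assms(3) by blast
qed

text \<open>A common root of two factors is a multiple root of the product, by the product
  rule.\<close>

lemma prime_dvd_Q_unique:
  assumes "i \<in> {1..r}" "j \<in> {1..r}" "i \<noteq> j" "\<not> int p dvd N" "int p dvd poly (Q i) n"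
  shows "\<not> int p dvd poly (Q j) n"
proof
  assume h: "int p dvd poly (Q j) n"
  define R where "R = (\<Prod>l\<in>{1..r} - {i} - {j}. Q l)"
  have "Qprod = Q i * (\<Prod>l\<in>{1..r} - {i}. Q l)" using assms(1) by (intro prod.remove) auto
  also have "(\<Prod>l\<in>{1..r} - {i}. Q l) = Q j * R" unfolding R_def using assms by (intro prod.remove) auto
  finally have eq: "Qprod = Q i * (Q j * R)" .
  have "int p dvd poly (pderiv Qprod) n"
    unfolding eq pderiv_mult using h assms(5) by (simp add: algebra_simps)
  moreover have "int p dvd poly Qprod n" unfolding eq using assms(5) by simp
  ultimately show False using dvd_N assms(4) by blast
qed

text \<open>Substitute \<open>n = c + q m\<close>, which turns the interval into one of length
  \<open>y / q\<close> in \<open>m\<close>. Since no sieving prime divides \<open>q\<close>, the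
  excluded classes of \<open>m\<close> modulo \<open>p\<close> inject into the roots of the product
  modulo \<open>p\<close>, so the density does not deteriorate.\<close>

lemma sieve_residue_class:
  fixes x y z w0 :: real and q :: nat and c :: int
  assumes "w0 \<ge> 2 ^ 28" "w0 \<ge> real g ^ 4" "z \<ge> w0" "q > 0" "y \<ge> 0"
    and T: "\<And>p. p \<in> T \<Longrightarrow> prime p \<and> w0 < real p \<and> real p \<le> z \<and> \<not> p dvd q"
  shows "y / (2 * real q) * (\<Prod>p\<in>T. 1 - root_count Qprod p / real p) - z powr (30 * real g + 9)
    \<le> real (card {n::int. x < of_int n \<and> of_int n \<le> x + y \<and> int q dvd n - c \<and> (\<forall>p\<in>T. \<not> int p dvd poly Qprod n)})"
proof -
  define A where "A p = {m. int p dvd poly Qprod (c + int q * m)}" for p :: nat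
  define \<alpha> \<beta> where "\<alpha> = (x - of_int c) / real q" and "\<beta> = (x + y - of_int c) / real q"
  have \<beta>\<alpha>: "\<beta> - \<alpha> = y / real q" unfolding \<alpha>_def \<beta>_def by (simp add: diff_divide_distrib[symmetric])
  have "y / real q \<ge> 0" using assms by simp
  then have \<alpha>\<beta>: "\<alpha> \<le> \<beta>" using \<beta>\<alpha> by linarith
  have per: "m \<in> A p \<longleftrightarrow> m mod int p \<in> A p" for m p
  proof -
    have "int p dvd (c + int q * m) - (c + int q * (m mod int p))"
      by (simp add: right_diff_distrib[symmetric] minus_mod_eq_mult_div)
    then show ?thesis unfolding A_def mem_Collect_eq by (rule dvd_poly_iff_of_dvd_diff)
  qed
  have card_A: "real (card (A p \<inter> {0..<int p})) \<le> root_count Qprod p" if p: "p \<in> T" for p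
  proof -
    have pr: "prime p" "\<not> p dvd q" using T[OF p] by auto
    have "card (A p \<inter> {0..<int p}) \<le> card {a \<in> {0..<int p}. int p dvd poly Qprod a}"
    proof (rule card_inj_on_le[of "\<lambda>m. (c + int q * m) mod int p"])
      show "inj_on (\<lambda>m. (c + int q * m) mod int p) (A p \<inter> {0..<int p})"
      proof (rule inj_onI)
        fix m m' assume h: "m \<in> A p \<inter> {0..<int p}" "m' \<in> A p \<inter> {0..<int p}"
          "(c + int q * m) mod int p = (c + int q * m') mod int p"
        then have "int p dvd int q * (m - m')" by (simp add: mod_eq_dvd_iff right_diff_distrib)
        then have "int p dvd m - m'" using pr by (simp add: prime_dvd_mult_iff)
        then have "m mod int p = m' mod int p" by (simp add: mod_eq_dvd_iff)
        then show "m = m'" using h by simp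
      qed
      show "(\<lambda>m. (c + int q * m) mod int p) ` (A p \<inter> {0..<int p}) \<subseteq> {a \<in> {0..<int p}. int p dvd poly Qprod a}"
      proof clarify
        fix m assume m: "m \<in> A p" "m \<in> {0..<int p}"
        have "int p dvd poly Qprod ((c + int q * m) mod int p) \<longleftrightarrow> int p dvd poly Qprod (c + int q * m)"
          by (rule dvd_poly_iff_of_dvd_diff) (simp add: dvd_diff_commute minus_mod_eq_mult_div)
        then show "(c + int q * m) mod int p \<in> {0..<int p} \<and> int p dvd poly Qprod ((c + int q * m) mod int p)"
          using m pr by (simp add: A_def prime_gt_0_nat)
      qed
    qed (auto intro: finite_subset[of _ "{0..<int p}"])
    then show ?thesis by (simp add: root_count_def)
  qed
  have card_g: "card (A p \<inter> {0..<int p}) \<le> g" if p: "p \<in> T" for p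
    using card_A[OF p] root_count_Qprod_le_g[of p] T[OF p] by linarith
  have T': "prime p \<and> w0 < real p \<and> real p \<le> z" if "p \<in> T" for p using T[OF that] by blast
  have sieve: "(\<beta> - \<alpha>) / 2 * (\<Prod>p\<in>T. 1 - real (card (A p \<inter> {0..<int p})) / real p) - z powr (30 * real g + 9)
    \<le> real (card {m::int. \<alpha> < of_int m \<and> of_int m \<le> \<beta> \<and> (\<forall>p\<in>T. m \<notin> A p)})"
    by (rule brun_hooley_sieve[OF degree_pos assms(1,2,3) T' per card_g \<alpha>\<beta>])
  have "(\<Prod>p\<in>T. 1 - root_count Qprod p / real p) \<le> (\<Prod>p\<in>T. 1 - real (card (A p \<inter> {0..<int p})) / real p)"
  proof (rule prod_mono)
    fix p assume p: "p \<in> T"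
    have "real g \<le> real g ^ 4" using degree_pos power_increasing[of 1 4 "real g"] by simp
    then have "root_count Qprod p \<le> real p" using root_count_Qprod_le_g[of p] T[OF p] assms by linarith
    then have "root_count Qprod p / real p \<le> 1" using T[OF p] by (simp add: divide_le_eq_1 prime_gt_0_nat)
    then show "0 \<le> 1 - root_count Qprod p / real p \<and>
        1 - root_count Qprod p / real p \<le> 1 - real (card (A p \<inter> {0..<int p})) / real p"
      using card_A[OF p] by (auto intro!: divide_right_mono)
  qed
  then have "(\<beta> - \<alpha>) / 2 * (\<Prod>p\<in>T. 1 - root_count Qprod p / real p)
      \<le> (\<beta> - \<alpha>) / 2 * (\<Prod>p\<in>T. 1 - real (card (A p \<inter> {0..<int p})) / real p)"
    using \<alpha>\<beta> by (intro mult_left_mono) auto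
  also have "(\<beta> - \<alpha>) / 2 = y / (2 * real q)" by (simp add: \<beta>\<alpha>)
  finally have 1: "y / (2 * real q) * (\<Prod>p\<in>T. 1 - root_count Qprod p / real p) - z powr (30 * real g + 9)
    \<le> real (card {m::int. \<alpha> < of_int m \<and> of_int m \<le> \<beta> \<and> (\<forall>p\<in>T. m \<notin> A p)})"
    using sieve \<beta>\<alpha> by simp
  have "card {m::int. \<alpha> < of_int m \<and> of_int m \<le> \<beta> \<and> (\<forall>p\<in>T. m \<notin> A p)} \<le>
    card {n::int. x < of_int n \<and> of_int n \<le> x + y \<and> int q dvd n - c \<and> (\<forall>p\<in>T. \<not> int p dvd poly Qprod n)}"
  proof (rule card_inj_on_le[of "\<lambda>m. c + int q * m"])
    show "inj_on (\<lambda>m. c + int q * m) {m. \<alpha> < of_int m \<and> of_int m \<le> \<beta> \<and> (\<forall>p\<in>T. m \<notin> A p)}"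
      using assms(4) by (intro inj_onI) simp
    show "(\<lambda>m. c + int q * m) ` {m. \<alpha> < of_int m \<and> of_int m \<le> \<beta> \<and> (\<forall>p\<in>T. m \<notin> A p)} \<subseteq>
      {n. x < of_int n \<and> of_int n \<le> x + y \<and> int q dvd n - c \<and> (\<forall>p\<in>T. \<not> int p dvd poly Qprod n)}"
    proof clarify
      fix m :: int assume m: "\<alpha> < of_int m" "of_int m \<le> \<beta>" "\<forall>p\<in>T. m \<notin> A p"
      have "x - of_int c < of_int m * real q" "of_int m * real q \<le> x + y - of_int c"
        using m(1,2) assms(4) unfolding \<alpha>_def \<beta>_def by (simp_all add: pos_divide_less_eq pos_le_divide_eq)
      then show "x < of_int (c + int q * m) \<and> of_int (c + int q * m) \<le> x + y \<and> int q dvd c + int q * m - c \<and>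
          (\<forall>p\<in>T. \<not> int p dvd poly Qprod (c + int q * m))"
        using m(3) by (simp add: A_def mult.commute)
    qed
  qed (rule finite_int_interval)
  then show ?thesis using 1 by linarith
qed

definition admissible :: "real \<Rightarrow> (nat \<Rightarrow> nat) \<Rightarrow> bool" where
  "admissible z a \<longleftrightarrow> (\<forall>j\<in>{1..r}. a j \<ge> 1 \<and> real (a j) \<le> z \<and> coprime (int (a j)) N) \<and>
     (\<forall>i\<in>{1..r}. \<forall>j\<in>{1..r}. i \<noteq> j \<longrightarrow> coprime (a i) (a j))"

text \<open>Primes dividing a component of \<open>a\<close> are set apart, here and among the
  sieving primes: exact divisibility by that component already controls them.\<close>

definition small_primes :: "real \<Rightarrow> (nat \<Rightarrow> nat) \<Rightarrow> nat set" where
  "small_primes w0 a = {p. prime p \<and> real p \<le> w0 \<and> \<not> p dvd (\<Prod>j\<in>{1..r}. a j)}"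

definition sieving_primes :: "real \<Rightarrow> real \<Rightarrow> (nat \<Rightarrow> nat) \<Rightarrow> nat set" where
  "sieving_primes w0 z a = {p. prime p \<and> w0 < real p \<and> real p \<le> z \<and> \<not> p dvd (\<Prod>j\<in>{1..r}. a j)}"

text \<open>The primes up to \<open>w0\<close> that divide no component of \<open>a\<close> are not sieved out, since all values of the product may be divisible by them:
  instead \<open>n\<close> is kept in a class modulo \<open>p ^ K\<close> that fixes the \<open>p\<close>-adic valuations.\<close>
definition good :: "real \<Rightarrow> real \<Rightarrow> int \<Rightarrow> nat \<Rightarrow> (nat \<Rightarrow> nat) \<Rightarrow> int \<Rightarrow> bool" where
  "good w0 z n0 K a n \<longleftrightarrow>
     (\<forall>j\<in>{1..r}. int (a j) dvd poly (Q j) n \<and> coprime (poly (Q j) n div int (a j)) (int (a j))) \<and>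
     (\<forall>p\<in>small_primes w0 a. int p ^ K dvd n - n0) \<and>
     (\<forall>p\<in>sieving_primes w0 z a. \<not> int p dvd poly Qprod n)"

lemma finite_small_primes [simp]: "finite (small_primes w0 a)"
  unfolding small_primes_def by (rule finite_primes_upto)

text \<open>Divisibility by \<open>a\<close> with cofactor coprime to \<open>a\<close> depends only
  on the class modulo \<open>a ^ 2\<close>, which is where the squares in the density come
  from.\<close>

lemma exact_root_cong:
  assumes "a > 0" "int a ^ 2 dvd n - c" "int a dvd poly P c" "coprime (poly P c div int a) (int a)"
  shows "int a dvd poly P n" "coprime (poly P n div int a) (int a)"
proof -
  have "int a ^ 2 dvd poly P n - poly P c" using assms(2) diff_dvd_poly_diff dvd_trans by blast
  then obtain k where k: "poly P n - poly P c = int a ^ 2 * k" by (auto simp: dvd_def)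
  obtain u where u: "poly P c = int a * u" using assms(3) by (auto simp: dvd_def)
  have eq: "poly P n = int a * (u + int a * k)" using k u by (simp add: power2_eq_square algebra_simps)
  show "int a dvd poly P n" using eq by simp
  have "coprime (u + int a * k) (int a) \<longleftrightarrow> coprime u (int a)"
    by (rule coprime_add_mult_self)
  then show "coprime (poly P n div int a) (int a)" using eq u assms(1,4) by simp
qed

text \<open>Each choice of an exact root modulo every \<open>a_j ^ 2\<close>, combined with
  \<open>n0\<close> modulo \<open>W\<close>, determines one class modulo \<open>q = W A ^ 2\<close>.
  Different choices give disjoint classes, each class is sieved separately, and simplicity of the
  roots bounds the number of choices from below.\<close>

lemma card_good_ge:
  fixes x y z w0 :: real
  assumes "w0 \<ge> 2 ^ 28" "w0 \<ge> real g ^ 4" "z \<ge> w0" "y \<ge> 0" "admissible z a"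
  shows "(\<Prod>j\<in>{1..r}. root_count (Q j) (a j) * real (totient (a j))) *
      (y / (2 * real ((\<Prod>p\<in>small_primes w0 a. p ^ K) * (\<Prod>j\<in>{1..r}. a j) ^ 2)) *
        (\<Prod>p\<in>sieving_primes w0 z a. 1 - root_count Qprod p / real p) - z powr (30 * real g + 9))
    \<le> real (card {n::int. x < of_int n \<and> of_int n \<le> x + y \<and> good w0 z n0 K a n})"
proof -
  define A where "A = (\<Prod>j\<in>{1..r}. a j)"
  define S where "S = small_primes w0 a"
  define T where "T = sieving_primes w0 z a"
  define W where "W = (\<Prod>p\<in>S. p ^ K)"
  define q where "q = W * A ^ 2"
  define b where "b = y / (2 * real q) * (\<Prod>p\<in>T. 1 - root_count Qprod p / real p) - z powr (30 * real g + 9)"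
  define R where "R = (\<Prod>j\<in>{1..r}. root_count (Q j) (a j) * real (totient (a j)))"
  define I where "I = {n::int. x < of_int n \<and> of_int n \<le> x + y \<and> good w0 z n0 K a n}"
  have R0: "R \<ge> 0" unfolding R_def by (intro prod_nonneg) auto
  have a: "a j \<ge> 1" "coprime (int (a j)) N" if "j \<in> {1..r}" for j
    using assms(5) that unfolding admissible_def by auto
  have acop: "coprime (a i) (a j)" if "i \<in> {1..r}" "j \<in> {1..r}" "i \<noteq> j" for i j
    using assms(5) that unfolding admissible_def by auto
  have Apos: "A > 0" unfolding A_def using a(1) by (intro prod_pos) (simp add: Suc_le_eq)
  have S: "prime p" "\<not> p dvd A" if "p \<in> S" for p
    using that by (auto simp: S_def small_primes_def A_def)
  have Wpos: "W > 0" unfolding W_def using S by (intro prod_pos) (auto simp: prime_gt_0_nat)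
  have qpos: "q > 0" using Apos Wpos by (simp add: q_def)
  have copWA: "coprime W A"
    unfolding W_def
  proof (rule prod_coprime_left)
    fix p assume "p \<in> S"
    then have "coprime p A" using S by (intro prime_imp_coprime)
    then show "coprime (p ^ K) A" by simp
  qed
  show ?thesis
  \<comment> \<open>For a negative sieve bound the claim is trivial; otherwise multiplication by
    \<open>b\<close> preserves the lower bound for the number of classes.\<close>
  proof (cases "b \<ge> 0")
    case False
    then have "R * b \<le> 0" using R0 by (simp add: mult_nonneg_nonpos)
    also have "0 \<le> real (card I)" by simp
    finally show ?thesis unfolding R_def b_def q_def W_def A_def I_def S_def T_def .
  next
    case True
    define C where "C j = {c \<in> {0..<int (a j) ^ 2}. int (a j) dvd poly (Q j) c \<and> coprime (poly (Q j) c div int (a j)) (int (a j))}" for j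
    have finC: "finite (C j)" for j unfolding C_def by (rule finite_subset[of _ "{0..<int (a j) ^ 2}"]) auto
    have cardC: "root_count (Q j) (a j) * real (totient (a j)) \<le> real (card (C j))" if j: "j \<in> {1..r}" for j
      unfolding C_def
    proof (rule card_exact_roots_ge)
      show "a j > 0" using a(1)[OF j] by simp
      fix c assume c: "int (a j) dvd poly (Q j) c"
      show "coprime (poly (pderiv (Q j)) c) (int (a j))"
      proof (rule ccontr)
        assume "\<not> coprime (poly (pderiv (Q j)) c) (int (a j))"
        then have "\<not> is_unit (gcd (poly (pderiv (Q j)) c) (int (a j)))" by (simp add: coprime_iff_gcd_eq_1 is_unit_gcd_iff)
        moreover have "gcd (poly (pderiv (Q j)) c) (int (a j)) \<noteq> 0" using a(1)[OF j] by simp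
        ultimately obtain l where l0: "l dvd gcd (poly (pderiv (Q j)) c) (int (a j))" "prime l"
          using prime_divisorE by metis
        then have l: "prime l" "l dvd poly (pderiv (Q j)) c" "l dvd int (a j)" by (auto dest: dvd_trans)
        define p where "p = nat l"
        have lp: "l = int p" using l(1) prime_ge_0_int by (simp add: p_def)
        have "\<not> int p dvd N"
        proof
          assume "int p dvd N"
          then have "is_unit (int p)" using a(2)[OF j] l(3) lp by (meson coprime_common_divisor)
          then show False using l(1) lp by auto
        qed
        then show False
          using prime_dvd_Q_pderiv[OF j, of p c] l(1,2) lp dvd_trans[OF l(3) c] by simp
      qed
    qed
    define V where "V = PiE {1..r} C"
    have finV: "finite V" unfolding V_def using finC by (intro finite_PiE) auto
    have ex: "\<exists>c. (\<forall>j\<in>{1..r}. int (a j) ^ 2 dvd c - v j) \<and> int W dvd c - n0" for v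
    proof -
      obtain c1 where c1: "\<forall>j\<in>{1..r}. int (a j) ^ 2 dvd c1 - v j"
        using crt_family[of "{1..r}" "\<lambda>j. int (a j) ^ 2" v] acop by auto
      have "coprime (int A ^ 2) (int W)" using copWA by (simp add: coprime_commute)
      then obtain c where c: "[c = c1] (mod (int A ^ 2))" "[c = n0] (mod int W)"
        using binary_chinese_remainder_int by blast
      have "int (a j) ^ 2 dvd c - v j" if j: "j \<in> {1..r}" for j
      proof -
        have "a j dvd A" unfolding A_def using j by (intro dvd_prodI) auto
        then have "int (a j) ^ 2 dvd int A ^ 2" by simp
        also have "\<dots> dvd c - c1" using c(1) by (simp add: cong_iff_dvd_diff)
        finally have "int (a j) ^ 2 dvd (c - c1) + (c1 - v j)" using c1 j by (intro dvd_add) auto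
        then show ?thesis by simp
      qed
      then have "\<forall>j\<in>{1..r}. int (a j) ^ 2 dvd c - v j" by blast
      moreover have "int W dvd c - n0" using c(2) by (simp add: cong_iff_dvd_diff)
      ultimately show ?thesis by blast
    qed
    define cc where "cc v = (SOME c. (\<forall>j\<in>{1..r}. int (a j) ^ 2 dvd c - v j) \<and> int W dvd c - n0)" for v
    have cc: "\<forall>j\<in>{1..r}. int (a j) ^ 2 dvd cc v - v j" "int W dvd cc v - n0" for v
      using someI_ex[OF ex[of v]] unfolding cc_def by blast+
    define X where "X v = {n::int. x < of_int n \<and> of_int n \<le> x + y \<and> int q dvd n - cc v \<and> (\<forall>p\<in>T. \<not> int p dvd poly Qprod n)}" for v
    have finX: "finite (X v)" for v unfolding X_def by (rule finite_int_interval)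
    have X_dvd: "int (a j) ^ 2 dvd n - v j" "int W dvd n - n0" if "n \<in> X v" "j \<in> {1..r}" for n v j
    proof -
      have q: "int q dvd n - cc v" using that(1) by (simp add: X_def)
      have "a j dvd A" unfolding A_def using that(2) by (intro dvd_prodI) auto
      then have "int (a j) ^ 2 dvd int A ^ 2" by simp
      also have "\<dots> dvd int q" by (simp add: q_def)
      finally have "int (a j) ^ 2 dvd (n - cc v) + (cc v - v j)" using q cc(1)[of v] that(2) by (meson dvd_add dvd_trans)
      then show "int (a j) ^ 2 dvd n - v j" by simp
      have "int W dvd int q" by (simp add: q_def)
      then have "int W dvd (n - cc v) + (cc v - n0)" using q cc(2)[of v] by (meson dvd_add dvd_trans)
      then show "int W dvd n - n0" by simp
    qed
    \<comment> \<open>\<open>X_dvd\<close> is instantiated at some index even where only its second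
      conclusion is wanted; positive degree makes the family nonempty.\<close>
    have r1: "1 \<in> {1..r}"
    proof -
      have "r \<noteq> 0" using degree_pos by (intro notI) simp
      then show ?thesis by simp
    qed
    have XI: "X v \<subseteq> I" if v: "v \<in> V" for v
    proof
      fix n assume n: "n \<in> X v"
      have "int (a j) dvd poly (Q j) n \<and> coprime (poly (Q j) n div int (a j)) (int (a j))" if j: "j \<in> {1..r}" for j
      proof -
        have "v j \<in> C j" using v j by (auto simp: V_def)
        then show ?thesis
          using exact_root_cong[of "a j" n "v j" "Q j"] a(1)[OF j] X_dvd(1)[OF n j] by (auto simp: C_def)
      qed
      moreover have "int p ^ K dvd n - n0" if p: "p \<in> S" for p
      proof -
        have "p ^ K dvd W" unfolding W_def using p by (intro dvd_prodI) (auto simp: S_def)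
        then have "int (p ^ K) dvd int W" by (simp only: int_dvd_int_iff)
        then show ?thesis using X_dvd(2)[OF n r1] by (metis dvd_trans of_nat_power)
      qed
      ultimately show "n \<in> I" using n by (auto simp: I_def X_def good_def S_def T_def)
    qed
    have disj: "X v \<inter> X v' = {}" if v: "v \<in> V" "v' \<in> V" "v \<noteq> v'" for v v'
    proof (rule ccontr)
      assume "X v \<inter> X v' \<noteq> {}"
      then obtain n where n: "n \<in> X v" "n \<in> X v'" by blast
      have "v j = v' j" if j: "j \<in> {1..r}" for j
      proof -
        have "int (a j) ^ 2 dvd (n - v' j) - (n - v j)" using X_dvd(1)[OF n(1) j] X_dvd(1)[OF n(2) j] by (rule dvd_diff[rotated])
        then have "v j mod int (a j) ^ 2 = v' j mod int (a j) ^ 2" by (simp add: mod_eq_dvd_iff)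
        moreover have "v j \<in> C j" "v' j \<in> C j" using v j by (auto simp: V_def)
        ultimately show ?thesis by (simp add: C_def)
      qed
      then have "v = v'" using v unfolding V_def by (intro PiE_ext[of v "{1..r}" C v']) auto
      then show False using v(3) by simp
    qed
    have "b \<le> real (card (X v))" for v
      unfolding b_def X_def
    proof (rule sieve_residue_class)
      fix p assume p: "p \<in> T"
      then have p': "prime p" "w0 < real p" "real p \<le> z" "\<not> p dvd A"
        by (auto simp: T_def sieving_primes_def A_def)
      have "\<not> p dvd W"
      proof
        assume "p dvd W"
        then obtain l where "l \<in> S" "p dvd l ^ K"
          unfolding W_def using p'(1) by (auto simp: prime_dvd_prod_iff S_def)
        then have "p = l" using p'(1) S(1)[of l] by (metis prime_dvd_power primes_dvd_imp_eq)
        then show False using \<open>l \<in> S\<close> p'(2) by (auto simp: S_def small_primes_def)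
      qed
      then have "\<not> p dvd q" using p' by (auto simp: q_def prime_dvd_mult_iff dest: prime_dvd_power)
      then show "prime p \<and> w0 < real p \<and> real p \<le> z \<and> \<not> p dvd q" using p' by blast
    qed (use assms qpos in auto)
    then have "(\<Sum>v\<in>V. b) \<le> (\<Sum>v\<in>V. real (card (X v)))" by (intro sum_mono)
    also have "\<dots> = real (card (\<Union>v\<in>V. X v))"
      using finV finX disj by (subst card_UN_disjoint) auto
    also have "card (\<Union>v\<in>V. X v) \<le> card I"
      using XI unfolding I_def by (intro card_mono finite_int_interval) auto
    finally have "real (card V) * b \<le> real (card I)" by simp
    moreover have "R \<le> real (card V)"
      unfolding R_def V_def using cardC by (simp add: card_PiE) (intro prod_mono, auto)
    then have "R * b \<le> real (card V) * b" using True by (intro mult_right_mono)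
    ultimately have "R * b \<le> real (card I)" by linarith
    then show ?thesis unfolding R_def b_def q_def W_def A_def I_def S_def T_def .
  qed
qed

end

lemma P_minus_gt:
  assumes "\<And>p. prime p \<Longrightarrow> p dvd b \<Longrightarrow> z < real p"
  shows "P_minus b > ereal z"
proof (cases "prime_factors b = {}")
  case True
  then show ?thesis by (simp add: P_minus_def top_ereal_def)
next
  case False
  have "P_minus b = Min ((\<lambda>p. ereal (real p)) ` prime_factors b)"
    unfolding P_minus_def using False by (intro Min_Inf[symmetric]) auto
  also have "\<dots> > ereal z"
    using False assms by (subst Min_gr_iff) (auto simp: prime_factors_dvd)
  finally show ?thesis .
qed

lemma SUP_value_count_nonneg: "0 \<le> (SUP k :: nat \<Rightarrow> real. value_count r Q f x y k)"
proof -
  have "0 \<le> value_count r Q f x y (\<lambda>_. 0)" by (simp add: value_count_def)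
  also have "\<dots> \<le> (SUP k :: nat \<Rightarrow> real. value_count r Q f x y k)"
    by (intro cSUP_upper bdd_above_value_count) auto
  finally show ?thesis .
qed

lemma finite_nat_le_real: "finite {m::nat. real m \<le> t \<and> R m}"
  by (rule finite_subset[of _ "{..nat \<lfloor>t\<rfloor>}"]) (auto simp: le_nat_floor)

section \<open>Elementary sums for the sieve product\<close>

lemma sum_inverse_le: "m \<ge> 1 \<Longrightarrow> (\<Sum>n=1..m. 1 / real n) \<le> 1 + ln (real m)"
proof (induction m rule: dec_induct)
  case (step m)
  have "ln (real m / real (Suc m)) \<le> real m / real (Suc m) - 1"
    using step(1) by (intro ln_le_minus_one) auto
  then have "1 / real (Suc m) \<le> ln (real (Suc m)) - ln (real m)"
    using step(1) by (simp add: ln_div field_simps)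
  then show ?case using step(3) by simp
qed simp

lemma sum_inverse_squares_le: "m \<ge> 1 \<Longrightarrow> (\<Sum>n=1..m. 1 / real n ^ 2) \<le> 2 - 1 / real m"
proof (induction m rule: dec_induct)
  case (step m)
  have "1 / real (Suc m) ^ 2 \<le> 1 / (real m * real (Suc m))"
    using step(1) by (intro divide_left_mono) (auto simp: power2_eq_square intro!: mult_right_mono)
  also have "\<dots> = 1 / real m - 1 / real (Suc m)" using step(1) by (simp add: field_simps)
  finally show ?case using step(3) by simp
qed simp

lemma sum_inverse_squares_primes_le:
  assumes "\<And>p. p \<in> T \<Longrightarrow> prime p \<and> real p \<le> z"
  shows "(\<Sum>p\<in>T. 1 / real p ^ 2) \<le> 2"
proof (cases "T = {}")
  case False
  then obtain p where "p \<in> T" by auto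
  then have z: "z \<ge> 2" using assms[of p] prime_ge_2_nat[of p] by linarith
  have "T \<subseteq> {1..nat \<lfloor>z\<rfloor>}" by (auto dest!: assms(1) simp: le_nat_floor Suc_le_eq prime_gt_0_nat)
  then have "(\<Sum>p\<in>T. 1 / real p ^ 2) \<le> (\<Sum>n=1..nat \<lfloor>z\<rfloor>. 1 / real n ^ 2)" by (intro sum_mono2) auto
  also have "\<dots> \<le> 2 - 1 / real (nat \<lfloor>z\<rfloor>)"
  proof (rule sum_inverse_squares_le)
    show "1 \<le> nat \<lfloor>z\<rfloor>" using z by linarith
  qed
  finally show ?thesis by (rule order_trans) simp
qed simp

lemma sum_inverse_primes_le:
  assumes "\<And>p. p \<in> T \<Longrightarrow> prime p \<and> real p \<le> z" "z \<ge> 1"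
  shows "(\<Sum>p\<in>T. 1 / real p) \<le> 1 + ln z"
proof -
  have "T \<subseteq> {1..nat \<lfloor>z\<rfloor>}" by (auto dest!: assms(1) simp: le_nat_floor Suc_le_eq prime_gt_0_nat)
  then have "(\<Sum>p\<in>T. 1 / real p) \<le> (\<Sum>n=1..nat \<lfloor>z\<rfloor>. 1 / real n)" by (intro sum_mono2) auto
  also have "\<dots> \<le> 1 + ln (real (nat \<lfloor>z\<rfloor>))"
  proof (rule sum_inverse_le)
    show "1 \<le> nat \<lfloor>z\<rfloor>" using assms(2) by linarith
  qed
  also have "\<dots> \<le> 1 + ln z" 
  proof -
    have "0 < real (nat \<lfloor>z\<rfloor>)" "real (nat \<lfloor>z\<rfloor>) \<le> z" using assms(2) by linarith+
    then show ?thesis by simp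
  qed
  finally show ?thesis .
qed

context polynomial_family
begin

definition small_part :: "nat set \<Rightarrow> int \<Rightarrow> nat \<Rightarrow> nat" where
  "small_part S n0 j = (\<Prod>p\<in>S. p ^ multiplicity (int p) (poly (Q j) n0))"

text \<open>The valuation \<open>v\<close> of \<open>Q_j(n0)\<close> at \<open>p\<close> is less
  than \<open>K\<close>, so both \<open>p ^ v\<close> and \<open>p ^ Suc v\<close> divide
  \<open>p ^ K\<close>; congruence modulo \<open>p ^ K\<close> therefore transfers the exact
  valuation from \<open>n0\<close> to \<open>n\<close>.\<close>

lemma good_small_prime:
  assumes "good w0 z n0 K a n" "p \<in> small_primes w0 a" "\<not> int p ^ K dvd poly Qprod n0" "j \<in> {1..r}"
  shows "int p ^ multiplicity (int p) (poly (Q j) n0) dvd poly (Q j) n"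
    and "\<not> int p ^ Suc (multiplicity (int p) (poly (Q j) n0)) dvd poly (Q j) n"
proof -
  define v where "v = multiplicity (int p) (poly (Q j) n0)"
  have pr: "prime p" using assms(2) by (simp add: small_primes_def)
  have notdvd: "\<not> int p ^ K dvd poly (Q j) n0"
    using assms(3) poly_Q_dvd_Qprod[OF assms(4), of n0] dvd_trans by blast
  have v_dvd: "int p ^ v dvd poly (Q j) n0" unfolding v_def by (rule multiplicity_dvd)
  have vK: "v < K"
  proof (rule ccontr)
    assume "\<not> v < K"
    then have "int p ^ K dvd int p ^ v" by (intro le_imp_power_dvd) simp
    then show False using v_dvd notdvd dvd_trans by blast
  qed
  have cong: "int p ^ e dvd poly (Q j) n \<longleftrightarrow> int p ^ e dvd poly (Q j) n0" if "e \<le> K" for e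
  proof (rule dvd_poly_iff_of_dvd_diff)
    have "int p ^ e dvd int p ^ K" using that by (rule le_imp_power_dvd)
    also have "\<dots> dvd n - n0" using assms(1,2) by (simp add: good_def)
    finally show "int p ^ e dvd n - n0" .
  qed
  show "int p ^ multiplicity (int p) (poly (Q j) n0) dvd poly (Q j) n"
    using cong[of v] vK v_dvd by (simp add: v_def)
  have "\<not> int p ^ Suc v dvd poly (Q j) n0"
  proof
    assume h: "int p ^ Suc v dvd poly (Q j) n0"
    have "poly (Q j) n0 \<noteq> 0" using notdvd by auto
    moreover have "\<not> is_unit (int p)" using pr by auto
    ultimately have "Suc v \<le> v" using h unfolding v_def by (metis multiplicity_geI)
    then show False by simp
  qed
  then show "\<not> int p ^ Suc (multiplicity (int p) (poly (Q j) n0)) dvd poly (Q j) n"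
    using cong[of "Suc v"] vK by (simp add: v_def)
qed

lemma small_part_pos: "small_part (small_primes w0 a) n0 j > 0"
  unfolding small_part_def by (intro prod_pos) (auto simp: small_primes_def prime_gt_0_nat)

text \<open>A prime \<open>p \<le> z\<close> is small, sieving, or divides some \<open>a_i\<close>.
  The valuation is frozen in the first case and zero in the second. In the third, coprimality with
  the cofactor settles \<open>i = j\<close>, and for \<open>i \<noteq> j\<close> the prime would
  divide the values of two factors, hence also \<open>N\<close>.\<close>

lemma good_not_dvd:
  assumes adm: "admissible z a" and good: "good w0 z n0 K a n" and "prime p" "real p \<le> z"
    and n0: "\<And>p. prime p \<Longrightarrow> real p \<le> w0 \<Longrightarrow> \<not> int p ^ K dvd poly Qprod n0" and j: "j \<in> {1..r}"
  shows "\<not> int p * (int (a j) * int (small_part (small_primes w0 a) n0 j)) dvd poly (Q j) n"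
proof
  define S where "S = small_primes w0 a"
  define s where "s = small_part S n0 j"
  assume "int p * (int (a j) * int (small_part (small_primes w0 a) n0 j)) dvd poly (Q j) n"
  then have d: "int p * (int (a j) * int s) dvd poly (Q j) n" by (simp add: s_def S_def)
  have dp: "int p dvd poly (Q j) n" using d by (rule dvd_mult_left)
  have das: "int p * int (a j) dvd poly (Q j) n" "int p * int s dvd poly (Q j) n"
    using d by (auto dest: dvd_mult_left dvd_mult_right simp: mult.assoc[symmetric] mult.left_commute[of "int p"])
  have "p \<in> S \<or> p \<in> sieving_primes w0 z a \<or> (\<exists>i\<in>{1..r}. p dvd a i)"
    using assms(3,4) unfolding S_def small_primes_def sieving_primes_def
    by (cases "real p \<le> w0") (auto simp: prime_dvd_prod_iff)
  then consider "p \<in> S" | "p \<in> sieving_primes w0 z a" | i where "i \<in> {1..r}" "p dvd a i"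
    by blast
  then show False
  proof cases
    case 1
    define v where "v = multiplicity (int p) (poly (Q j) n0)"
    have "p ^ v dvd s" unfolding s_def small_part_def v_def using 1 by (intro dvd_prodI) (auto simp: S_def)
    then have "int p ^ v dvd int s" by (metis int_dvd_int_iff of_nat_power)
    then have "int p ^ Suc v dvd int p * int s" by simp
    then have "int p ^ Suc v dvd poly (Q j) n" using das(2) dvd_trans by blast
    moreover have "\<not> int p ^ K dvd poly Qprod n0" using 1 n0 by (simp add: S_def small_primes_def)
    ultimately show False using good_small_prime(2)[OF good _ _ j, of p] 1 by (simp add: v_def S_def)
  next
    case 2
    then have "\<not> int p dvd poly Qprod n" using good by (simp add: good_def)
    then show False using dp poly_Q_dvd_Qprod[OF j, of n] dvd_trans by blast
  next
    case 3
    show False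
    proof (cases "i = j")
      case True
      obtain u where u: "poly (Q j) n = int (a j) * u" using good j unfolding good_def dvd_def by blast
      have aj: "a j \<ge> 1" using adm j by (simp add: admissible_def)
      then have cop: "coprime u (int (a j))" using good j u unfolding good_def by fastforce
      have "int (a j) * int p dvd int (a j) * u" using das(1) u by (simp add: mult.commute)
      then have "int p dvd u" using aj by simp
      moreover have "int p dvd int (a j)" using 3 True by simp
      ultimately have "is_unit (int p)" using cop coprime_common_divisor by blast
      then show False using assms(3) by auto
    next
      case False
      have "\<not> int p dvd N"
      proof
        assume "int p dvd N"
        moreover have "int p dvd int (a i)" using 3 by simp
        moreover have "coprime (int (a i)) N" using adm 3 unfolding admissible_def by blast
        ultimately have "is_unit (int p)" using coprime_common_divisor by blast
        then show False using assms(3) by auto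
      qed
      moreover have "int p dvd poly (Q i) n"
      proof -
        have "int (a i) dvd poly (Q i) n" using good 3(1) unfolding good_def by blast
        moreover have "int p dvd int (a i)" using 3 by simp
        ultimately show ?thesis by (metis dvd_trans)
      qed
      ultimately show False using prime_dvd_Q_unique[OF 3(1) j False _ ] dp by blast
    qed
  qed
qed

lemma good_decomposition:
  assumes adm: "admissible z a" and good: "good w0 z n0 K a n" and "z \<ge> 2"
    and n0: "\<And>p. prime p \<Longrightarrow> real p \<le> w0 \<Longrightarrow> \<not> int p ^ K dvd poly Qprod n0" and j: "j \<in> {1..r}"
  defines "s \<equiv> small_part (small_primes w0 a) n0 j"
  defines "b \<equiv> nat \<bar>poly (Q j) n\<bar> div (a j * s)"
  shows "poly (Q j) n \<noteq> 0" "nat \<bar>poly (Q j) n\<bar> = a j * s * b" "b \<ge> 1" "coprime (a j) s"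
    "\<And>p. prime p \<Longrightarrow> p dvd b \<Longrightarrow> z < real p"
proof -
  have nd: "\<not> int p * (int (a j) * int s) dvd poly (Q j) n" if "prime p" "real p \<le> z" for p
    unfolding s_def by (rule good_not_dvd[OF adm good that n0 j])
  \<comment> \<open>Zero would be divisible by \<open>2 * a j * s\<close>, contradicting
    \<open>nd\<close> at the prime 2; this is where \<open>z \<ge> 2\<close> enters.\<close>
  show nz: "poly (Q j) n \<noteq> 0" using nd[of 2] assms(3) by auto
  have aj: "a j \<ge> 1" using adm j by (simp add: admissible_def)
  show cop: "coprime (a j) s"
    unfolding s_def small_part_def
  proof (rule prod_coprime_right)
    fix p assume p: "p \<in> small_primes w0 a"
    have "\<not> p dvd a j"
    proof
      assume "p dvd a j"
      also have "a j dvd (\<Prod>i\<in>{1..r}. a i)" using j by (intro dvd_prodI) auto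
      finally show False using p by (simp add: small_primes_def)
    qed
    then have "coprime p (a j)" using p by (intro prime_imp_coprime) (auto simp: small_primes_def)
    then show "coprime (a j) (p ^ multiplicity (int p) (poly (Q j) n0))" by (simp add: coprime_commute)
  qed
  have "(\<Prod>p\<in>small_primes w0 a. int p ^ multiplicity (int p) (poly (Q j) n0)) dvd poly (Q j) n"
    using good_small_prime(1)[OF good _ n0 j] by (intro prod_prime_powers_dvd finite_small_primes) (auto simp: small_primes_def)
  then have "int s dvd poly (Q j) n" by (simp add: s_def small_part_def)
  moreover have "int (a j) dvd poly (Q j) n" using good j unfolding good_def by blast
  ultimately have as: "int (a j) * int s dvd poly (Q j) n" using cop by (intro divides_mult) auto
  then have "int (a j * s) dvd \<bar>poly (Q j) n\<bar>" by simp
  then have as': "a j * s dvd nat \<bar>poly (Q j) n\<bar>" by (subst int_dvd_int_iff[symmetric]) simp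
  then show eq: "nat \<bar>poly (Q j) n\<bar> = a j * s * b" unfolding b_def by simp
  show b1: "b \<ge> 1" using eq nz by (cases "b = 0") auto
  fix p assume p: "prime p" "p dvd b"
  show "z < real p"
  proof (rule ccontr)
    assume "\<not> z < real p"
    then have 1: "\<not> int p * (int (a j) * int s) dvd poly (Q j) n" using nd p(1) by simp
    have "p * (a j * s) dvd nat \<bar>poly (Q j) n\<bar>" unfolding eq using p(2) by (metis mult.commute mult_dvd_mono dvd_refl)
    then have "int (p * (a j * s)) dvd int (nat \<bar>poly (Q j) n\<bar>)" by (simp only: int_dvd_int_iff)
    then show False using 1 by simp
  qed
qed

text \<open>The pigeons are the pairs \<open>(a, n)\<close>; the holes record the set of small primes not dividing \<open>a\<close>, which determines
  the \<open>s\<^sub>j\<close>, and the values \<open>f\<^sub>j(b\<^sub>j)\<close>. Within a hole, \<open>n\<close> determines \<open>a\<close>.\<close>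
lemma pigeonhole_value_count:
  fixes x y z w0 u :: real and V :: nat
  assumes "z \<ge> 2" "w0 \<ge> 0" "w0 \<le> z" "u \<ge> 1"
    and n0: "\<And>p. prime p \<Longrightarrow> real p \<le> w0 \<Longrightarrow> \<not> int p ^ K dvd poly Qprod n0"
    and f: "\<And>j. j \<in> {1..r} \<Longrightarrow> additive_fun (f j) \<and> sparse_values V z (f j)"
    and bound: "\<And>n::int. x < of_int n \<Longrightarrow> of_int n \<le> x + y \<Longrightarrow> real_of_int \<bar>poly Qprod n\<bar> \<le> z powr u"
  shows "(\<Sum>a\<in>coprime_tuples r N f z k. real (card {n::int. x < of_int n \<and> of_int n \<le> x + y \<and> good w0 z n0 K a n}))
    \<le> 2 ^ nat \<lfloor>w0\<rfloor> * (real V powr u) ^ r * (SUP k. value_count r Q f x y k)"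
proof -
  define Tk where "Tk = coprime_tuples r N f z k"
  define G where "G a = {n::int. x < of_int n \<and> of_int n \<le> x + y \<and> good w0 z n0 K a n}" for a
  define X where "X = Sigma Tk G"
  define sup where "sup = (SUP k. value_count r Q f x y k)"
  have sup: "value_count r Q f x y k \<le> sup" for k
    unfolding sup_def by (intro cSUP_upper bdd_above_value_count) auto
  have sup0: "0 \<le> sup" unfolding sup_def by (rule SUP_value_count_nonneg)
  have finT: "finite Tk"
    unfolding Tk_def coprime_tuples_def by (rule finite_subset[OF _ finite_tuples[of r z]]) auto
  have finG: "finite (G a)" for a unfolding G_def by (rule finite_int_interval)
  have finX: "finite X" unfolding X_def using finT finG by (intro finite_SigmaI)
  have adm: "admissible z a" and ak: "\<And>j. j \<in> {1..r} \<Longrightarrow> f j (a j) = k j" and aext: "a \<in> extensional {1..r}"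
    if "a \<in> Tk" for a
    using that unfolding Tk_def coprime_tuples_def admissible_def PiE_def by auto
  define s where "s S j = small_part S n0 j" for S j
  define b where "b a n j = nat \<bar>poly (Q j) n\<bar> div (a j * s (small_primes w0 a) j)" for a n j
  define \<Phi> where "\<Phi> = (\<lambda>(a, n). (small_primes w0 a, \<lambda>j\<in>{1..r}. f j (b a n j)))"
  define Vals where "Vals j = {f j m | m. m \<ge> 1 \<and> real m \<le> z powr u \<and> P_minus m > ereal z}" for j
  define Y where "Y = Pow {p::nat. prime p \<and> real p \<le> w0} \<times> PiE {1..r} Vals"
  have dec: "poly (Q j) n \<noteq> 0" "nat \<bar>poly (Q j) n\<bar> = a j * s (small_primes w0 a) j * b a n j" "b a n j \<ge> 1"
      "coprime (a j) (s (small_primes w0 a) j)" "\<And>p. prime p \<Longrightarrow> p dvd b a n j \<Longrightarrow> z < real p"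
    if "a \<in> Tk" "n \<in> G a" "j \<in> {1..r}" for a n j
    using good_decomposition[OF adm[OF that(1)] _ assms(1) n0 that(3)] that(2)
    unfolding b_def s_def G_def by blast+
  have finV: "finite (Vals j)" for j
  proof -
    have "finite {m::nat. real m \<le> z powr u \<and> (m \<ge> 1 \<and> P_minus m > ereal z)}" by (rule finite_nat_le_real)
    then have "finite (f j ` {m::nat. real m \<le> z powr u \<and> (m \<ge> 1 \<and> P_minus m > ereal z)})" by (rule finite_imageI)
    moreover have "Vals j = f j ` {m::nat. real m \<le> z powr u \<and> (m \<ge> 1 \<and> P_minus m > ereal z)}" unfolding Vals_def by blast
    ultimately show ?thesis by simp
  qed
  have cardV: "real (card (Vals j)) \<le> real V powr u" if "j \<in> {1..r}" for j
    using f[OF that] assms(4) unfolding sparse_values_def Vals_def by blast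
  have finY: "finite Y" unfolding Y_def using finV
    by (intro finite_cartesian_product finite_PiE) (auto intro: finite_subset[OF _ finite_primes_upto[of w0 "\<lambda>_. True"]])
  have \<Phi>Y: "\<Phi> \<in> X \<rightarrow> Y"
  proof
    fix t assume "t \<in> X"
    then obtain a n where t: "t = (a, n)" "a \<in> Tk" "n \<in> G a" by (auto simp: X_def)
    have "f j (b a n j) \<in> Vals j" if j: "j \<in> {1..r}" for j
    proof -
      note d = dec[OF t(2,3) j]
      have n: "x < of_int n" "of_int n \<le> x + y" "good w0 z n0 K a n" using t(3) by (auto simp: G_def)
      have "poly Qprod n \<noteq> 0"
        unfolding poly_prod using dec(1)[OF t(2,3)] by (simp add: prod_zero_iff)
      then have "\<bar>poly (Q j) n\<bar> \<le> \<bar>poly Qprod n\<bar>"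
        using poly_Q_dvd_Qprod[OF j, of n] by (intro dvd_imp_le_int) auto
      moreover have "b a n j \<le> nat \<bar>poly (Q j) n\<bar>" unfolding b_def by (rule div_le_dividend)
      then have "int (b a n j) \<le> \<bar>poly (Q j) n\<bar>" by linarith
      ultimately have "int (b a n j) \<le> \<bar>poly Qprod n\<bar>" by linarith
      then have "real_of_int (int (b a n j)) \<le> real_of_int \<bar>poly Qprod n\<bar>" by (simp only: of_int_le_iff)
      then have "real (b a n j) \<le> z powr u" using bound[OF n(1,2)] by simp
      moreover have "P_minus (b a n j) > ereal z" using d(5) by (rule P_minus_gt)
      ultimately show ?thesis unfolding Vals_def using d(3) by blast
    qed
    then show "\<Phi> t \<in> Y" unfolding \<Phi>_def Y_def t by (auto simp: small_primes_def)
  qed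
  have cardX: "real (card X) = (\<Sum>a\<in>Tk. real (card (G a)))"
    unfolding X_def using finT finG by (subst card_SigmaI) auto
  have cardY: "real (card Y) \<le> 2 ^ nat \<lfloor>w0\<rfloor> * (real V powr u) ^ r"
  proof -
    have "card {p::nat. prime p \<and> real p \<le> w0} \<le> card {1..nat \<lfloor>w0\<rfloor>}"
      by (intro card_mono) (auto simp: le_nat_floor dest: prime_gt_0_nat)
    then have "(2::real) ^ card {p::nat. prime p \<and> real p \<le> w0} \<le> 2 ^ nat \<lfloor>w0\<rfloor>" by (intro power_increasing) auto
    moreover have "(\<Prod>j\<in>{1..r}. real (card (Vals j))) \<le> (\<Prod>j\<in>{1..r}. real V powr u)"
      using cardV by (intro prod_mono) auto
    moreover have "real (card Y) = 2 ^ card {p::nat. prime p \<and> real p \<le> w0} * (\<Prod>j\<in>{1..r}. real (card (Vals j)))"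
      unfolding Y_def using finite_primes_upto[of w0 "\<lambda>_. True"]
      by (simp add: card_cartesian_product card_Pow card_PiE)
    ultimately show ?thesis by (auto intro!: mult_mono prod_nonneg)
  qed
  have "real (card X) \<le> real (card Y) * sup"
  proof (cases "X = {}")
    case True
    then show ?thesis using sup0 by simp
  next
    case False
    then have "Y \<noteq> {}" using \<Phi>Y by blast
    then obtain v where v: "v \<in> Y" "card (\<Phi> -` {v} \<inter> X) * card Y \<ge> card X"
      using pigeonhole_card[OF \<Phi>Y finX finY] by blast
    obtain S \<psi> where S\<psi>: "v = (S, \<psi>)" by (cases v)
    define Z where "Z = \<Phi> -` {v} \<inter> X"
    \<comment> \<open>The common value attained by all pairs in the hole, the three factors being
      pairwise coprime.\<close>
    define k' where "k' j = k j + f j (s S j) + \<psi> j" for j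
    have Z: "a \<in> Tk" "n \<in> G a" "small_primes w0 a = S" "\<And>j. j \<in> {1..r} \<Longrightarrow> f j (b a n j) = \<psi> j"
      if "(a, n) \<in> Z" for a n
      using that unfolding Z_def X_def \<Phi>_def S\<psi> by (auto simp: fun_eq_iff restrict_def split: if_splits)
    \<comment> \<open>The primes of \<open>a j * s S j\<close> are at most \<open>z\<close>, those
      of every \<open>b\<close> exceed \<open>z\<close>. Stating this for two different pairs is
      what makes the injectivity argument possible.\<close>
    have rough_coprime: "coprime (a j * s S j) (b a' n' j)" if h: "(a, n) \<in> Z" "(a', n') \<in> Z" "j \<in> {1..r}" for a n a' n' j
    proof (rule ccontr)
      assume "\<not> coprime (a j * s S j) (b a' n' j)"
      then have "gcd (a j * s S j) (b a' n' j) \<noteq> 1" by (simp only: coprime_iff_gcd_eq_1 not_False_eq_True)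
      then obtain p where "prime p" "p dvd gcd (a j * s S j) (b a' n' j)"
        using prime_factor_nat by blast
      then have p: "prime p" "p dvd a j * s S j" "p dvd b a' n' j" by simp_all
      have "z < real p" using dec(5)[OF Z(1,2)[OF h(2)] h(3)] p by blast
      have aj: "a j \<ge> 1" "real (a j) \<le> z" using adm[OF Z(1)[OF h(1)]] h(3) by (auto simp: admissible_def)
      have "\<not> p dvd a j"
      proof
        assume "p dvd a j"
        then have "p \<le> a j" using aj by (intro dvd_imp_le) auto
        then show False using aj \<open>z < real p\<close> by linarith
      qed
      then have "p dvd s S j" using p by (simp add: prime_dvd_mult_iff)
      moreover have fS: "finite S" "\<And>q. q \<in> S \<Longrightarrow> prime q \<and> real q \<le> w0"
        using Z(3)[OF h(1)] by (auto simp: small_primes_def intro: finite_primes_upto)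
      ultimately obtain q where q: "q \<in> S" "p dvd q ^ multiplicity (int q) (poly (Q j) n0)"
        unfolding s_def small_part_def using p(1) by (auto simp: prime_dvd_prod_iff)
      then have "p = q" using p(1) fS(2)[of q] by (metis prime_dvd_power primes_dvd_imp_eq)
      then show False using fS(2)[of q] q(1) \<open>z < real p\<close> assms(3) by simp
    qed
    \<comment> \<open>For a given \<open>n\<close>, the parts of \<open>Q_j(n)\<close> made of
      primes up to \<open>z\<close> and beyond \<open>z\<close> are unique; since
      \<open>s S j\<close> is constant in the hole, \<open>a j\<close> is determined.\<close>
    have inj: "inj_on snd Z"
    proof (rule inj_onI, clarify)
      fix a n a' n' assume h: "(a, n) \<in> Z" "(a', n') \<in> Z" "snd (a, n) = snd (a', n')"
      then have h': "(a', n) \<in> Z" by simp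
      have "a j = a' j" if j: "j \<in> {1..r}" for j
      proof -
        have eq: "a j * s S j * b a n j = a' j * s S j * b a' n j"
          by (rule trans[OF dec(2)[OF Z(1,2)[OF h(1)] j, unfolded Z(3)[OF h(1)], symmetric]
                dec(2)[OF Z(1,2)[OF h'] j, unfolded Z(3)[OF h']]])
        have "a j * s S j dvd a' j * s S j * b a' n j" using eq by (metis dvd_triv_left)
        then have 1: "a j * s S j dvd a' j * s S j"
          using rough_coprime[OF h(1) h' j] by (simp add: coprime_dvd_mult_left_iff)
        have "a' j * s S j dvd a j * s S j * b a n j" using eq by (metis dvd_triv_left)
        then have 2: "a' j * s S j dvd a j * s S j"
          using rough_coprime[OF h' h(1) j] by (simp add: coprime_dvd_mult_left_iff)
        have "s S j > 0" unfolding s_def Z(3)[OF h(1), symmetric] by (rule small_part_pos)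
        then show ?thesis using dvd_antisym[OF 1 2] by simp
      qed
      then have "a = a'" using aext[OF Z(1)[OF h(1)]] aext[OF Z(1)[OF h']] by (intro extensionalityI[of a "{1..r}" a']) auto
      then show "a = a' \<and> n = n'" using h(3) by simp
    qed
    have sub: "snd ` Z \<subseteq> {n::int. x < of_int n \<and> of_int n \<le> x + y \<and> (\<forall>j\<in>{1..r}. int_ext (f j) (poly (Q j) n) = k' j)}"
    proof clarsimp
      fix a n assume h: "(a, n) \<in> Z"
      have n: "x < of_int n" "of_int n \<le> x + y" using Z(2)[OF h] by (auto simp: G_def)
      have "int_ext (f j) (poly (Q j) n) = k' j" if j: "j \<in> {1..r}" for j
      proof -
        note d = dec[OF Z(1,2)[OF h] j, unfolded Z(3)[OF h]]
        have add: "f j (l * m) = f j l + f j m" if "l \<ge> 1" "m \<ge> 1" "coprime l m" for l m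
          using f[OF j] that unfolding additive_fun_def by blast
        have aj: "a j \<ge> 1" using adm[OF Z(1)[OF h]] j by (auto simp: admissible_def)
        have sj: "s S j \<ge> 1" unfolding s_def Z(3)[OF h, symmetric] using small_part_pos[of w0 a n0 j] by simp
        have "f j (nat \<bar>poly (Q j) n\<bar>) = f j (a j * s S j) + f j (b a n j)"
          unfolding d(2) using aj sj d(3) rough_coprime[OF h h j] by (intro add) auto
        also have "f j (a j * s S j) = f j (a j) + f j (s S j)" by (intro add aj sj d(4))
        finally show ?thesis
          using d(1) ak[OF Z(1)[OF h] j] Z(4)[OF h j] by (simp add: int_ext_def k'_def)
      qed
      then show "x < of_int n \<and> of_int n \<le> x + y \<and> (\<forall>j\<in>{Suc 0..r}. int_ext (f j) (poly (Q j) n) = k' j)"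
        using n by simp
    qed
    have "card Z = card (snd ` Z)" by (rule card_image[OF inj, symmetric])
    also have "\<dots> \<le> card {n::int. x < of_int n \<and> of_int n \<le> x + y \<and> (\<forall>j\<in>{1..r}. int_ext (f j) (poly (Q j) n) = k' j)}"
      by (rule card_mono[OF finite_int_interval sub])
    finally have "real (card Z) \<le> value_count r Q f x y k'" unfolding value_count_def by (rule of_nat_mono)
    then have Zs: "real (card Z) \<le> sup" using sup[of k'] by linarith
    have "real (card X) \<le> real (card Z * card Y)" using v(2) unfolding Z_def by (rule of_nat_mono)
    also have "\<dots> \<le> sup * real (card Y)" using Zs by (simp add: mult_right_mono)
    finally show ?thesis by (simp add: mult.commute)
  qed
  also have "\<dots> \<le> 2 ^ nat \<lfloor>w0\<rfloor> * (real V powr u) ^ r * sup"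
    using cardY sup0 by (rule mult_right_mono)
  finally show ?thesis using cardX unfolding Tk_def G_def sup_def by simp
qed

end


section \<open>The lower bound for general additive functions\<close>

text \<open>Collects the two lower bounds that the sieve imposes on its starting point.\<close>

definition sieve_start :: "nat \<Rightarrow> real" where
  "sieve_start g = max (2 ^ 28) (real g ^ 4)"

definition superfactorial :: "nat \<Rightarrow> nat" where
  "superfactorial g = (\<Prod>i\<le>g. fact i)"

text \<open>The modulus \<open>W\<close> belonging to the tuple of ones. The modulus of every other
  tuple divides it, so it is a uniform bound depending on \<open>g\<close> alone.\<close>

definition small_modulus :: "nat \<Rightarrow> nat" where
  "small_modulus g = (\<Prod>p | prime p \<and> real p \<le> sieve_start g. p ^ superfactorial g)"

lemma sieve_start_ge: "sieve_start g \<ge> 2 ^ 28" "sieve_start g \<ge> real g ^ 4" "sieve_start g \<ge> 2 * real g"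
proof -
  show 1: "sieve_start g \<ge> 2 ^ 28" "sieve_start g \<ge> real g ^ 4" by (auto simp: sieve_start_def)
  show "sieve_start g \<ge> 2 * real g" using 1 by (rule double_le_of_fourth_power)
qed

lemma finite_sieve_start: "finite {p::nat. prime p \<and> real p \<le> sieve_start g}"
  using finite_primes_upto[of "sieve_start g" "\<lambda>_. True"] by simp

lemma small_modulus_pos: "small_modulus g > 0"
  unfolding small_modulus_def by (intro prod_pos) (auto simp: prime_gt_0_nat)

section \<open>Size of polynomial values\<close>

lemma coeff_le_height: "\<bar>coeff P i\<bar> \<le> height P"
proof (cases "i \<le> degree P")
  case True
  then show ?thesis unfolding height_def by (intro Max_ge) auto
next
  case False
  have "\<bar>coeff P 0\<bar> \<le> height P" unfolding height_def by (intro Max_ge) auto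
  then show ?thesis using False by (simp add: coeff_eq_0)
qed

lemma height_ge_1: "P \<noteq> 0 \<Longrightarrow> height P \<ge> 1"
  using coeff_le_height[of P "degree P"] leading_coeff_neq_0[of P] by linarith

lemma abs_poly_le:
  fixes P :: "int poly"
  assumes "1 \<le> n" "real_of_int n \<le> X"
  shows "real_of_int \<bar>poly P n\<bar> \<le> real (degree P + 1) * real_of_int (height P) * X ^ degree P"
proof -
  have X: "X \<ge> 1" using assms by linarith
  have "\<bar>poly P n\<bar> \<le> (\<Sum>i\<le>degree P. \<bar>coeff P i * n ^ i\<bar>)"
    unfolding poly_altdef by (rule sum_abs)
  then have "real_of_int \<bar>poly P n\<bar> \<le> real_of_int (\<Sum>i\<le>degree P. \<bar>coeff P i * n ^ i\<bar>)" by (simp only: of_int_le_iff)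
  also have "\<dots> = (\<Sum>i\<le>degree P. real_of_int \<bar>coeff P i\<bar> * real_of_int n ^ i)"
    using assms(1) by (simp add: abs_mult)
  also have "\<dots> \<le> (\<Sum>i\<le>degree P. real_of_int (height P) * X ^ degree P)"
  proof (rule sum_mono)
    fix i assume i: "i \<in> {..degree P}"
    have "real_of_int n ^ i \<le> X ^ i" using assms by (intro power_mono) auto
    also have "\<dots> \<le> X ^ degree P" using X i by (intro power_increasing) auto
    finally have "real_of_int n ^ i \<le> X ^ degree P" .
    moreover have "real_of_int \<bar>coeff P i\<bar> \<le> real_of_int (height P)" by (simp only: of_int_le_iff coeff_le_height)
    moreover have "0 \<le> real_of_int n ^ i" using assms by simp
    moreover have "0 \<le> real_of_int (height P)" using \<open>real_of_int \<bar>coeff P i\<bar> \<le> _\<close> by linarith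
    ultimately show "real_of_int \<bar>coeff P i\<bar> * real_of_int n ^ i \<le> real_of_int (height P) * X ^ degree P"
      by (intro mult_mono) auto
  qed
  also have "\<dots> = real (degree P + 1) * real_of_int (height P) * X ^ degree P" by simp
  finally show ?thesis .
qed

context polynomial_family
begin

lemma height_Qprod_ge_1: "real_of_int (height Qprod) \<ge> 1"
proof -
  have "Qprod \<noteq> 0"
  proof
    assume "Qprod = 0"
    then have "degree Qprod = 0" by (simp only: degree_0)
    then show False using degree_pos by linarith
  qed
  then have "1 \<le> height Qprod" by (rule height_ge_1)
  then show ?thesis by simp
qed

text \<open>Local witnesses glued by the Chinese remainder theorem. The exponent depends only on
  \<open>g\<close>, which keeps the modulus bounded uniformly in the family.\<close>

lemma ex_small_residue:
  "\<exists>n0. \<forall>p. prime p \<longrightarrow> real p \<le> w0 \<longrightarrow> \<not> int p ^ superfactorial g dvd poly Qprod n0"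
proof -
  define K where "K = superfactorial g"
  define J where "J = {p::nat. prime p \<and> real p \<le> w0}"
  have "\<exists>n. \<not> int p ^ K dvd poly Qprod n" if "prime p" for p
    using ex_not_prime_power_dvd_poly[OF that prime_not_dvd_Qprod[OF that] order_refl]
    by (simp only: K_def superfactorial_def)
  then obtain u where u: "\<And>p. prime p \<Longrightarrow> \<not> int p ^ K dvd poly Qprod (u p)" by metis
  have "\<exists>c. \<forall>p\<in>J. int p ^ K dvd c - u p"
  proof (rule crt_family)
    show "finite J" unfolding J_def using finite_primes_upto[of w0 "\<lambda>_. True"] by simp
    fix p q assume "p \<in> J" "q \<in> J" "p \<noteq> q"
    then have "coprime p q" by (auto simp: J_def primes_coprime)
    then show "coprime (int p ^ K) (int q ^ K)" by simp
  qed
  then obtain c where c: "\<forall>p\<in>J. int p ^ K dvd c - u p" by blast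
  have "\<not> int p ^ K dvd poly Qprod c" if "prime p" "real p \<le> w0" for p
    using dvd_poly_iff_of_dvd_diff[of "int p ^ K" c "u p" Qprod] c u[OF that(1)] that by (auto simp: J_def)
  then show ?thesis unfolding K_def by blast
qed

lemma sieve_product_factor:
  assumes "prime p" "sieve_start g < real p"
  shows "root_count Qprod p / real p \<le> 1/2" "real g / real p \<le> 1/2"
    "root_count Qprod p / real p \<le> (\<Sum>j\<in>{1..r}. root_count (Q j) p) / real p"
    "(\<Sum>j\<in>{1..r}. root_count (Q j) p) / real p \<le> real g / real p"
    "root_count Qprod p / real p \<le> real g / real p"
proof -
  have p: "real p > 0" "2 * real g \<le> real p" using assms sieve_start_ge(3)[of g] by (auto simp: prime_gt_0_nat)
  show 1: "real g / real p \<le> 1/2" using p by (simp add: field_simps)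
  show "root_count Qprod p / real p \<le> (\<Sum>j\<in>{1..r}. root_count (Q j) p) / real p"
    using root_count_Qprod_le[OF assms(1)] by (intro divide_right_mono) auto
  show "(\<Sum>j\<in>{1..r}. root_count (Q j) p) / real p \<le> real g / real p"
    using sum_root_count_le[OF assms(1)] by (intro divide_right_mono) auto
  show 2: "root_count Qprod p / real p \<le> real g / real p"
    using root_count_Qprod_le_g[OF assms(1)] by (intro divide_right_mono) auto
  show "root_count Qprod p / real p \<le> 1/2" using 1 2 by linarith
qed

text \<open>A wasteful bound from the harmonic sum, but free of the constants \<open>M j\<close>: it
  serves to show that the sieve error is negligible from a threshold on that must not depend on the
  family beyond \<open>g\<close>.\<close>

lemma sieve_product_ge_powr:
  assumes T: "\<And>p. p \<in> T \<Longrightarrow> prime p \<and> sieve_start g < real p \<and> real p \<le> z" and "z \<ge> 1"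
  shows "exp (- 2 * real g) * z powr (- 2 * real g) \<le> (\<Prod>p\<in>T. 1 - root_count Qprod p / real p)"
proof -
  have finT: "finite T"
    by (rule finite_subset[OF _ finite_primes_upto[of z "\<lambda>_. True"]]) (auto dest: T)
  have "(\<Sum>p\<in>T. 1 / real p) \<le> 1 + ln z" using T assms(2) by (intro sum_inverse_primes_le) auto
  then have "2 * real g * (\<Sum>p\<in>T. 1 / real p) \<le> 2 * real g * (1 + ln z)" by (intro mult_left_mono) auto
  moreover have "(\<Sum>p\<in>T. - 2 * (real g / real p)) = - (2 * real g * (\<Sum>p\<in>T. 1 / real p))"
    unfolding sum_distrib_left sum_negf[symmetric] by (intro sum.cong refl) simp
  ultimately have le: "- 2 * real g + - 2 * real g * ln z \<le> (\<Sum>p\<in>T. - 2 * (real g / real p))"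
    by (simp add: distrib_left)
  have "exp (- 2 * real g) * z powr (- 2 * real g) = exp (- 2 * real g + - 2 * real g * ln z)"
    using assms(2) by (simp add: powr_def flip: exp_add)
  also have "\<dots> \<le> exp (\<Sum>p\<in>T. - 2 * (real g / real p))" using le by simp
  also have "\<dots> = (\<Prod>p\<in>T. exp (- 2 * (real g / real p)))" by (rule exp_sum[OF finT])
  also have "\<dots> \<le> (\<Prod>p\<in>T. 1 - root_count Qprod p / real p)"
  proof (rule prod_mono, rule conjI)
    fix p assume p: "p \<in> T"
    note f = sieve_product_factor[of p]
    have "exp (- 2 * (real g / real p)) \<le> 1 - real g / real p"
      using f(2) T[OF p] by (intro exp_minus_two_le) auto
    also have "\<dots> \<le> 1 - root_count Qprod p / real p" using f(5) T[OF p] by auto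
    finally show "exp (- 2 * (real g / real p)) \<le> 1 - root_count Qprod p / real p" .
  qed simp
  finally show ?thesis .
qed

lemma sum_mertens_le:
  assumes "\<And>j. j \<in> {1..r} \<Longrightarrow> mertens_bound (Q j) (M j)" "z \<ge> 2"
  shows "(\<Sum>p | prime p \<and> real p \<le> z. (\<Sum>j\<in>{1..r}. root_count (Q j) p) / real p)
      \<le> real r * ln (ln z) + (\<Sum>j\<in>{1..r}. M j)"
    and "real r * ln (ln z) - (\<Sum>j\<in>{1..r}. M j)
      \<le> (\<Sum>p | prime p \<and> real p \<le> z. (\<Sum>j\<in>{1..r}. root_count (Q j) p) / real p)"
proof -
  define B where "B j = (\<Sum>p | prime p \<and> real p \<le> z. root_count (Q j) p / real p)" for j
  have eq: "(\<Sum>p | prime p \<and> real p \<le> z. (\<Sum>j\<in>{1..r}. root_count (Q j) p) / real p) = (\<Sum>j\<in>{1..r}. B j)"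
    unfolding sum_divide_distrib B_def by (rule sum.swap)
  have bd: "\<bar>B j - ln (ln z)\<bar> \<le> M j" if "j \<in> {1..r}" for j
    using assms(1)[OF that] assms(2) unfolding mertens_bound_def B_def by blast
  have "(\<Sum>j\<in>{1..r}. B j) \<le> (\<Sum>j\<in>{1..r}. ln (ln z) + M j)" using bd by (intro sum_mono) (smt (verit))
  then show "(\<Sum>p | prime p \<and> real p \<le> z. (\<Sum>j\<in>{1..r}. root_count (Q j) p) / real p)
      \<le> real r * ln (ln z) + (\<Sum>j\<in>{1..r}. M j)" unfolding eq by (simp add: sum.distrib)
  have "(\<Sum>j\<in>{1..r}. ln (ln z) - M j) \<le> (\<Sum>j\<in>{1..r}. B j)" using bd by (intro sum_mono) (smt (verit))
  then show "real r * ln (ln z) - (\<Sum>j\<in>{1..r}. M j)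
      \<le> (\<Sum>p | prime p \<and> real p \<le> z. (\<Sum>j\<in>{1..r}. root_count (Q j) p) / real p)"
    unfolding eq by (simp add: sum_subtractf)
qed

text \<open>The sharp counterpart. With \<open>s p\<close> the sum of the root counts over
  \<open>p\<close>, \<open>1 - s p \<ge> exp (- s p - 2 (s p)\<^sup>2)\<close>; the linear terms are
  controlled by the Mertens bounds of the single factors, and the quadratic ones total at most
  \<open>4 g\<^sup>2\<close> because \<open>s p \<le> g / p\<close>.\<close>

lemma sieve_product_ge_mertens:
  assumes T: "\<And>p. p \<in> T \<Longrightarrow> prime p \<and> sieve_start g < real p \<and> real p \<le> z" and "z \<ge> 2"
    and M: "\<And>j. j \<in> {1..r} \<Longrightarrow> mertens_bound (Q j) (M j)"
  shows "exp (- (\<Sum>j\<in>{1..r}. M j)) * exp (- 4 * real g ^ 2) / ln z ^ r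
    \<le> (\<Prod>p\<in>T. 1 - root_count Qprod p / real p)"
proof -
  have finT: "finite T"
    by (rule finite_subset[OF _ finite_primes_upto[of z "\<lambda>_. True"]]) (auto dest: T)
  define s where "s p = (\<Sum>j\<in>{1..r}. root_count (Q j) p) / real p" for p
  have s0: "0 \<le> s p" for p unfolding s_def by (intro divide_nonneg_nonneg sum_nonneg) auto
  have lnz: "ln z > 0" using assms(2) by simp
  have "(\<Sum>p\<in>T. 1 / real p ^ 2) \<le> 2" using T by (intro sum_inverse_squares_primes_le[of T z]) auto
  then have 1: "(\<Sum>p\<in>T. 2 * real g ^ 2 * (1 / real p ^ 2)) \<le> 2 * real g ^ 2 * 2"
    unfolding sum_distrib_left[symmetric] by (intro mult_left_mono) auto
  have "(\<Sum>p\<in>T. s p) \<le> (\<Sum>p | prime p \<and> real p \<le> z. s p)"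
    using T s0 finite_primes_upto[of z "\<lambda>_. True"] by (intro sum_mono2) auto
  also have "\<dots> \<le> real r * ln (ln z) + (\<Sum>j\<in>{1..r}. M j)"
    unfolding s_def by (rule sum_mertens_le(1)[OF M assms(2)])
  finally have 2: "- (\<Sum>j\<in>{1..r}. M j) + - 4 * real g ^ 2 - real r * ln (ln z)
      \<le> (\<Sum>p\<in>T. - s p - 2 * real g ^ 2 * (1 / real p ^ 2))"
    using 1 unfolding sum_subtractf sum_negf by linarith
  have "exp (- (\<Sum>j\<in>{1..r}. M j)) * exp (- 4 * real g ^ 2) / ln z ^ r =
      exp (- (\<Sum>j\<in>{1..r}. M j) + - 4 * real g ^ 2 - real r * ln (ln z))"
  proof -
    have "exp (real r * ln (ln z)) = ln z ^ r" using lnz by (simp add: exp_of_nat_mult)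
    then show ?thesis by (simp only: exp_diff exp_add)
  qed
  also have "\<dots> \<le> exp (\<Sum>p\<in>T. - s p - 2 * real g ^ 2 * (1 / real p ^ 2))" using 2 by simp
  also have "\<dots> = (\<Prod>p\<in>T. exp (- s p - 2 * real g ^ 2 * (1 / real p ^ 2)))" by (rule exp_sum[OF finT])
  also have "\<dots> \<le> (\<Prod>p\<in>T. 1 - root_count Qprod p / real p)"
  proof (rule prod_mono, rule conjI)
    fix p assume p: "p \<in> T"
    have pT: "prime p" "sieve_start g < real p" using T[OF p] by auto
    note f = sieve_product_factor[OF pT]
    have sg: "s p \<le> real g / real p" using f(4) by (simp only: s_def)
    then have "s p ^ 2 \<le> (real g / real p) ^ 2" using s0 by (intro power_mono) auto
    then have "- s p - 2 * real g ^ 2 * (1 / real p ^ 2) \<le> - s p - 2 * s p ^ 2"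
      by (simp add: power_divide)
    also have "\<dots> \<le> ln (1 - s p)" using s0[of p] sg f(2) by (intro ln_one_minus_pos_lower_bound; linarith)
    finally have "- s p - 2 * real g ^ 2 * (1 / real p ^ 2) \<le> ln (1 - s p)" .
    moreover have "0 < 1 - s p" using sg f(2) by linarith
    ultimately have "exp (- s p - 2 * real g ^ 2 * (1 / real p ^ 2)) \<le> 1 - s p"
      using ln_ge_iff by blast
    also have "\<dots> \<le> 1 - root_count Qprod p / real p" using f(3) unfolding s_def by linarith
    finally show "exp (- s p - 2 * real g ^ 2 * (1 / real p ^ 2)) \<le> 1 - root_count Qprod p / real p" .
  qed simp
  finally show ?thesis .
qed

text \<open>The budget of exponents: \<open>y \<ge> z powr (50 g)\<close>, the modulus is at most
  \<open>W z powr (2 g)\<close>, and the crude sieve product is at least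
  \<open>exp (- 2 g) z powr (- 2 g)\<close>. The main term is thus of order at least
  \<open>z powr (46 g)\<close>. Once the error is absorbed, the crude product is exchanged for the
  sharp one, and summation over the tuples feeds the pigeonhole principle.\<close>

lemma tuple_sum_le:
  fixes x y z u :: real and V :: nat
  assumes z: "z \<ge> sieve_start g" "z \<ge> 4 * real (small_modulus g) * exp (2 * real g)"
    and y: "y \<ge> z powr (50 * real g)" and "u \<ge> 1"
    and M: "\<And>j. j \<in> {1..r} \<Longrightarrow> mertens_bound (Q j) (M j)"
    and f: "\<And>j. j \<in> {1..r} \<Longrightarrow> additive_fun (f j) \<and> sparse_values V z (f j)"
    and bound: "\<And>n::int. x < of_int n \<Longrightarrow> of_int n \<le> x + y \<Longrightarrow> real_of_int \<bar>poly Qprod n\<bar> \<le> z powr u"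
  shows "exp (- (\<Sum>j\<in>{1..r}. M j)) * y / ln z ^ r * tuple_sum r Q N f z k \<le>
    4 * real (small_modulus g) * exp (4 * real g ^ 2) * (2 ^ nat \<lfloor>sieve_start g\<rfloor> * (real V powr u) ^ r)
      * (SUP k. value_count r Q f x y k)"
proof -
  define w0 where "w0 = sieve_start g"
  define K where "K = superfactorial g"
  define W where "W = real (small_modulus g)"
  define m where "m = exp (- (\<Sum>j\<in>{1..r}. M j)) * exp (- 4 * real g ^ 2) / ln z ^ r"
  have W: "W \<ge> 1" unfolding W_def using small_modulus_pos[of g] by (simp add: Suc_le_eq)
  have w0: "w0 \<ge> 2 ^ 28" "w0 \<ge> real g ^ 4" unfolding w0_def by (rule sieve_start_ge)+
  have "(2::real) \<le> 2 ^ 28" by simp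
  then have z2: "z \<ge> 2" using z(1) w0(1) unfolding w0_def by linarith
  have y0: "y > 0" using y z2 by (intro less_le_trans[OF _ y]) simp
  obtain n0 where n0: "\<And>p. prime p \<Longrightarrow> real p \<le> w0 \<Longrightarrow> \<not> int p ^ K dvd poly Qprod n0"
    using ex_small_residue[of w0] unfolding K_def by blast
  define G where "G a = real (card {n::int. x < of_int n \<and> of_int n \<le> x + y \<and> good w0 z n0 K a n})" for a
  define \<tau> where "\<tau> a = (\<Prod>j\<in>{1..r}. root_count (Q j) (a j) * real (totient (a j)) / (real (a j))\<^sup>2)" for a
  have main: "\<tau> a * (y / (4 * W) * m) \<le> G a" if a: "a \<in> coprime_tuples r N f z k" for a
  proof -
    have adm: "admissible z a" using a unfolding coprime_tuples_def admissible_def PiE_def by auto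
    define A where "A = (\<Prod>j\<in>{1..r}. a j)"
    define WS where "WS = (\<Prod>p\<in>small_primes w0 a. p ^ K)"
    define T where "T = sieving_primes w0 z a"
    define P where "P = (\<Prod>p\<in>T. 1 - root_count Qprod p / real p)"
    have T: "prime p \<and> sieve_start g < real p \<and> real p \<le> z" if "p \<in> T" for p
      using that by (auto simp: T_def sieving_primes_def w0_def)
    have aj: "a j \<ge> 1" "real (a j) \<le> z" if "j \<in> {1..r}" for j using adm that by (auto simp: admissible_def)
    have Apos: "A > 0" unfolding A_def using aj(1) by (intro prod_pos) (simp add: Suc_le_eq)
    have "real A = (\<Prod>j\<in>{1..r}. real (a j))" by (simp add: A_def)
    also have "\<dots> \<le> (\<Prod>j\<in>{1..r}. z)" using aj by (intro prod_mono) auto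
    also have "\<dots> = z ^ r" by simp
    also have "\<dots> \<le> z ^ g" using z2 r_le_g by (intro power_increasing) auto
    finally have A: "real A \<le> z ^ g" .
    have WS: "WS > 0" "real WS \<le> W"
    proof -
      show "WS > 0" unfolding WS_def by (intro prod_pos) (auto simp: small_primes_def prime_gt_0_nat)
      have "WS dvd small_modulus g" unfolding WS_def small_modulus_def K_def w0_def
        by (intro prod_dvd_prod_subset finite_sieve_start) (auto simp: small_primes_def)
      then have "WS \<le> small_modulus g" using small_modulus_pos by (rule dvd_imp_le)
      then show "real WS \<le> W" by (simp add: W_def)
    qed
    have P1: "exp (- 2 * real g) * z powr (- 2 * real g) \<le> P"
      unfolding P_def using T z2 by (intro sieve_product_ge_powr) auto
    have P2: "m \<le> P" unfolding P_def m_def by (rule sieve_product_ge_mertens[OF T z2 M])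
    have P0: "0 \<le> P" using P1 by (rule order_trans[rotated]) simp
    define q where "q = real (WS * A ^ 2)"
    have q0: "q > 0" using WS Apos by (simp add: q_def)
    have qW: "q \<le> W * real A ^ 2" unfolding q_def using WS by (simp add: mult_right_mono)
    have "q \<le> W * z powr (2 * real g)"
    proof -
      have "real A ^ 2 \<le> (z ^ g) ^ 2" using A by (intro power_mono) auto
      also have "\<dots> = z ^ (2 * g)" by (simp only: power_mult[symmetric] mult.commute)
      also have "\<dots> = z powr real (2 * g)" using z2 by (intro powr_realpow[symmetric]) linarith
      also have "real (2 * g) = 2 * real g" by simp
      finally have "W * real A ^ 2 \<le> W * z powr (2 * real g)" using W by (intro mult_left_mono) auto
      then show ?thesis using qW by linarith
    qed
    then have "z powr (50 * real g) / (2 * (W * z powr (2 * real g))) \<le> y / (2 * q)"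
      using y q0 y0 by (intro frac_le) auto
    then have "z powr (50 * real g) / (2 * (W * z powr (2 * real g))) * (exp (- 2 * real g) * z powr (- 2 * real g))
        \<le> y / (2 * q) * P"
      using P1 y0 q0 by (intro mult_mono) auto
    also have "z powr (50 * real g) / (2 * (W * z powr (2 * real g))) * (exp (- 2 * real g) * z powr (- 2 * real g))
      = z powr (46 * real g) / (2 * W * exp (2 * real g))"
    proof -
      have "z powr (50 * real g) = z powr (46 * real g) * z powr (2 * real g) * z powr (2 * real g)"
        by (simp flip: powr_add)
      then show ?thesis using z2 W by (simp add: powr_minus exp_minus field_simps)
    qed
    finally have b1: "z powr (46 * real g) / (2 * W * exp (2 * real g)) \<le> y / (2 * q) * P" .
    have "4 * W * exp (2 * real g) * z powr (30 * real g + 9) \<le> z powr 1 * z powr (30 * real g + 9)"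
      using z(2) z2 by (intro mult_right_mono) (auto simp: W_def)
    also have "\<dots> = z powr (1 + (30 * real g + 9))" by (rule powr_add[symmetric])
    also have "1 + (30 * real g + 9) = 30 * real g + 10" by simp
    also have "z powr (30 * real g + 10) \<le> z powr (46 * real g)" using z2 degree_pos by (intro powr_mono) auto
    \<comment> \<open>The error is at most half of the main term; subtracting it turns
      \<open>2 q\<close> into \<open>4 q\<close> in the denominator.\<close>
    finally have "2 * z powr (30 * real g + 9) \<le> z powr (46 * real g) / (2 * W * exp (2 * real g))"
      using W by (simp add: field_simps)
    then have b2: "z powr (30 * real g + 9) \<le> y / (4 * q) * P" using b1 by simp
    have "y / (4 * W * real A ^ 2) * m \<le> y / (4 * q) * P"
    proof (cases "m \<ge> 0")
      case True
      have "y / (4 * W * real A ^ 2) \<le> y / (4 * q)" using qW q0 y0 W Apos by (intro divide_left_mono) auto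
      then show ?thesis using P2 True y0 q0 by (intro mult_mono) auto
    next
      case False
      then have "y / (4 * W * real A ^ 2) * m \<le> 0" using y0 W by (intro mult_nonneg_nonpos) auto
      also have "0 \<le> y / (4 * q) * P" using y0 q0 P0 by simp
      finally show ?thesis .
    qed
    also have "\<dots> \<le> y / (2 * q) * P - z powr (30 * real g + 9)" using b2 by simp
    finally have b3: "y / (4 * W * real A ^ 2) * m \<le> y / (2 * q) * P - z powr (30 * real g + 9)" .
    define R where "R = (\<Prod>j\<in>{1..r}. root_count (Q j) (a j) * real (totient (a j)))"
    have R0: "0 \<le> R" unfolding R_def by (intro prod_nonneg) auto
    have \<tau>: "\<tau> a = R / real A ^ 2"
      unfolding \<tau>_def R_def A_def by (simp add: prod_dividef prod_power_distrib)
    have "\<tau> a * (y / (4 * W) * m) = R * (y / (4 * W * real A ^ 2) * m)" by (simp add: \<tau>)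
    also have "\<dots> \<le> R * (y / (2 * q) * P - z powr (30 * real g + 9))" using b3 R0 by (rule mult_left_mono)
    also have "\<dots> \<le> G a"
      using card_good_ge[OF w0 z(1)[folded w0_def] less_imp_le[OF y0] adm, of K x n0]
      unfolding R_def q_def P_def T_def WS_def A_def G_def .
    finally show ?thesis .
  qed
  have "tuple_sum r Q N f z k * (y / (4 * W) * m) = (\<Sum>a\<in>coprime_tuples r N f z k. \<tau> a * (y / (4 * W) * m))"
    unfolding tuple_sum_def \<tau>_def by (rule sum_distrib_right)
  also have "\<dots> \<le> (\<Sum>a\<in>coprime_tuples r N f z k. G a)" by (intro sum_mono main)
  also have "\<dots> \<le> 2 ^ nat \<lfloor>w0\<rfloor> * (real V powr u) ^ r * (SUP k. value_count r Q f x y k)"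
    unfolding G_def using z2 w0 z(1) assms(4)
    by (intro pigeonhole_value_count n0 f bound) (auto simp: w0_def)
  finally have fin: "tuple_sum r Q N f z k * (y / (4 * W) * m) \<le>
      2 ^ nat \<lfloor>w0\<rfloor> * (real V powr u) ^ r * (SUP k. value_count r Q f x y k)" .
  have "exp (- (\<Sum>j\<in>{1..r}. M j)) * y / ln z ^ r * tuple_sum r Q N f z k =
      (4 * W * exp (4 * real g ^ 2)) * (tuple_sum r Q N f z k * (y / (4 * W) * m))"
    using W unfolding m_def by (simp add: exp_minus field_simps)
  also have "\<dots> \<le> (4 * W * exp (4 * real g ^ 2)) * (2 ^ nat \<lfloor>w0\<rfloor> * (real V powr u) ^ r * (SUP k. value_count r Q f x y k))"
    using fin W by (intro mult_left_mono) auto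
  finally show ?thesis unfolding W_def w0_def by (simp only: mult.assoc)
qed

end

text \<open>Isolates the first assertion for given constants, so that it can be reused with
  \<open>V = 2\<close> for truncated counts of prime factors.\<close>

definition value_count_bound :: "nat \<Rightarrow> nat \<Rightarrow> nat \<Rightarrow> real \<Rightarrow> real \<Rightarrow> real \<Rightarrow> real \<Rightarrow> bool" where
  "value_count_bound r g V \<epsilon> \<delta> c C \<longleftrightarrow>
    (\<forall>(Q :: nat \<Rightarrow> int poly) M x y f.
      poly_family r Q \<longrightarrow> degree (\<Prod>j\<in>{1..r}. Q j) = g \<longrightarrow>
      (\<forall>j\<in>{1..r}. mertens_bound (Q j) (M j)) \<longrightarrow>
      x \<ge> c * real_of_int (height (\<Prod>j\<in>{1..r}. Q j)) powr \<delta> \<longrightarrow> x powr \<epsilon> < y \<longrightarrow> y \<le> x \<longrightarrow>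
      (\<forall>j\<in>{1..r}. additive_fun (f j) \<and> sparse_values V (x powr (\<epsilon> / (50 * real g))) (f j)) \<longrightarrow>
      (SUP k :: nat \<Rightarrow> real. value_count r Q f x y k) \<ge>
        C * (exp (- (\<Sum>j\<in>{1..r}. M j)) * y / (ln x) ^ r *
          (SUP k :: nat \<Rightarrow> real. tuple_sum r Q
            (lead_coeff (\<Prod>j\<in>{1..r}. Q j) * poly_disc (\<Prod>j\<in>{1..r}. Q j)) f (x powr (\<epsilon> / (50 * real g))) k)))"

lemma ex_value_count_bound:
  fixes r g V :: nat and \<epsilon> \<delta> :: real
  assumes "r \<ge> 1" and "g \<ge> 1" and "V \<ge> 1"
    and "0 < \<epsilon>" and "\<epsilon> < 1" and "0 < \<delta>" and "\<delta> < 1"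
  shows "\<exists>c\<ge>1. \<exists>C>0. value_count_bound r g V \<epsilon> \<delta> c C"
proof -
  define \<epsilon>0 where "\<epsilon>0 = \<epsilon> / (50 * real g)"
  have \<epsilon>0: "0 < \<epsilon>0" "\<epsilon>0 \<le> 1" unfolding \<epsilon>0_def using assms by (auto simp: field_simps)
  \<comment> \<open>Chosen so that \<open>z powr u = x powr (1 / \<delta> + g + 1)\<close>. This
    bounds the values of the product: the height is at most \<open>x powr (1 / \<delta>)\<close>,
    the variable contributes \<open>x ^ g\<close>, and one more \<open>x\<close> absorbs the
    constants.\<close>
  define u where "u = (1 / \<delta> + real g + 1) / \<epsilon>0"
  have u: "u \<ge> 1"
  proof -
    have "0 \<le> 1 / \<delta>" using assms by simp
    then have "\<epsilon>0 \<le> 1 / \<delta> + real g + 1" using \<epsilon>0(2) by linarith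
    then show ?thesis unfolding u_def using \<epsilon>0 by (simp add: field_simps)
  qed
  define Z where "Z = max (sieve_start g) (4 * real (small_modulus g) * exp (2 * real g))"
  have Z: "Z \<ge> 2"
  proof -
    have "(2::real) \<le> 2 ^ 28" by simp
    then show ?thesis unfolding Z_def using sieve_start_ge(1)[of g] by linarith
  qed
  \<comment> \<open>The first entry ensures \<open>z \<ge> Z\<close>, the second that
    \<open>x\<close> exceeds the constant \<open>(g + 1) 2 ^ g\<close> in the bound for the
    values.\<close>
  define c0 where "c0 = max (Z powr (1 / \<epsilon>0)) (real (g + 1) * 2 ^ g)"
  define D where "D = 4 * real (small_modulus g) * exp (4 * real g ^ 2) * (2 ^ nat \<lfloor>sieve_start g\<rfloor> * (real V powr u) ^ r)"
  have D: "D > 0" unfolding D_def using small_modulus_pos[of g] assms(3) by (intro mult_pos_pos) auto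
  have c0: "c0 \<ge> 1"
  proof -
    have "1 \<le> Z powr (1 / \<epsilon>0)" using Z \<epsilon>0 by (intro ge_one_powr_ge_zero) auto
    then show ?thesis by (simp add: c0_def)
  qed
  have main: "1 / D * (exp (- (\<Sum>j\<in>{1..r}. M j)) * y / (ln x) ^ r *
          (SUP k :: nat \<Rightarrow> real. tuple_sum r Q
            (lead_coeff (\<Prod>j\<in>{1..r}. Q j) * poly_disc (\<Prod>j\<in>{1..r}. Q j)) f (x powr \<epsilon>0) k))
      \<le> (SUP k :: nat \<Rightarrow> real. value_count r Q f x y k)"
    if fam: "poly_family r Q" and deg: "degree (\<Prod>j\<in>{1..r}. Q j) = g"
      and M: "\<And>j. j \<in> {1..r} \<Longrightarrow> mertens_bound (Q j) (M j)"
      and x: "x \<ge> c0 * real_of_int (height (\<Prod>j\<in>{1..r}. Q j)) powr \<delta>"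
      and y: "x powr \<epsilon> < y" "y \<le> x"
      and f: "\<And>j. j \<in> {1..r} \<Longrightarrow> additive_fun (f j) \<and> sparse_values V (x powr \<epsilon>0) (f j)"
    for Q :: "nat \<Rightarrow> int poly" and M :: "nat \<Rightarrow> real" and x y f
  proof -
    interpret polynomial_family r Q
      by unfold_locales (use fam deg assms in auto)
    define H where "H = real_of_int (height Qprod)"
    have H: "H \<ge> 1" unfolding H_def by (rule height_Qprod_ge_1)
    have H\<delta>: "H powr \<delta> \<ge> 1" using H assms by (intro ge_one_powr_ge_zero) auto
    have xc: "x \<ge> c0 * H powr \<delta>" using x by (simp add: H_def)
    have x_c0: "x \<ge> c0"
    proof -
      have "c0 * 1 \<le> c0 * H powr \<delta>" using H\<delta> c0 by (intro mult_left_mono) auto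
      then show ?thesis using xc by linarith
    qed
    have x1: "x \<ge> 1" using x_c0 c0 by linarith
    have Hx: "H \<le> x powr (1 / \<delta>)"
    proof -
      have "1 * H powr \<delta> \<le> c0 * H powr \<delta>" using c0 H\<delta> by (intro mult_right_mono) auto
      then have "H powr \<delta> \<le> x" using xc by linarith
      then have "(H powr \<delta>) powr (1 / \<delta>) \<le> x powr (1 / \<delta>)" using assms by (intro powr_mono2) auto
      then show ?thesis using assms H by (simp add: powr_powr)
    qed
    define z where "z = x powr \<epsilon>0"
    have zZ: "z \<ge> Z"
    proof -
      have "Z powr (1 / \<epsilon>0) \<le> x" using x_c0 by (simp add: c0_def)
      then have "(Z powr (1 / \<epsilon>0)) powr \<epsilon>0 \<le> x powr \<epsilon>0" using \<epsilon>0 by (intro powr_mono2) auto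
      then show ?thesis using \<epsilon>0 Z by (simp add: powr_powr z_def)
    qed
    have z2: "z \<ge> 2" using zZ Z by linarith
    have zg: "z powr (50 * real g) = x powr \<epsilon>"
      unfolding z_def powr_powr \<epsilon>0_def using assms by simp
    have zu: "z powr u = x powr (1 / \<delta> + real g + 1)"
      unfolding z_def powr_powr u_def using \<epsilon>0 by simp
    have zx: "z \<le> x" unfolding z_def using x1 \<epsilon>0 powr_mono[of \<epsilon>0 1 x] by simp
    have bound: "real_of_int \<bar>poly Qprod n\<bar> \<le> z powr u" if n: "x < of_int n" "of_int n \<le> x + y" for n
    proof -
      have n1: "1 \<le> n" "real_of_int n \<le> 2 * x" using n x1 y(2) by linarith+
      have "real_of_int \<bar>poly Qprod n\<bar> \<le> real (g + 1) * H * (2 * x) ^ g"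
        using abs_poly_le[OF n1, of Qprod] unfolding deg H_def .
      also have "\<dots> = (real (g + 1) * 2 ^ g) * H * x ^ g" by (simp add: power_mult_distrib)
      also have "\<dots> \<le> x * x powr (1 / \<delta>) * x ^ g"
      proof (intro mult_mono)
        show "real (g + 1) * 2 ^ g \<le> x" using x_c0 by (simp add: c0_def)
      qed (use Hx H x1 in auto)
      also have "\<dots> = x powr (1 / \<delta> + real g + 1)"
        using x1 by (simp add: powr_add powr_realpow)
      finally show ?thesis using zu by simp
    qed
    define E where "E = exp (- (\<Sum>j\<in>{1..r}. M j)) * y"
    have y0: "y \<ge> 0" using y(1) by (smt (verit) powr_ge_zero)
    have E0: "E \<ge> 0" unfolding E_def using y0 by simp
    define sup where "sup = (SUP k :: nat \<Rightarrow> real. value_count r Q f x y k)"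
    have sup0: "0 \<le> sup" unfolding sup_def by (rule SUP_value_count_nonneg)
    have bnd: "E / ln z ^ r * tuple_sum r Q N f z k \<le> D * sup" for k
    proof -
      have "E / ln z ^ r * tuple_sum r Q N f z k \<le>
        4 * real (small_modulus (degree Qprod)) * exp (4 * real (degree Qprod) ^ 2) *
        (2 ^ nat \<lfloor>sieve_start (degree Qprod)\<rfloor> * (real V powr u) ^ r) * (SUP k. value_count r Q f x y k)"
        unfolding E_def
      proof (rule tuple_sum_le)
        show "z \<ge> sieve_start (degree Qprod)" "z \<ge> 4 * real (small_modulus (degree Qprod)) * exp (2 * real (degree Qprod))"
          using zZ unfolding deg Z_def by auto
        show "y \<ge> z powr (50 * real (degree Qprod))" unfolding deg using y(1) zg by simp
        show "additive_fun (f j) \<and> sparse_values V z (f j)" if "j \<in> {1..r}" for j using f[OF that] by (simp add: z_def)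
      qed (use u M bound in auto)
      then show ?thesis unfolding deg D_def sup_def .
    qed
    have lnz: "0 < ln z" "ln z \<le> ln x" using z2 zx by auto
    have ts0: "0 \<le> tuple_sum r Q N f z k" for k
      unfolding tuple_sum_def by (intro sum_nonneg prod_nonneg) auto
    have bnd': "E / ln x ^ r * tuple_sum r Q N f z k \<le> D * sup" for k
    proof -
      have "E / ln x ^ r \<le> E / ln z ^ r" using lnz E0 by (intro divide_left_mono power_mono) auto
      then have "E / ln x ^ r * tuple_sum r Q N f z k \<le> E / ln z ^ r * tuple_sum r Q N f z k"
        using ts0 by (intro mult_right_mono) auto
      then show ?thesis using bnd[of k] by linarith
    qed
    have "E / ln x ^ r * (SUP k :: nat \<Rightarrow> real. tuple_sum r Q N f z k) \<le> D * sup"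
    proof (cases "E / ln x ^ r = 0")
      case True
      show ?thesis unfolding True using D sup0 by simp
    next
      case False
      then have pos: "E / ln x ^ r > 0" using E0 lnz by (metis divide_nonneg_nonneg less_eq_real_def order_trans zero_le_power)
      have "(SUP k :: nat \<Rightarrow> real. tuple_sum r Q N f z k) \<le> D * sup / (E / ln x ^ r)"
      proof (rule cSUP_least)
        fix k :: "nat \<Rightarrow> real"
        show "tuple_sum r Q N f z k \<le> D * sup / (E / ln x ^ r)"
          unfolding pos_le_divide_eq[OF pos] using bnd'[of k] by (simp only: mult.commute)
      qed simp
      then show ?thesis unfolding pos_le_divide_eq[OF pos] by (simp only: mult.commute)
    qed
    from divide_right_mono[OF this less_imp_le[OF D]]
    have "1 / D * (E / ln x ^ r * (SUP k :: nat \<Rightarrow> real. tuple_sum r Q N f z k)) \<le> sup"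
      using D by (simp add: mult.commute)
    then show ?thesis unfolding E_def N_def z_def sup_def .
  qed
  have "value_count_bound r g V \<epsilon> \<delta> c0 (1 / D)"
    unfolding value_count_bound_def \<epsilon>0_def[symmetric] using main by blast
  moreover have "1 / D > 0" using D by simp
  ultimately show ?thesis using c0 by blast
qed


section \<open>Truncated numbers of prime factors\<close>

lemma additive_omega_upto: "additive_fun (omega_upto y)"
  unfolding additive_fun_def
proof (intro allI impI)
  fix m n :: nat assume mn: "1 \<le> m" "1 \<le> n" "coprime m n"
  have "{p \<in> prime_factors (m * n). real p \<le> y} = {p \<in> prime_factors m. real p \<le> y} \<union> {p \<in> prime_factors n. real p \<le> y}"
    using mn by (auto simp: prime_factors_product)
  moreover have "{p \<in> prime_factors m. real p \<le> y} \<inter> {p \<in> prime_factors n. real p \<le> y} = {}"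
  proof -
    have False if "p \<in> prime_factors m" "p \<in> prime_factors n" for p
    proof -
      have p: "prime p" "p dvd m" "p dvd n" using that by auto
      have "is_unit p" by (rule coprime_common_divisor[OF mn(3) p(2,3)])
      then show False using p(1) by auto
    qed
    then show ?thesis by blast
  qed
  ultimately show "omega_upto y (m * n) = omega_upto y m + omega_upto y n"
    by (simp add: omega_upto_def card_Un_disjoint)
qed

text \<open>All prime factors of \<open>n\<close> exceed \<open>t\<close>, so
  \<open>n \<le> t powr u\<close> has at most \<open>u\<close> of them; the possible values are
  \<open>0\<close> up to the floor of \<open>u\<close>, and their number is at most
  \<open>2 powr u\<close>.\<close>

lemma sparse_omega_upto:
  assumes "z > 1"
  shows "sparse_values 2 z (omega_upto y)"
  unfolding sparse_values_def
proof (intro allI impI)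
  fix t u :: real assume tu: "t \<ge> z" "u \<ge> 1"
  have t1: "t > 1" using tu assms by linarith
  have sub: "{omega_upto y n | n. n \<ge> 1 \<and> real n \<le> t powr u \<and> P_minus n > ereal t} \<subseteq> real ` {..nat \<lfloor>u\<rfloor>}"
  proof clarify
    fix n :: nat assume n: "n \<ge> 1" "real n \<le> t powr u" "P_minus n > ereal t"
    define m where "m = card {p \<in> prime_factors n. real p \<le> y}"
    have "t < real p" if "p \<in> prime_factors n" for p
    proof -
      have "P_minus n \<le> ereal (real p)" unfolding P_minus_def using that by (rule INF_lower)
      then have "ereal t < ereal (real p)" using n(3) by (rule less_le_trans[rotated])
      then show ?thesis by simp
    qed
    then have "(\<Prod>p\<in>prime_factors n. t) \<le> (\<Prod>p\<in>prime_factors n. real p)"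
      using t1 by (intro prod_mono) (auto intro: less_imp_le)
    also have "\<dots> = real (\<Prod>(prime_factors n))" by simp
    also have "\<dots> \<le> real n"
      using n(1) by (intro of_nat_mono dvd_imp_le prod_primes_dvd) auto
    also have "\<dots> \<le> t powr u" by (rule n(2))
    finally have "t powr real (card (prime_factors n)) \<le> t powr u" using t1 by (simp add: powr_realpow)
    then have "real (card (prime_factors n)) \<le> u" using t1 by simp
    moreover have "m \<le> card (prime_factors n)" unfolding m_def by (intro card_mono) auto
    ultimately have "real m \<le> u" by linarith
    then have "m \<in> {..nat \<lfloor>u\<rfloor>}" by (simp add: le_nat_floor)
    then show "omega_upto y n \<in> real ` {..nat \<lfloor>u\<rfloor>}" unfolding omega_upto_def m_def by blast
  qed
  have "card {omega_upto y n | n. n \<ge> 1 \<and> real n \<le> t powr u \<and> P_minus n > ereal t} \<le> card (real ` {..nat \<lfloor>u\<rfloor>})"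
    by (rule card_mono[OF _ sub]) simp
  also have "\<dots> = nat \<lfloor>u\<rfloor> + 1" by (simp add: card_image)
  finally have "real (card {omega_upto y n | n. n \<ge> 1 \<and> real n \<le> t powr u \<and> P_minus n > ereal t}) \<le> real (nat \<lfloor>u\<rfloor> + 1)"
    by (rule of_nat_mono)
  also have "\<dots> \<le> 2 ^ nat \<lfloor>u\<rfloor>"
  proof -
    have "nat \<lfloor>u\<rfloor> + 1 \<le> 2 ^ nat \<lfloor>u\<rfloor>" using Suc_leI[OF less_exp[of "nat \<lfloor>u\<rfloor>"]] by simp
    then have "real (nat \<lfloor>u\<rfloor> + 1) \<le> real (2 ^ nat \<lfloor>u\<rfloor>)" by (rule of_nat_mono)
    then show ?thesis by simp
  qed
  also have "\<dots> = 2 powr real (nat \<lfloor>u\<rfloor>)" by (simp add: powr_realpow)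
  also have "\<dots> \<le> 2 powr u" using tu by (intro powr_mono) linarith+
  finally show "real (card {omega_upto y n | n. n \<ge> 1 \<and> real n \<le> t powr u \<and> P_minus n > ereal t}) \<le> real 2 powr u"
    by simp
qed

section \<open>Moments under a product measure\<close>

lemma sum_PiE_insert:
  assumes "p \<notin> S"
  shows "(\<Sum>\<sigma>\<in>PiE (insert p S) (\<lambda>_. I). F \<sigma>) = (\<Sum>i\<in>I. \<Sum>\<sigma>\<in>PiE S (\<lambda>_. I). F (\<sigma>(p := i)))"
proof -
  have "(\<Sum>\<sigma>\<in>PiE (insert p S) (\<lambda>_. I). F \<sigma>) = (\<Sum>(i, \<sigma>)\<in>I \<times> PiE S (\<lambda>_. I). F (\<sigma>(p := i)))"
    unfolding PiE_insert_eq using inj_combinator[OF assms, of "\<lambda>_. I"]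
    by (subst sum.reindex) (auto simp: case_prod_beta intro!: sum.cong)
  then show ?thesis by (simp add: sum.cartesian_product)
qed

text \<open>Each \<open>h p\<close> is a distribution on the classes \<open>I\<close> of total mass
  1; the summand is the weight of an assignment when the elements of \<open>S\<close> choose their
  classes independently.\<close>

lemma sum_PiE_weights:
  fixes h :: "'p \<Rightarrow> 'i \<Rightarrow> real"
  assumes "finite S" "finite I" "\<And>p. p \<in> S \<Longrightarrow> (\<Sum>i\<in>I. h p i) = 1"
  shows "(\<Sum>\<sigma>\<in>PiE S (\<lambda>_. I). \<Prod>p\<in>S. h p (\<sigma> p)) = 1"
  using assms prod_sum_PiE[of S "\<lambda>_. I" h] by simp

lemma prod_fun_upd_notin:
  assumes "p \<notin> S"
  shows "(\<Prod>q\<in>S. f q ((\<sigma>(p := i)) q)) = (\<Prod>q\<in>S. f q (\<sigma> q))"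
  using assms by (intro prod.cong) auto

lemma sum_fun_upd_notin:
  assumes "p \<notin> S"
  shows "(\<Sum>q\<in>S. f q ((\<sigma>(p := i)) q)) = (\<Sum>q\<in>S. f q (\<sigma> q))"
  using assms by (intro sum.cong) auto

lemma sum_PiE_first_moment:
  fixes h d :: "'p \<Rightarrow> 'i \<Rightarrow> real"
  assumes "finite S" "finite I" "\<And>p. p \<in> S \<Longrightarrow> (\<Sum>i\<in>I. h p i) = 1"
  shows "(\<Sum>\<sigma>\<in>PiE S (\<lambda>_. I). (\<Prod>p\<in>S. h p (\<sigma> p)) * (\<Sum>p\<in>S. d p (\<sigma> p))) = (\<Sum>p\<in>S. \<Sum>i\<in>I. h p i * d p i)"
  using assms(1,3)
proof (induction S)
  case (insert p S)
  define w where "w \<sigma> = (\<Prod>q\<in>S. h q (\<sigma> q))" for \<sigma>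
  define C where "C \<sigma> = (\<Sum>q\<in>S. d q (\<sigma> q))" for \<sigma>
  let ?E = "PiE S (\<lambda>_. I)"
  have w1: "(\<Sum>\<sigma>\<in>?E. w \<sigma>) = 1" unfolding w_def using insert assms(2) by (intro sum_PiE_weights) auto
  have IH: "(\<Sum>\<sigma>\<in>?E. w \<sigma> * C \<sigma>) = (\<Sum>p\<in>S. \<Sum>i\<in>I. h p i * d p i)" unfolding w_def C_def using insert by auto
  have hp: "(\<Sum>i\<in>I. h p i) = 1" using insert by auto
  have "(\<Sum>\<sigma>\<in>PiE (insert p S) (\<lambda>_. I). (\<Prod>q\<in>insert p S. h q (\<sigma> q)) * (\<Sum>q\<in>insert p S. d q (\<sigma> q)))
      = (\<Sum>i\<in>I. \<Sum>\<sigma>\<in>?E. (h p i * w \<sigma>) * (d p i + C \<sigma>))"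
    using insert(1,2) by (simp only: sum_PiE_insert prod.insert sum.insert not_False_eq_True fun_upd_same
      prod_fun_upd_notin sum_fun_upd_notin w_def C_def)
  also have "\<dots> = (\<Sum>i\<in>I. h p i * d p i * (\<Sum>\<sigma>\<in>?E. w \<sigma>) + h p i * (\<Sum>\<sigma>\<in>?E. w \<sigma> * C \<sigma>))"
    unfolding sum_distrib_left sum.distrib[symmetric] by (intro sum.cong refl) (simp add: algebra_simps)
  also have "\<dots> = (\<Sum>i\<in>I. h p i * d p i) + (\<Sum>i\<in>I. h p i) * (\<Sum>\<sigma>\<in>?E. w \<sigma> * C \<sigma>)"
    unfolding w1 by (simp add: sum.distrib sum_distrib_right)
  finally show ?case using insert(1,2) IH hp by simp
qed simp

text \<open>The variance of a sum of independent centred variables: the cross terms vanish because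
  each \<open>c p\<close> has mean zero.\<close>

lemma sum_PiE_second_moment:
  fixes h c :: "'p \<Rightarrow> 'i \<Rightarrow> real"
  assumes "finite S" "finite I" "\<And>p. p \<in> S \<Longrightarrow> (\<Sum>i\<in>I. h p i) = 1" "\<And>p. p \<in> S \<Longrightarrow> (\<Sum>i\<in>I. h p i * c p i) = 0"
  shows "(\<Sum>\<sigma>\<in>PiE S (\<lambda>_. I). (\<Prod>p\<in>S. h p (\<sigma> p)) * (\<Sum>p\<in>S. c p (\<sigma> p))\<^sup>2) = (\<Sum>p\<in>S. \<Sum>i\<in>I. h p i * (c p i)\<^sup>2)"
  using assms(1,3,4)
proof (induction S)
  case (insert p S)
  define w where "w \<sigma> = (\<Prod>q\<in>S. h q (\<sigma> q))" for \<sigma>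
  define C where "C \<sigma> = (\<Sum>q\<in>S. c q (\<sigma> q))" for \<sigma>
  let ?E = "PiE S (\<lambda>_. I)"
  have w1: "(\<Sum>\<sigma>\<in>?E. w \<sigma>) = 1" unfolding w_def using insert assms(2) by (intro sum_PiE_weights) auto
  have IH: "(\<Sum>\<sigma>\<in>?E. w \<sigma> * (C \<sigma>)\<^sup>2) = (\<Sum>p\<in>S. \<Sum>i\<in>I. h p i * (c p i)\<^sup>2)" unfolding w_def C_def using insert by auto
  have hp: "(\<Sum>i\<in>I. h p i) = 1" "(\<Sum>i\<in>I. h p i * c p i) = 0" using insert by auto
  have "(\<Sum>\<sigma>\<in>PiE (insert p S) (\<lambda>_. I). (\<Prod>q\<in>insert p S. h q (\<sigma> q)) * (\<Sum>q\<in>insert p S. c q (\<sigma> q))\<^sup>2)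
      = (\<Sum>i\<in>I. \<Sum>\<sigma>\<in>?E. (h p i * w \<sigma>) * (c p i + C \<sigma>)\<^sup>2)"
    using insert(1,2) by (simp only: sum_PiE_insert prod.insert sum.insert not_False_eq_True fun_upd_same
      prod_fun_upd_notin sum_fun_upd_notin w_def C_def)
  also have "\<dots> = (\<Sum>i\<in>I. h p i * (c p i)\<^sup>2 * (\<Sum>\<sigma>\<in>?E. w \<sigma>) + h p i * c p i * (2 * (\<Sum>\<sigma>\<in>?E. w \<sigma> * C \<sigma>))
      + h p i * (\<Sum>\<sigma>\<in>?E. w \<sigma> * (C \<sigma>)\<^sup>2))"
    unfolding sum_distrib_left sum.distrib[symmetric]
    by (intro sum.cong refl) (simp add: algebra_simps power2_eq_square)
  also have "\<dots> = (\<Sum>i\<in>I. h p i * (c p i)\<^sup>2) + (\<Sum>i\<in>I. h p i * c p i) * (2 * (\<Sum>\<sigma>\<in>?E. w \<sigma> * C \<sigma>))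
      + (\<Sum>i\<in>I. h p i) * (\<Sum>\<sigma>\<in>?E. w \<sigma> * (C \<sigma>)\<^sup>2)"
    unfolding w1 by (simp add: sum.distrib sum_distrib_right)
  finally show ?case using insert(1,2) IH hp by simp
qed simp

lemma card_nat_ball_le:
  fixes \<mu> R :: real
  assumes "R \<ge> 0"
  shows "finite {n::nat. \<bar>real n - \<mu>\<bar> \<le> R}" "real (card {n::nat. \<bar>real n - \<mu>\<bar> \<le> R}) \<le> 2 * R + 1"
proof -
  define A where "A = {n::nat. \<bar>real n - \<mu>\<bar> \<le> R}"
  have sub: "int ` A \<subseteq> {\<lceil>\<mu> - R\<rceil>..\<lfloor>\<mu> + R\<rfloor>}"
    unfolding A_def by (auto simp: ceiling_le_iff le_floor_iff abs_le_iff algebra_simps)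
  have "finite (int ` A)" using sub by (rule finite_subset) simp
  then have fin: "finite A" by (rule finite_imageD) simp
  then show "finite {n::nat. \<bar>real n - \<mu>\<bar> \<le> R}" by (simp add: A_def)
  have "card A = card (int ` A)" by (simp add: card_image)
  also have "\<dots> \<le> card {\<lceil>\<mu> - R\<rceil>..\<lfloor>\<mu> + R\<rfloor>}" using sub by (intro card_mono) auto
  also have "\<dots> = nat (\<lfloor>\<mu> + R\<rfloor> - \<lceil>\<mu> - R\<rceil> + 1)" by simp
  finally have "card A \<le> nat (\<lfloor>\<mu> + R\<rfloor> - \<lceil>\<mu> - R\<rceil> + 1)" .
  moreover have "real (nat (\<lfloor>\<mu> + R\<rfloor> - \<lceil>\<mu> - R\<rceil> + 1)) \<le> 2 * R + 1"
  proof (cases "\<lfloor>\<mu> + R\<rfloor> - \<lceil>\<mu> - R\<rceil> + 1 \<ge> 0")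
    case True
    have "real (nat (\<lfloor>\<mu> + R\<rfloor> - \<lceil>\<mu> - R\<rceil> + 1)) = real_of_int \<lfloor>\<mu> + R\<rfloor> - real_of_int \<lceil>\<mu> - R\<rceil> + 1"
      using True by simp
    moreover have "real_of_int \<lfloor>\<mu> + R\<rfloor> \<le> \<mu> + R" "\<mu> - R \<le> real_of_int \<lceil>\<mu> - R\<rceil>" by linarith+
    ultimately show ?thesis by linarith
  qed (use assms in simp)
  ultimately show "real (card {n::nat. \<bar>real n - \<mu>\<bar> \<le> R}) \<le> 2 * R + 1"
    unfolding A_def[symmetric] by (meson of_nat_mono order_trans)
qed

lemma prime_factors_prod_primes:
  assumes "finite A" "\<And>p. p \<in> A \<Longrightarrow> prime (p::nat)"
  shows "prime_factors (\<Prod>A) = A" "\<Prod>A > 0"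
proof -
  show pos: "\<Prod>A > 0" using assms(2) by (intro prod_pos) (simp add: prime_gt_0_nat)
  have "p \<in> A" if pd: "prime p" "p dvd \<Prod>A" for p
  proof -
    obtain q where "q \<in> A" "p dvd q" using prime_dvd_prod_iff[OF assms(1) pd(1), of "\<lambda>x. x"] pd(2) by blast
    then show ?thesis using pd(1) assms(2)[of q] by (metis primes_dvd_imp_eq)
  qed
  moreover have "p dvd \<Prod>A" if "p \<in> A" for p using assms(1) that by (rule dvd_prodI)
  ultimately show "prime_factors (\<Prod>A) = A" using assms(2) pos by (auto simp: in_prime_factors_iff)
qed

text \<open>The random tuples consist of products of distinct primes, so their weights factor by
  multiplicativity on coprime arguments.\<close>

lemma root_weight_prod_primes:
  assumes "finite A" "\<And>p. p \<in> A \<Longrightarrow> prime (p::nat)"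
  shows "root_count P (\<Prod>A) * real (totient (\<Prod>A)) / (real (\<Prod>A))\<^sup>2
    = (\<Prod>p\<in>A. root_count P p * (real p - 1) / (real p)\<^sup>2)"
  using assms
proof (induction A)
  case (insert p A)
  have cop: "coprime p (\<Prod>A)"
    using insert by (intro prod_coprime_right) (metis insertCI primes_coprime)
  have pos: "p > 0" "\<Prod>A > 0" using insert prime_factors_prod_primes(2)[of A] by (auto simp: prime_gt_0_nat)
  have "prime p" using insert by simp
  then have tp: "real (totient p) = real p - 1"
    using prime_ge_1_nat[of p] by (simp add: totient_prime of_nat_diff)
  have "\<Prod>(insert p A) = p * \<Prod>A" using insert by simp
  then have "root_count P (\<Prod>(insert p A)) * real (totient (\<Prod>(insert p A))) / (real (\<Prod>(insert p A)))\<^sup>2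
      = root_count P p * (real p - 1) / (real p)\<^sup>2 * (root_count P (\<Prod>A) * real (totient (\<Prod>A)) / (real (\<Prod>A))\<^sup>2)"
    using root_count_mult[OF cop pos, of P] totient_mult_coprime[OF cop] tp
    by (simp add: power_mult_distrib)
  also have "\<dots> = (\<Prod>p\<in>insert p A. root_count P p * (real p - 1) / (real p)\<^sup>2)"
    using insert by simp
  finally show ?case .
qed simp

context polynomial_family
begin

text \<open>The weight of placing the prime \<open>p\<close> into the component \<open>i\<close> of a tuple; the index 0 stands for leaving \<open>p\<close> out.\<close>
definition root_weight :: "nat \<Rightarrow> nat \<Rightarrow> real" where
  "root_weight p i = (if i = 0 then 1 else root_count (Q i) p * (real p - 1) / (real p)\<^sup>2)"

lemma root_weight_nonneg: "prime p \<Longrightarrow> 0 \<le> root_weight p i"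
  using prime_ge_1_nat[of p] by (simp add: root_weight_def)

lemma root_weight_le: "prime p \<Longrightarrow> i \<noteq> 0 \<Longrightarrow> root_weight p i \<le> root_count (Q i) p / real p"
proof -
  assume p: "prime p" "i \<noteq> 0"
  have "root_count (Q i) p * (real p - 1) / (real p)\<^sup>2 \<le> root_count (Q i) p * real p / (real p)\<^sup>2"
    by (intro divide_right_mono mult_left_mono) auto
  then show ?thesis using p by (simp add: root_weight_def power2_eq_square)
qed

text \<open>Each factor is \<open>1 + v\<close> with \<open>v = s p - s p / p\<close>, and
  \<open>1 + v \<ge> exp (v - v\<^sup>2)\<close>; the deviation from \<open>exp (s p)\<close> costs
  \<open>(g + g\<^sup>2) / p\<^sup>2\<close>, which is summable. The Mertens bounds from below give
  \<open>(ln t) ^ r exp (- M)\<close>. The missing primes dividing \<open>N\<close> cost at most the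
  sum of \<open>g / p\<close>, which the \<open>g\<close>-th power of the totient quotient covers,
  since \<open>1 - 1 / p \<le> exp (- 1 / p)\<close>.\<close>

lemma prod_sum_root_weight_ge:
  assumes "t \<ge> 2" "N \<noteq> 0"
    and M: "\<And>j. j \<in> {1..r} \<Longrightarrow> mertens_bound (Q j) (M j)"
  shows "exp (- 2 * (real g + real g ^ 2)) * ln t ^ r * exp (- (\<Sum>j\<in>{1..r}. M j))
      * (real (totient (nat \<bar>N\<bar>)) / real_of_int \<bar>N\<bar>) ^ g
    \<le> (\<Prod>p | prime p \<and> real p \<le> t \<and> \<not> int p dvd N. \<Sum>i\<in>{0..r}. root_weight p i)"
proof -
  define S where "S = {p. prime p \<and> real p \<le> t \<and> \<not> int p dvd N}"
  define B where "B = {p. prime p \<and> real p \<le> t \<and> int p dvd N}"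
  define s where "s p = (\<Sum>j\<in>{1..r}. root_count (Q j) p) / real p" for p
  have fin: "finite S" "finite B" unfolding S_def B_def by (rule finite_primes_upto)+
  have s0: "0 \<le> s p" for p unfolding s_def by (intro divide_nonneg_nonneg sum_nonneg) auto
  have sg: "s p \<le> real g / real p" if "prime p" for p
    unfolding s_def using sum_root_count_le[OF that] by (intro divide_right_mono) auto
  have N0: "nat \<bar>N\<bar> > 0" using assms(2) by simp
  have BN: "B \<subseteq> prime_factors (nat \<bar>N\<bar>)"
    using N0 by (auto simp: B_def in_prime_factors_iff int_dvd_int_iff[symmetric])
  have split: "(\<Sum>p | prime p \<and> real p \<le> t. s p) = (\<Sum>p\<in>S. s p) + (\<Sum>p\<in>B. s p)"
  proof -
    have "{p. prime p \<and> real p \<le> t} = S \<union> B" "S \<inter> B = {}" unfolding S_def B_def by auto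
    then show ?thesis using fin by (simp add: sum.union_disjoint)
  qed
  have le: "real r * ln (ln t) - (\<Sum>j\<in>{1..r}. M j) \<le> (\<Sum>p\<in>S. s p) + (\<Sum>p\<in>B. s p)"
    unfolding split[symmetric] unfolding s_def by (rule sum_mertens_le(2)[OF M assms(1)])
  have "(real (totient (nat \<bar>N\<bar>)) / real_of_int \<bar>N\<bar>) = (\<Prod>p\<in>prime_factors (nat \<bar>N\<bar>). 1 - 1 / real p)"
    using N0 totient_formula2[of "nat \<bar>N\<bar>"] by (simp add: field_simps)
  also have "\<dots> \<le> (\<Prod>p\<in>B. 1 - 1 / real p)"
  proof -
    have f: "0 \<le> 1 - 1 / real p" "1 - 1 / real p \<le> 1" if "p \<in> prime_factors (nat \<bar>N\<bar>)" for p
      using prime_ge_1_nat[of p] that by (auto simp: in_prime_factors_iff divide_le_eq_1)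
    have "(\<Prod>p\<in>prime_factors (nat \<bar>N\<bar>). 1 - 1 / real p) =
        (\<Prod>p\<in>prime_factors (nat \<bar>N\<bar>) - B. 1 - 1 / real p) * (\<Prod>p\<in>B. 1 - 1 / real p)"
      using BN by (intro prod.subset_diff) auto
    also have "\<dots> \<le> 1 * (\<Prod>p\<in>B. 1 - 1 / real p)"
      using f BN by (intro mult_right_mono prod_le_1 prod_nonneg) auto
    finally show ?thesis by simp
  qed
  also have "\<dots> \<le> (\<Prod>p\<in>B. exp (- (1 / real p)))"
  proof (intro prod_mono conjI)
    fix p assume "p \<in> B"
    then have "prime p" by (simp add: B_def)
    then have "1 \<le> p" by (rule prime_ge_1_nat)
    then show "0 \<le> 1 - 1 / real p" by (simp add: divide_le_eq_1)
    show "1 - 1 / real p \<le> exp (- (1 / real p))" using exp_ge_add_one_self[of "- (1 / real p)"] by simp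
  qed
  also have "\<dots> = exp (\<Sum>p\<in>B. - (1 / real p))" by (rule exp_sum[OF fin(2), symmetric])
  finally have tot: "real (totient (nat \<bar>N\<bar>)) / real_of_int \<bar>N\<bar> \<le> exp (\<Sum>p\<in>B. - (1 / real p))" .
  have "(real (totient (nat \<bar>N\<bar>)) / real_of_int \<bar>N\<bar>) ^ g \<le> exp (\<Sum>p\<in>B. - (1 / real p)) ^ g"
    using tot by (intro power_mono) auto
  also have "\<dots> = exp (\<Sum>p\<in>B. - (real g / real p))"
    by (simp add: exp_of_nat_mult[symmetric] sum_distrib_left sum_negf)
  also have "\<dots> \<le> exp (\<Sum>p\<in>B. - s p)"
    using sg by (auto intro!: sum_mono simp: B_def)
  finally have tot': "(real (totient (nat \<bar>N\<bar>)) / real_of_int \<bar>N\<bar>) ^ g \<le> exp (\<Sum>p\<in>B. - s p)" .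
  have lnt: "ln t > 0" using assms(1) by simp
  have "(\<Sum>p\<in>S. 1 / real p ^ 2) \<le> 2" by (rule sum_inverse_squares_primes_le[of S t]) (auto simp: S_def)
  then have sq: "(\<Sum>p\<in>S. (real g + real g ^ 2) * (1 / real p ^ 2)) \<le> (real g + real g ^ 2) * 2"
    unfolding sum_distrib_left[symmetric] by (intro mult_left_mono) auto
  have "exp (- 2 * (real g + real g ^ 2)) * ln t ^ r * exp (- (\<Sum>j\<in>{1..r}. M j))
      * (real (totient (nat \<bar>N\<bar>)) / real_of_int \<bar>N\<bar>) ^ g
    \<le> exp (- 2 * (real g + real g ^ 2)) * ln t ^ r * exp (- (\<Sum>j\<in>{1..r}. M j)) * exp (\<Sum>p\<in>B. - s p)"
    using tot' lnt by (intro mult_left_mono) auto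
  also have "\<dots> = exp (- 2 * (real g + real g ^ 2) + real r * ln (ln t) - (\<Sum>j\<in>{1..r}. M j) - (\<Sum>p\<in>B. s p))"
  proof -
    have "ln t ^ r = exp (real r * ln (ln t))" using lnt by (simp add: exp_of_nat_mult)
    then show ?thesis by (simp only: exp_add[symmetric] sum_negf) (simp add: algebra_simps)
  qed
  also have "\<dots> \<le> exp (\<Sum>p\<in>S. s p - (real g + real g ^ 2) * (1 / real p ^ 2))"
    using le sq unfolding sum_subtractf by simp
  also have "\<dots> = (\<Prod>p\<in>S. exp (s p - (real g + real g ^ 2) * (1 / real p ^ 2)))" by (rule exp_sum[OF fin(1)])
  also have "\<dots> \<le> (\<Prod>p\<in>S. \<Sum>i\<in>{0..r}. root_weight p i)"
  proof (intro prod_mono conjI)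
    fix p assume "p \<in> S"
    then have p: "prime p" by (simp add: S_def)
    have p0: "real p > 0" using p by (simp add: prime_gt_0_nat)
    define v where "v = (\<Sum>i\<in>{1..r}. root_weight p i)"
    have "{0..r} = insert 0 {1..r}" by auto
    then have T: "(\<Sum>i\<in>{0..r}. root_weight p i) = 1 + v"
      unfolding v_def by (simp add: root_weight_def)
    have v0: "0 \<le> v" unfolding v_def using root_weight_nonneg[OF p] by (intro sum_nonneg)
    have "v = (\<Sum>i\<in>{1..r}. root_count (Q i) p * ((real p - 1) / (real p)\<^sup>2))"
      unfolding v_def by (intro sum.cong refl) (auto simp: root_weight_def)
    also have "\<dots> = s p * (1 - 1 / real p)"
      unfolding sum_distrib_right[symmetric] s_def using p0 by (simp add: field_simps power2_eq_square)
    finally have v: "v = s p - s p / real p" by (simp add: right_diff_distrib)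
    have vs: "v \<le> s p" using v s0[of p] p0 by simp
    have "s p / real p \<le> real g / real p / real p" using sg[OF p] p0 by (intro divide_right_mono) auto
    then have 1: "s p - real g * (1 / real p ^ 2) \<le> v" using v by (simp add: power2_eq_square)
    have "v\<^sup>2 \<le> (real g / real p)\<^sup>2" using v0 vs sg[OF p] by (intro power_mono) auto
    then have 2: "v\<^sup>2 \<le> real g ^ 2 * (1 / real p ^ 2)" by (simp add: power_divide)
    \<comment> \<open>For \<open>v > 1\<close> the left side is negative and the right side is
      nonnegative.\<close>
    have 3: "v - v\<^sup>2 \<le> ln (1 + v)"
    proof (cases "v \<le> 1")
      case True
      then show ?thesis using v0 by (intro ln_one_plus_pos_lower_bound)
    next
      case False
      then have "v * 1 \<le> v * v" by (intro mult_left_mono) auto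
      moreover have "0 \<le> ln (1 + v)" using v0 by (intro ln_ge_zero) simp
      ultimately show ?thesis by (simp add: power2_eq_square)
    qed
    have "s p - (real g + real g ^ 2) * (1 / real p ^ 2) \<le> ln (1 + v)"
      using 1 2 3 unfolding distrib_right by linarith
    moreover have "0 < 1 + v" using v0 by simp
    ultimately show "exp (s p - (real g + real g ^ 2) * (1 / real p ^ 2)) \<le> (\<Sum>i\<in>{0..r}. root_weight p i)"
      unfolding T using ln_ge_iff by blast
  qed simp
  finally show ?thesis unfolding S_def .
qed

end

lemma sqrt_prod: "sqrt (\<Prod>i\<in>A. f i) = (\<Prod>i\<in>A. sqrt (f i))"
  by (induction A rule: infinite_finite_induct) (auto simp: real_sqrt_mult)

context polynomial_family
begin

text \<open>Expanding the product writes the total mass as a sum over all assignments of the primes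
  to the classes \<open>0, ..., r\<close>. There are \<open>2 r\<close> bad events, one of Chebyshev
  and one of Markov type for each \<open>j\<close>, each of probability at most
  \<open>1 / (4 r)\<close>, so half of the mass survives and is shared by the value vectors in a
  box.\<close>

lemma ex_tuple_sum_omega_ge:
  fixes t Z x :: real and y :: "nat \<Rightarrow> real"
  assumes t: "2 \<le> t" "t \<le> x" and Z: "16 * real r * real g * (ln t + 1) \<le> ln Z" "Z > 1"
  defines "E \<equiv> \<lambda>j. E_fun (omega_upto (y j)) x (root_count (Q j))"
  shows "\<exists>k :: nat \<Rightarrow> nat. (\<Prod>p | prime p \<and> real p \<le> t \<and> \<not> int p dvd N. \<Sum>i\<in>{0..r}. root_weight p i)
      / (2 * (4 * sqrt (real r) + 1) ^ r * sqrt (\<Prod>j\<in>{1..r}. E j))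
    \<le> tuple_sum r Q N (\<lambda>j. omega_upto (y j)) Z (\<lambda>j. real (k j))"
proof -
  define S where "S = {p. prime p \<and> real p \<le> t \<and> \<not> int p dvd N}"
  define I where "I = {0..r}"
  define T where "T p = (\<Sum>i\<in>I. root_weight p i)" for p
  define h where "h p i = root_weight p i / T p" for p i
  have finS: "finite S" unfolding S_def by (rule finite_primes_upto)
  have finI: "finite I" by (simp add: I_def)
  have S: "prime p" "real p \<le> t" "\<not> int p dvd N" if "p \<in> S" for p using that by (auto simp: S_def)
  have T1: "1 \<le> T p" if "p \<in> S" for p
  proof -
    have "root_weight p 0 \<le> T p" unfolding T_def
      using root_weight_nonneg[OF S(1)[OF that]] finI by (intro member_le_sum) (auto simp: I_def)
    then show ?thesis by (simp add: root_weight_def)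
  qed
  have h0: "0 \<le> h p i" if "p \<in> S" for p i
    unfolding h_def using root_weight_nonneg[OF S(1)[OF that]] T1[OF that] by simp
  have h_sum: "(\<Sum>i\<in>I. h p i) = 1" if "p \<in> S" for p
    unfolding h_def sum_divide_distrib[symmetric] T_def[symmetric] using T1[OF that] by simp
  have h_le: "h p j \<le> root_count (Q j) p / real p" if "p \<in> S" "j \<in> {1..r}" for p j
  proof -
    have "h p j \<le> root_weight p j / 1" unfolding h_def
      using T1[OF that(1)] root_weight_nonneg[OF S(1)[OF that(1)]] by (intro divide_left_mono) auto
    then show ?thesis using root_weight_le[OF S(1)[OF that(1)], of j] that(2) by simp
  qed
  have r1: "r \<ge> 1"
  proof (rule ccontr)
    assume "\<not> 1 \<le> r"
    then have "{1..r} = {}" by simp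
    then have "Qprod = 1" by (simp only: prod.empty)
    then show False using degree_pos by simp
  qed
  define \<Omega> where "\<Omega> = PiE S (\<lambda>_. I)"
  have fin\<Omega>: "finite \<Omega>" unfolding \<Omega>_def using finS finI by (intro finite_PiE) auto
  define w where "w \<sigma> = (\<Prod>p\<in>S. h p (\<sigma> p))" for \<sigma>
  have w0: "0 \<le> w \<sigma>" for \<sigma> unfolding w_def using h0 by (intro prod_nonneg) auto
  have w1: "(\<Sum>\<sigma>\<in>\<Omega>. w \<sigma>) = 1"
    unfolding w_def \<Omega>_def by (rule sum_PiE_weights[OF finS finI h_sum])
  define A where "A \<sigma> j = {p \<in> S. \<sigma> p = j}" for \<sigma> :: "nat \<Rightarrow> nat" and j
  have finA: "finite (A \<sigma> j)" and Apr: "\<And>p. p \<in> A \<sigma> j \<Longrightarrow> prime p" for \<sigma> j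
    using finS S(1) by (auto simp: A_def)
  have A_pf: "prime_factors (\<Prod>(A \<sigma> j)) = A \<sigma> j" and A_pos: "\<Prod>(A \<sigma> j) > 0" for \<sigma> j
    by (rule prime_factors_prod_primes, rule finA, erule Apr)+
  define a where "a \<sigma> = (\<lambda>j\<in>{1..r}. \<Prod>(A \<sigma> j))" for \<sigma>
  define X where "X \<sigma> j = card {p \<in> S. \<sigma> p = j \<and> real p \<le> y j}" for \<sigma> :: "nat \<Rightarrow> nat" and j
  have a_eq: "a \<sigma> j = \<Prod>(A \<sigma> j)" if "j \<in> {1..r}" for \<sigma> j using that by (simp only: a_def restrict_apply if_True)
  have a_omega: "omega_upto (y j) (a \<sigma> j) = real (X \<sigma> j)" if "j \<in> {1..r}" for \<sigma> j
  proof -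
    have "prime_factors (a \<sigma> j) = A \<sigma> j"
      unfolding a_eq[OF that] by (rule A_pf)
    moreover have "{p \<in> A \<sigma> j. real p \<le> y j} = {p \<in> S. \<sigma> p = j \<and> real p \<le> y j}" by (auto simp: A_def)
    ultimately show ?thesis by (simp only: omega_upto_def X_def)
  qed
  define \<mu> where "\<mu> j = (\<Sum>p\<in>S. if real p \<le> y j then h p j else 0)" for j
  \<comment> \<open>The centred indicator of the event that \<open>p \<le> y j\<close> is placed
    into class \<open>j\<close>.\<close>
  define c where "c j p i = (if real p \<le> y j then (if i = j then 1 else 0) - h p j else 0)" for j p i
  have E1: "1 \<le> E j" for j
    unfolding E_def E_fun_def by (auto intro!: sum_nonneg divide_nonneg_nonneg)
  \<comment> \<open>The radius at which Chebyshev's inequality with variance at most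
    \<open>E j\<close> leaves probability \<open>1 / (4 r)\<close>.\<close>
  define R where "R j = sqrt (4 * real r * E j)" for j
  have R: "R j > 0" "(R j)\<^sup>2 = 4 * real r * E j" for j
    using r1 E1[of j] by (auto simp: R_def intro!: mult_pos_pos)
  have Xc: "real (X \<sigma> j) - \<mu> j = (\<Sum>p\<in>S. c j p (\<sigma> p))" for \<sigma> j
  proof -
    have "real (X \<sigma> j) = (\<Sum>p\<in>S. if \<sigma> p = j \<and> real p \<le> y j then 1 else 0)"
      unfolding X_def using finS by (simp add: sum.If_cases Int_def)
    moreover have "(\<Sum>p\<in>S. c j p (\<sigma> p)) = (\<Sum>p\<in>S. (if \<sigma> p = j \<and> real p \<le> y j then 1 else 0)
        - (if real p \<le> y j then h p j else 0))"
      by (intro sum.cong refl) (simp add: c_def)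
    ultimately show ?thesis by (simp only: \<mu>_def sum_subtractf)
  qed
  have var: "(\<Sum>\<sigma>\<in>\<Omega>. w \<sigma> * (real (X \<sigma> j) - \<mu> j)\<^sup>2) \<le> E j" if j: "j \<in> {1..r}" for j
  proof -
    have jI: "j \<in> I" using j by (simp add: I_def)
    have cent: "(\<Sum>i\<in>I. h p i * c j p i) = 0" if p: "p \<in> S" for p
    proof -
      have "(\<Sum>i\<in>I. h p i * ((if i = j then 1 else 0) - h p j)) = (\<Sum>i\<in>I. h p i * (if i = j then 1 else 0)) - (\<Sum>i\<in>I. h p i) * h p j"
        by (simp add: right_diff_distrib sum_subtractf sum_distrib_right)
      also have "(\<Sum>i\<in>I. h p i * (if i = j then 1 else 0)) = h p j"
        using finI jI by (simp add: if_distrib[of "\<lambda>x. _ * x"] cong: if_cong)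
      finally show ?thesis using h_sum[OF p] by (cases "real p \<le> y j") (simp_all add: c_def)
    qed
    \<comment> \<open>The variance of a Bernoulli variable, \<open>h p j * (1 - h p j)\<close>, is
      at most its mean.\<close>
    have sec: "(\<Sum>i\<in>I. h p i * (c j p i)\<^sup>2) \<le> (if real p \<le> y j then root_count (Q j) p / real p else 0)" if p: "p \<in> S" for p
    proof (cases "real p \<le> y j")
      case True
      have "(\<Sum>i\<in>I. h p i * (c j p i)\<^sup>2) = (\<Sum>i\<in>I. h p i * c j p i * (if i = j then 1 else 0)) - (\<Sum>i\<in>I. h p i * c j p i) * h p j"
        unfolding sum_distrib_right sum_subtractf[symmetric]
        by (intro sum.cong refl) (simp add: c_def True power2_eq_square algebra_simps)
      also have "\<dots> = h p j * c j p j"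
        unfolding cent[OF p] using finI jI by (simp add: if_distrib[of "\<lambda>x. _ * x"] cong: if_cong)
      also have "\<dots> \<le> h p j * 1"
        using h0[OF p] True by (intro mult_left_mono) (auto simp: c_def)
      also have "\<dots> \<le> root_count (Q j) p / real p" using h_le[OF p j] by simp
      finally show ?thesis using True by simp
    qed (simp add: c_def)
    have "(\<Sum>\<sigma>\<in>\<Omega>. w \<sigma> * (real (X \<sigma> j) - \<mu> j)\<^sup>2) = (\<Sum>p\<in>S. \<Sum>i\<in>I. h p i * (c j p i)\<^sup>2)"
      unfolding Xc w_def \<Omega>_def by (rule sum_PiE_second_moment[OF finS finI h_sum cent])
    also have "\<dots> \<le> (\<Sum>p\<in>S. if real p \<le> y j then root_count (Q j) p / real p else 0)" by (intro sum_mono sec)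
    also have "\<dots> = (\<Sum>p\<in>{p \<in> S. real p \<le> y j}. root_count (Q j) p / real p)"
      using finS by (simp add: sum.inter_filter)
    also have "\<dots> \<le> (\<Sum>p | prime p \<and> real p \<le> x \<and> omega_upto (y j) p \<noteq> 0. root_count (Q j) p / real p)"
    proof (rule sum_mono2)
      show "finite {p. prime p \<and> real p \<le> x \<and> omega_upto (y j) p \<noteq> 0}" by (rule finite_primes_upto)
      show "{p \<in> S. real p \<le> y j} \<subseteq> {p. prime p \<and> real p \<le> x \<and> omega_upto (y j) p \<noteq> 0}"
      proof clarify
        fix p assume p: "p \<in> S" "real p \<le> y j"
        have "{q \<in> prime_factors p. real q \<le> y j} = {p}" using p S(1)[OF p(1)] by (auto simp: prime_prime_factors)
        then show "prime p \<and> real p \<le> x \<and> omega_upto (y j) p \<noteq> 0"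
          using S(1,2)[OF p(1)] t(2) by (simp add: omega_upto_def)
      qed
    qed auto
    also have "\<dots> \<le> E j" by (simp add: E_def E_fun_def)
    finally show ?thesis .
  qed
  define Bad1 where "Bad1 j = {\<sigma> \<in> \<Omega>. \<not> \<bar>real (X \<sigma> j) - \<mu> j\<bar> \<le> R j}" for j
  define Bad2 where "Bad2 j = {\<sigma> \<in> \<Omega>. \<not> real (a \<sigma> j) \<le> Z}" for j
  have bad1: "(\<Sum>\<sigma>\<in>Bad1 j. w \<sigma>) \<le> 1 / (4 * real r)" if j: "j \<in> {1..r}" for j
  proof -
    have "(R j)\<^sup>2 * (\<Sum>\<sigma>\<in>Bad1 j. w \<sigma>) = (\<Sum>\<sigma>\<in>Bad1 j. w \<sigma> * (R j)\<^sup>2)"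
      by (subst sum_distrib_left) (simp only: mult.commute)
    also have "\<dots> \<le> (\<Sum>\<sigma>\<in>Bad1 j. w \<sigma> * (real (X \<sigma> j) - \<mu> j)\<^sup>2)"
    proof (intro sum_mono mult_left_mono w0)
      fix \<sigma> assume "\<sigma> \<in> Bad1 j"
      then have "R j \<le> \<bar>real (X \<sigma> j) - \<mu> j\<bar>" by (auto simp: Bad1_def)
      then have "(R j)\<^sup>2 \<le> \<bar>real (X \<sigma> j) - \<mu> j\<bar>\<^sup>2" using R(1)[of j] by (intro power_mono) auto
      then show "(R j)\<^sup>2 \<le> (real (X \<sigma> j) - \<mu> j)\<^sup>2" by simp
    qed
    also have "\<dots> \<le> (\<Sum>\<sigma>\<in>\<Omega>. w \<sigma> * (real (X \<sigma> j) - \<mu> j)\<^sup>2)"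
      using fin\<Omega> w0 by (intro sum_mono2) (auto simp: Bad1_def)
    also have "\<dots> \<le> E j" by (rule var[OF j])
    finally have "4 * real r * E j * (\<Sum>\<sigma>\<in>Bad1 j. w \<sigma>) \<le> E j" by (simp only: R(2))
    then have "E j * (4 * real r * (\<Sum>\<sigma>\<in>Bad1 j. w \<sigma>)) \<le> E j * 1" by (simp add: mult_ac)
    then have "4 * real r * (\<Sum>\<sigma>\<in>Bad1 j. w \<sigma>) \<le> 1" using E1[of j] by simp
    then show ?thesis using r1 by (simp add: field_simps)
  qed
  \<comment> \<open>Markov's inequality for \<open>ln (a_j)\<close>, whose mean is at most
    \<open>4 g (ln t + 1)\<close>; the hypothesis relating \<open>t\<close> and \<open>Z\<close> is
    exactly what makes the probability \<open>1 / (4 r)\<close>.\<close>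
  have bad2: "(\<Sum>\<sigma>\<in>Bad2 j. w \<sigma>) \<le> 1 / (4 * real r)" if j: "j \<in> {1..r}" for j
  proof -
    define d where "d p i = (if i = j then ln (real p) else 0)" for p i :: nat
    have lna: "ln (real (a \<sigma> j)) = (\<Sum>p\<in>S. d p (\<sigma> p))" for \<sigma>
    proof -
      have "ln (real (a \<sigma> j)) = ln (\<Prod>p\<in>A \<sigma> j. real p)" unfolding a_eq[OF j] by simp
      also have "\<dots> = (\<Sum>p\<in>A \<sigma> j. ln (real p))"
        using finA Apr[of _ \<sigma> j] by (intro ln_prod) (auto simp: prime_gt_0_nat)
      also have "\<dots> = (\<Sum>p\<in>S. d p (\<sigma> p))"
        unfolding A_def d_def using finS by (simp add: sum.inter_filter)
      finally show ?thesis .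
    qed
    have apos: "real (a \<sigma> j) > 0" for \<sigma> unfolding a_eq[OF j] using A_pos by (simp only: of_nat_0_less_iff)
    have lna0: "0 \<le> ln (real (a \<sigma> j))" for \<sigma>
    proof -
      have "real (a \<sigma> j) \<ge> 1" using apos[of \<sigma>] by simp
      then show ?thesis by (rule ln_ge_zero)
    qed
    have lnZ: "0 < ln Z" using Z(2) by simp
    have "ln Z * (\<Sum>\<sigma>\<in>Bad2 j. w \<sigma>) = (\<Sum>\<sigma>\<in>Bad2 j. w \<sigma> * ln Z)"
      by (subst sum_distrib_left) (simp only: mult.commute)
    also have "\<dots> \<le> (\<Sum>\<sigma>\<in>Bad2 j. w \<sigma> * ln (real (a \<sigma> j)))"
      using Z(2) apos by (intro sum_mono mult_left_mono w0) (auto simp: Bad2_def)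
    also have "\<dots> \<le> (\<Sum>\<sigma>\<in>\<Omega>. w \<sigma> * ln (real (a \<sigma> j)))"
      using fin\<Omega> w0 lna0 by (intro sum_mono2) (auto simp: Bad2_def)
    also have "\<dots> = (\<Sum>p\<in>S. \<Sum>i\<in>I. h p i * d p i)"
      unfolding lna w_def \<Omega>_def by (rule sum_PiE_first_moment[OF finS finI h_sum])
    also have "\<dots> = (\<Sum>p\<in>S. h p j * ln (real p))"
      using finI j by (intro sum.cong refl) (simp add: d_def I_def if_distrib[of "\<lambda>x. _ * x"] cong: if_cong)
    also have "\<dots> \<le> (\<Sum>p\<in>S. real g * (ln (real p) / real p))"
    proof (rule sum_mono)
      fix p assume p: "p \<in> S"
      have "1 \<le> p" using S(1)[OF p] by (rule prime_ge_1_nat)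
      then have lnp: "0 \<le> ln (real p)" by (intro ln_ge_zero) simp
      have "root_count (Q j) p \<le> (\<Sum>j\<in>{1..r}. root_count (Q j) p)" using j by (intro member_le_sum) auto
      then have "root_count (Q j) p \<le> real g" using sum_root_count_le[OF S(1)[OF p]] by linarith
      then have "root_count (Q j) p / real p \<le> real g / real p" by (intro divide_right_mono) auto
      then have "h p j \<le> real g / real p" using h_le[OF p j] by linarith
      then have "h p j * ln (real p) \<le> real g / real p * ln (real p)" using lnp by (rule mult_right_mono)
      then show "h p j * ln (real p) \<le> real g * (ln (real p) / real p)" by simp
    qed
    also have "\<dots> = real g * (\<Sum>p\<in>S. ln (real p) / real p)" by (rule sum_distrib_left[symmetric])
    also have "\<dots> \<le> real g * (\<Sum>p | prime p \<and> real p \<le> t. ln (real p) / real p)"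
    proof (intro mult_left_mono sum_mono2)
      show "finite {p. prime p \<and> real p \<le> t}" using finite_primes_upto[of t "\<lambda>_. True"] by simp
      fix p assume "p \<in> {p. prime p \<and> real p \<le> t} - S"
      then have "prime p" by blast
      then have "1 \<le> p" by (rule prime_ge_1_nat)
      then have "1 \<le> real p" by simp
      then show "0 \<le> ln (real p) / real p" by (intro divide_nonneg_nonneg ln_ge_zero) auto
    qed (auto simp: S_def)
    also have "\<dots> \<le> real g * (4 * (ln t + 1))" using t by (intro mult_left_mono sum_ln_primes_le) auto
    finally have 1: "ln Z * (\<Sum>\<sigma>\<in>Bad2 j. w \<sigma>) \<le> real g * (4 * (ln t + 1))" .
    have "ln Z * (4 * real r * (\<Sum>\<sigma>\<in>Bad2 j. w \<sigma>)) = 4 * real r * (ln Z * (\<Sum>\<sigma>\<in>Bad2 j. w \<sigma>))" by simp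
    also have "\<dots> \<le> 4 * real r * (real g * (4 * (ln t + 1)))" using 1 by (intro mult_left_mono) auto
    also have "\<dots> = 16 * real r * real g * (ln t + 1)" by simp
    also have "\<dots> \<le> ln Z * 1" using Z(1) by simp
    finally have "4 * real r * (\<Sum>\<sigma>\<in>Bad2 j. w \<sigma>) \<le> 1" using lnZ by simp
    then show ?thesis using r1 by (simp add: field_simps)
  qed
  define Gd where "Gd = {\<sigma> \<in> \<Omega>. \<forall>j\<in>{1..r}. \<bar>real (X \<sigma> j) - \<mu> j\<bar> \<le> R j \<and> real (a \<sigma> j) \<le> Z}"
  have finGd: "finite Gd" unfolding Gd_def using fin\<Omega> by simp
  have half: "1/2 \<le> (\<Sum>\<sigma>\<in>Gd. w \<sigma>)"
  proof -
    have "(\<Sum>\<sigma>\<in>\<Omega> - Gd. w \<sigma>) \<le> (\<Sum>j\<in>{1..r}. (\<Sum>\<sigma>\<in>Bad1 j \<union> Bad2 j. w \<sigma>))"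
    proof (rule sum_le_sum_UNION)
      show "\<Omega> - Gd \<subseteq> (\<Union>j\<in>{1..r}. Bad1 j \<union> Bad2 j)" unfolding Gd_def Bad1_def Bad2_def by blast
    qed (use fin\<Omega> w0 in \<open>auto simp: Bad1_def Bad2_def\<close>)
    also have "\<dots> \<le> (\<Sum>j\<in>{1..r}. 1 / (2 * real r))"
    proof (rule sum_mono)
      fix j assume j: "j \<in> {1..r}"
      have "finite (Bad1 j)" "finite (Bad2 j)" using fin\<Omega> by (auto simp: Bad1_def Bad2_def)
      then have "(\<Sum>\<sigma>\<in>Bad1 j \<union> Bad2 j. w \<sigma>) = (\<Sum>\<sigma>\<in>Bad1 j. w \<sigma>) + (\<Sum>\<sigma>\<in>Bad2 j. w \<sigma>) - (\<Sum>\<sigma>\<in>Bad1 j \<inter> Bad2 j. w \<sigma>)"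
        by (rule sum_Un)
      also have "\<dots> \<le> 1 / (4 * real r) + 1 / (4 * real r)"
      proof -
        have "0 \<le> (\<Sum>\<sigma>\<in>Bad1 j \<inter> Bad2 j. w \<sigma>)" using w0 by (intro sum_nonneg)
        then show ?thesis using bad1[OF j] bad2[OF j] by linarith
      qed
      also have "\<dots> = 1 / (2 * real r)" by simp
      finally show "(\<Sum>\<sigma>\<in>Bad1 j \<union> Bad2 j. w \<sigma>) \<le> 1 / (2 * real r)" .
    qed
    also have "\<dots> = 1/2" using r1 by simp
    finally have "(\<Sum>\<sigma>\<in>\<Omega> - Gd. w \<sigma>) \<le> 1/2" .
    moreover have "(\<Sum>\<sigma>\<in>\<Omega>. w \<sigma>) = (\<Sum>\<sigma>\<in>\<Omega> - Gd. w \<sigma>) + (\<Sum>\<sigma>\<in>Gd. w \<sigma>)"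
      using fin\<Omega> by (intro sum.subset_diff) (auto simp: Gd_def)
    ultimately show ?thesis using w1 by linarith
  qed
  define K where "K = PiE {1..r} (\<lambda>j. {n::nat. \<bar>real n - \<mu> j\<bar> \<le> R j})"
  have finK: "finite K" unfolding K_def using card_nat_ball_le(1) R(1) by (intro finite_PiE) (auto intro: less_imp_le)
  define D where "D = (4 * sqrt (real r) + 1) ^ r * sqrt (\<Prod>j\<in>{1..r}. E j)"
  have cardK: "real (card K) \<le> D"
  proof -
    have "real (card K) = (\<Prod>j\<in>{1..r}. real (card {n::nat. \<bar>real n - \<mu> j\<bar> \<le> R j}))"
      unfolding K_def by (simp add: card_PiE)
    also have "\<dots> \<le> (\<Prod>j\<in>{1..r}. (4 * sqrt (real r) + 1) * sqrt (E j))"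
    proof (intro prod_mono conjI)
      fix j
      have "real (card {n::nat. \<bar>real n - \<mu> j\<bar> \<le> R j}) \<le> 2 * R j + 1"
        using R(1)[of j] by (intro card_nat_ball_le) auto
      also have "\<dots> = 4 * sqrt (real r) * sqrt (E j) + 1" by (simp add: R_def real_sqrt_mult)
      \<comment> \<open>The summand 1 in the definition of \<open>E j\<close> allows
        \<open>1 \<le> sqrt (E j)\<close>.\<close>
      also have "\<dots> \<le> 4 * sqrt (real r) * sqrt (E j) + sqrt (E j)" using E1[of j] by simp
      finally show "real (card {n::nat. \<bar>real n - \<mu> j\<bar> \<le> R j}) \<le> (4 * sqrt (real r) + 1) * sqrt (E j)"
        by (simp add: distrib_right)
    qed simp
    also have "\<dots> = D" unfolding D_def by (simp add: prod.distrib sqrt_prod)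
    finally show ?thesis .
  qed
  define \<kappa> where "\<kappa> \<sigma> = (\<lambda>j\<in>{1..r}. X \<sigma> j)" for \<sigma>
  have \<kappa>K: "\<kappa> ` Gd \<subseteq> K" unfolding K_def \<kappa>_def Gd_def by auto
  have D0: "D > 0"
  proof -
    have "0 < E j" for j using E1[of j] by linarith
    then have "0 < (\<Prod>j\<in>{1..r}. E j)" by (intro prod_pos) simp
    then show ?thesis unfolding D_def by (intro mult_pos_pos zero_less_power) (auto intro: add_nonneg_pos)
  qed
  \<comment> \<open>Averaging: mass at least \<open>1/2\<close> is spread over at most
    \<open>D\<close> value vectors, so one of them carries at least
    \<open>1 / (2 D)\<close>.\<close>
  obtain k where k: "k \<in> K" "1 / (2 * D) \<le> (\<Sum>\<sigma>\<in>{\<sigma> \<in> Gd. \<kappa> \<sigma> = k}. w \<sigma>)"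
  proof (rule ccontr)
    assume "\<not> thesis"
    then have lt: "(\<Sum>\<sigma>\<in>{\<sigma> \<in> Gd. \<kappa> \<sigma> = k}. w \<sigma>) < 1 / (2 * D)" if "k \<in> K" for k
      using that \<open>\<And>k. k \<in> K \<Longrightarrow> 1 / (2 * D) \<le> sum w {\<sigma> \<in> Gd. \<kappa> \<sigma> = k} \<Longrightarrow> thesis\<close> by force
    have "Gd \<noteq> {}" using half by auto
    then have "K \<noteq> {}" using \<kappa>K by blast
    have "(\<Sum>\<sigma>\<in>Gd. w \<sigma>) = (\<Sum>k\<in>K. \<Sum>\<sigma>\<in>{\<sigma> \<in> Gd. \<kappa> \<sigma> = k}. w \<sigma>)"
      by (rule sum.group[OF finGd finK \<kappa>K, symmetric])
    also have "\<dots> < (\<Sum>k\<in>K. 1 / (2 * D))" using finK \<open>K \<noteq> {}\<close> lt by (intro sum_strict_mono) auto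
    also have "\<dots> = real (card K) * (1 / (2 * D))" by simp
    also have "\<dots> \<le> D * (1 / (2 * D))" using cardK D0 by (intro mult_right_mono) auto
    also have "\<dots> = 1/2" using D0 by simp
    finally show False using half by linarith
  qed
  define G where "G = {\<sigma> \<in> Gd. \<kappa> \<sigma> = k}"
  define \<tau> where "\<tau> b = (\<Prod>j\<in>{1..r}. root_count (Q j) (b j) * real (totient (b j)) / (real (b j))\<^sup>2)" for b
  have G\<Omega>: "\<sigma> \<in> \<Omega>" "\<sigma> \<in> Gd" if "\<sigma> \<in> G" for \<sigma> using that by (auto simp: G_def Gd_def)
  \<comment> \<open>Undoing the normalisation: the weight of a tuple is the total mass times the
    probability of its assignment. Class 0 contributes only factors 1.\<close>
  have tau_eq: "\<tau> (a \<sigma>) = (\<Prod>p\<in>S. T p) * w \<sigma>" if "\<sigma> \<in> \<Omega>" for \<sigma>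
  proof -
    have "\<tau> (a \<sigma>) = (\<Prod>j\<in>{1..r}. \<Prod>p\<in>A \<sigma> j. root_weight p j)"
      unfolding \<tau>_def
    proof (rule prod.cong[OF refl])
      fix j assume j: "j \<in> {1..r}"
      show "root_count (Q j) (a \<sigma> j) * real (totient (a \<sigma> j)) / (real (a \<sigma> j))\<^sup>2 = (\<Prod>p\<in>A \<sigma> j. root_weight p j)"
      proof -
        have "root_count (Q j) (\<Prod>(A \<sigma> j)) * real (totient (\<Prod>(A \<sigma> j))) / (real (\<Prod>(A \<sigma> j)))\<^sup>2
            = (\<Prod>p\<in>A \<sigma> j. root_count (Q j) p * (real p - 1) / (real p)\<^sup>2)"
          by (rule root_weight_prod_primes, rule finA, erule Apr)
        also have "\<dots> = (\<Prod>p\<in>A \<sigma> j. root_weight p j)"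
          using j by (intro prod.cong refl) (auto simp: root_weight_def)
        finally show ?thesis unfolding a_eq[OF j] .
      qed
    qed
    also have "\<dots> = (\<Prod>j\<in>I. \<Prod>p\<in>A \<sigma> j. root_weight p (\<sigma> p))"
    proof -
      have "(\<Prod>j\<in>{1..r}. \<Prod>p\<in>A \<sigma> j. root_weight p j) = (\<Prod>j\<in>{1..r}. \<Prod>p\<in>A \<sigma> j. root_weight p (\<sigma> p))"
        by (intro prod.cong refl) (simp add: A_def)
      also have "\<dots> = (\<Prod>j\<in>I. \<Prod>p\<in>A \<sigma> j. root_weight p (\<sigma> p))"
      proof (rule prod.mono_neutral_left[OF finI])
        show "\<forall>j\<in>I - {1..r}. (\<Prod>p\<in>A \<sigma> j. root_weight p (\<sigma> p)) = 1"
          by (auto simp: I_def A_def root_weight_def intro!: prod.neutral)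
      qed (auto simp: I_def)
      finally show ?thesis .
    qed
    also have "\<dots> = (\<Prod>p\<in>S. root_weight p (\<sigma> p))"
      unfolding A_def using that by (intro prod.group[OF finS finI]) (auto simp: \<Omega>_def)
    also have "\<dots> = (\<Prod>p\<in>S. T p * h p (\<sigma> p))"
    proof (rule prod.cong[OF refl])
      fix p assume "p \<in> S"
      then show "root_weight p (\<sigma> p) = T p * h p (\<sigma> p)" using T1[of p] by (simp add: h_def)
    qed
    finally show ?thesis by (simp add: prod.distrib w_def)
  qed
  have dvd_a: "p dvd a \<sigma> j \<longleftrightarrow> p \<in> A \<sigma> j" if "prime p" "j \<in> {1..r}" for p \<sigma> j
  proof -
    have "p dvd a \<sigma> j \<longleftrightarrow> p \<in> prime_factors (\<Prod>(A \<sigma> j))"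
      unfolding a_eq[OF that(2)] using A_pos[of \<sigma> j] that(1)
      by (simp only: in_prime_factors_iff) simp
    then show ?thesis by (simp only: A_pf)
  qed
  \<comment> \<open>The tuple records the class of every prime in \<open>S\<close>: a prime dividing
    no component is in class 0.\<close>
  have inj: "inj_on a G"
  proof (rule inj_onI)
    fix \<sigma> \<sigma>' assume h: "\<sigma> \<in> G" "\<sigma>' \<in> G" "a \<sigma> = a \<sigma>'"
    have "\<sigma> p = \<sigma>' p" if p: "p \<in> S" for p
    proof -
      have iff: "\<sigma> p = j \<longleftrightarrow> \<sigma>' p = j" if "j \<in> {1..r}" for j
        using dvd_a[OF S(1)[OF p] that, of \<sigma>] dvd_a[OF S(1)[OF p] that, of \<sigma>'] h(3) p by (auto simp: A_def)
      have "\<sigma> p \<in> I" "\<sigma>' p \<in> I" using G\<Omega>(1)[OF h(1)] G\<Omega>(1)[OF h(2)] p by (auto simp: \<Omega>_def)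
      then have "\<sigma> p = 0 \<or> \<sigma> p \<in> {1..r}" "\<sigma>' p = 0 \<or> \<sigma>' p \<in> {1..r}" by (auto simp: I_def)
      then show ?thesis using iff by metis
    qed
    then show "\<sigma> = \<sigma>'" using G\<Omega>(1)[OF h(1)] G\<Omega>(1)[OF h(2)] unfolding \<Omega>_def by (intro PiE_ext) auto
  qed
  have sub: "a ` G \<subseteq> coprime_tuples r N (\<lambda>j. omega_upto (y j)) Z (\<lambda>j. real (k j))"
  proof clarify
    fix \<sigma> assume \<sigma>: "\<sigma> \<in> G"
    have apos: "a \<sigma> j \<ge> 1" if "j \<in> {1..r}" for j
      unfolding a_eq[OF that] using A_pos[of \<sigma> j] by linarith
    have 1: "real (a \<sigma> j) \<le> Z" if "j \<in> {1..r}" for j using G\<Omega>(2)[OF \<sigma>] that unfolding Gd_def by blast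
    have 2: "omega_upto (y j) (a \<sigma> j) = real (k j)" if "j \<in> {1..r}" for j
    proof -
      have "\<kappa> \<sigma> j = k j" using \<sigma> by (simp add: G_def)
      then show ?thesis using a_omega[OF that] that by (simp add: \<kappa>_def)
    qed
    have 3: "coprime (int (a \<sigma> j)) N" if j: "j \<in> {1..r}" for j
    proof -
      have "coprime (\<Prod>p\<in>A \<sigma> j. int p) N"
      proof (rule prod_coprime_left)
        fix p assume "p \<in> A \<sigma> j"
        then have "p \<in> S" by (simp add: A_def)
        then show "coprime (int p) N" using S(1,3) by (intro prime_imp_coprime) auto
      qed
      then show ?thesis unfolding a_eq[OF j] by simp
    qed
    have 4: "coprime (a \<sigma> i) (a \<sigma> j)" if ij: "i \<in> {1..r}" "j \<in> {1..r}" "i \<noteq> j" for i j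
      unfolding a_eq[OF ij(1)] a_eq[OF ij(2)]
    proof (rule prod_coprime_left, rule prod_coprime_right)
      fix p q assume "p \<in> A \<sigma> i" "q \<in> A \<sigma> j"
      then have "p \<noteq> q" "prime p" "prime q" using ij(3) Apr by (auto simp: A_def)
      then show "coprime p q" by (intro primes_coprime)
    qed
    have "a \<sigma> \<in> {1..r} \<rightarrow>\<^sub>E {m. m \<ge> 1 \<and> real m \<le> Z}"
    proof (rule PiE_I)
      show "a \<sigma> j \<in> {m. m \<ge> 1 \<and> real m \<le> Z}" if "j \<in> {1..r}" for j using apos[OF that] 1[OF that] by blast
      show "a \<sigma> j = undefined" if "j \<notin> {1..r}" for j using that by (simp only: a_def restrict_apply if_False)
    qed
    then show "a \<sigma> \<in> coprime_tuples r N (\<lambda>j. omega_upto (y j)) Z (\<lambda>j. real (k j))"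
      unfolding coprime_tuples_def using 2 3 4 by blast
  qed
  have finct: "finite (coprime_tuples r N (\<lambda>j. omega_upto (y j)) Z (\<lambda>j. real (k j)))"
    unfolding coprime_tuples_def by (rule finite_subset[OF _ finite_tuples[of r Z]]) auto
  have TP: "0 \<le> (\<Prod>p\<in>S. T p)" using T1 by (intro prod_nonneg) (meson order_trans zero_le_one)
  have "(\<Prod>p\<in>S. T p) / (2 * D) = (\<Prod>p\<in>S. T p) * (1 / (2 * D))" by simp
  also have "\<dots> \<le> (\<Prod>p\<in>S. T p) * (\<Sum>\<sigma>\<in>G. w \<sigma>)" using k(2) TP unfolding G_def by (rule mult_left_mono)
  also have "\<dots> = (\<Sum>\<sigma>\<in>G. \<tau> (a \<sigma>))" unfolding sum_distrib_left using tau_eq G\<Omega>(1) by (intro sum.cong) auto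
  also have "\<dots> = (\<Sum>b\<in>a ` G. \<tau> b)" by (rule sum.reindex[OF inj, unfolded o_def, symmetric])
  also have "\<dots> \<le> tuple_sum r Q N (\<lambda>j. omega_upto (y j)) Z (\<lambda>j. real (k j))"
    unfolding tuple_sum_def \<tau>_def[symmetric]
    by (rule sum_mono2[OF finct sub]) (auto simp: \<tau>_def intro!: prod_nonneg)
  finally show ?thesis unfolding S_def T_def I_def D_def by (intro exI[of _ k]) (simp only: mult.assoc)
qed

end

text \<open>The truncated count takes natural values, also with the convention at 0; a real vector
  with a nonzero count is therefore natural on \<open>{1..r}\<close>, and any other vector
  contributes 0.\<close>

lemma SUP_value_count_nat:
  fixes z :: "nat \<Rightarrow> real"
  shows "(SUP k :: nat \<Rightarrow> real. value_count r Q (\<lambda>j. omega_upto (z j)) x y k)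
    \<le> (SUP k :: nat \<Rightarrow> nat. value_count r Q (\<lambda>j. omega_upto (z j)) x y (\<lambda>j. real (k j)))"
proof (rule cSUP_least)
  fix k :: "nat \<Rightarrow> real"
  define F where "F k = value_count r Q (\<lambda>j. omega_upto (z j)) x y k" for k
  have bdd: "bdd_above (range (\<lambda>k :: nat \<Rightarrow> nat. F (\<lambda>j. real (k j))))"
    using bdd_above_value_count[of r Q "\<lambda>j. omega_upto (z j)" x y UNIV]
    unfolding F_def by (rule bdd_above_mono) auto
  have "\<exists>k' :: nat \<Rightarrow> nat. F k \<le> F (\<lambda>j. real (k' j))"
  proof (cases "{n::int. x < of_int n \<and> of_int n \<le> x + y \<and> (\<forall>j\<in>{1..r}. int_ext (omega_upto (z j)) (poly (Q j) n) = k j)} = {}")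
    case True
    then have "F k = 0" unfolding F_def value_count_def by (simp only: card.empty of_nat_0)
    also have "0 \<le> F (\<lambda>j. real ((\<lambda>_. 0::nat) j))" unfolding F_def value_count_def by simp
    finally show ?thesis by (intro exI[of _ "\<lambda>_. 0"]) simp
  next
    case False
    then obtain n where n: "\<forall>j\<in>{1..r}. int_ext (omega_upto (z j)) (poly (Q j) n) = k j" by blast
    define k' where "k' j = nat \<lfloor>k j\<rfloor>" for j
    have "real (k' j) = k j" if "j \<in> {1..r}" for j
    proof -
      have "k j = int_ext (omega_upto (z j)) (poly (Q j) n)" using n that by simp
      then show ?thesis by (auto simp: k'_def int_ext_def omega_upto_def)
    qed
    then have "F (\<lambda>j. real (k' j)) = F k"
      unfolding F_def value_count_def by (intro arg_cong[where f = "\<lambda>A. real (card A)"]) auto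
    then show ?thesis by (metis order_refl)
  qed
  then obtain k' :: "nat \<Rightarrow> nat" where "F k \<le> F (\<lambda>j. real (k' j))" by blast
  also have "\<dots> \<le> (SUP k :: nat \<Rightarrow> nat. F (\<lambda>j. real (k j)))" by (intro cSUP_upper bdd) simp
  finally show "value_count r Q (\<lambda>j. omega_upto (z j)) x y k
      \<le> (SUP k :: nat \<Rightarrow> nat. value_count r Q (\<lambda>j. omega_upto (z j)) x y (\<lambda>j. real (k j)))"
    unfolding F_def .
qed simp

definition omega_count_bound :: "nat \<Rightarrow> nat \<Rightarrow> real \<Rightarrow> real \<Rightarrow> real \<Rightarrow> real \<Rightarrow> bool" where
  "omega_count_bound r g \<epsilon> \<delta> c C \<longleftrightarrow>
    (\<forall>(Q :: nat \<Rightarrow> int poly) M x y z.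
      poly_family r Q \<longrightarrow> degree (\<Prod>j\<in>{1..r}. Q j) = g \<longrightarrow>
      (\<forall>j\<in>{1..r}. mertens_bound (Q j) (M j)) \<longrightarrow>
      x \<ge> c * real_of_int (height (\<Prod>j\<in>{1..r}. Q j)) powr \<delta> \<longrightarrow> x powr \<epsilon> < y \<longrightarrow> y \<le> x \<longrightarrow>
      (SUP k :: nat \<Rightarrow> nat. value_count r Q (\<lambda>j. omega_upto (z j)) x y (\<lambda>j. real (k j))) \<ge>
        C * ((real (totient (nat \<bar>lead_coeff (\<Prod>j\<in>{1..r}. Q j) * poly_disc (\<Prod>j\<in>{1..r}. Q j)\<bar>)) /
            real_of_int \<bar>lead_coeff (\<Prod>j\<in>{1..r}. Q j) * poly_disc (\<Prod>j\<in>{1..r}. Q j)\<bar>) ^ g *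
            (exp (- 2 * (\<Sum>j\<in>{1..r}. M j)) * y) /
          sqrt (\<Prod>j\<in>{1..r}. E_fun (omega_upto (z j)) x (root_count (Q j)))))"

lemma ex_omega_count_bound:
  fixes r g :: nat and \<epsilon> \<delta> :: real
  assumes "r \<ge> 1" and "g \<ge> 1"
    and "0 < \<epsilon>" and "\<epsilon> < 1" and "0 < \<delta>" and "\<delta> < 1"
  shows "\<exists>c\<ge>1. \<exists>C>0. omega_count_bound r g \<epsilon> \<delta> c C"
proof -
  define \<epsilon>0 where "\<epsilon>0 = \<epsilon> / (50 * real g)"
  have \<epsilon>0: "0 < \<epsilon>0" "\<epsilon>0 \<le> 1" unfolding \<epsilon>0_def using assms by (auto simp: field_simps)
  \<comment> \<open>With \<open>t = x powr \<eta>\<close> and \<open>Z = x powr \<epsilon>0\<close>,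
    the term \<open>16 r g ln t\<close> is exactly half of \<open>ln Z\<close>; the other half is
    left for \<open>16 r g\<close>.\<close>
  define \<eta> where "\<eta> = \<epsilon>0 / (32 * real r * real g)"
  have rg: "1 \<le> real r" "1 \<le> real g" using assms by auto
  have \<eta>: "0 < \<eta>" "\<eta> \<le> 1"
  proof -
    show "0 < \<eta>" unfolding \<eta>_def using \<epsilon>0 rg by (intro divide_pos_pos mult_pos_pos) auto
    have "1 * 1 \<le> real r * real g" using rg by (intro mult_mono) auto
    then have "\<epsilon>0 \<le> 32 * real r * real g" using \<epsilon>0(2) by linarith
    then show "\<eta> \<le> 1" unfolding \<eta>_def using rg by (intro divide_le_eq_1[THEN iffD2]) auto
  qed
  obtain c1 C1 :: real where c1: "c1 \<ge> 1" and C1: "C1 > 0" and bound: "value_count_bound r g 2 \<epsilon> \<delta> c1 C1"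
    using ex_value_count_bound[OF assms(1,2) _ assms(3-6), of 2] by auto
  \<comment> \<open>The entries serve, in order, the first assertion, the inequality
    \<open>16 r g \<le> (ln Z) / 2\<close>, and \<open>t \<ge> 2\<close>.\<close>
  define c0 where "c0 = max c1 (max (exp (32 * real r * real g / \<epsilon>0)) (2 powr (1 / \<eta>)))"
  have c0: "c0 \<ge> 1" "c0 \<ge> c1" using c1 by (auto simp: c0_def)
  define C2 where "C2 = C1 * (exp (- 2 * (real g + real g ^ 2)) * \<eta> ^ r / (2 * (4 * sqrt (real r) + 1) ^ r))"
  have sr: "(4 * sqrt (real r) + 1) ^ r > 0" by (intro zero_less_power add_nonneg_pos) auto
  have C2: "C2 > 0" unfolding C2_def using C1 \<eta> sr by (intro mult_pos_pos divide_pos_pos) auto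
  have main: "C2 * ((real (totient (nat \<bar>lead_coeff (\<Prod>j\<in>{1..r}. Q j) * poly_disc (\<Prod>j\<in>{1..r}. Q j)\<bar>)) /
            real_of_int \<bar>lead_coeff (\<Prod>j\<in>{1..r}. Q j) * poly_disc (\<Prod>j\<in>{1..r}. Q j)\<bar>) ^ g *
            (exp (- 2 * (\<Sum>j\<in>{1..r}. M j)) * y) /
          sqrt (\<Prod>j\<in>{1..r}. E_fun (omega_upto (z j)) x (root_count (Q j))))
      \<le> (SUP k :: nat \<Rightarrow> nat. value_count r Q (\<lambda>j. omega_upto (z j)) x y (\<lambda>j. real (k j)))"
    if fam: "poly_family r Q" and deg: "degree (\<Prod>j\<in>{1..r}. Q j) = g"
      and M: "\<And>j. j \<in> {1..r} \<Longrightarrow> mertens_bound (Q j) (M j)"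
      and x: "x \<ge> c0 * real_of_int (height (\<Prod>j\<in>{1..r}. Q j)) powr \<delta>"
      and y: "x powr \<epsilon> < y" "y \<le> x"
    for Q :: "nat \<Rightarrow> int poly" and M :: "nat \<Rightarrow> real" and x y z
  proof -
    interpret polynomial_family r Q
      by unfold_locales (use fam deg assms in auto)
    define f where "f j = omega_upto (z j)" for j
    define sup where "sup = (SUP k :: nat \<Rightarrow> real. value_count r Q f x y k)"
    define \<phi> where "\<phi> = (real (totient (nat \<bar>N\<bar>)) / real_of_int \<bar>N\<bar>) ^ g"
    define S where "S = sqrt (\<Prod>j\<in>{1..r}. E_fun (omega_upto (z j)) x (root_count (Q j)))"
    define m where "m = exp (- (\<Sum>j\<in>{1..r}. M j))"
    have H\<delta>: "real_of_int (height Qprod) powr \<delta> \<ge> 1"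
      using assms by (intro ge_one_powr_ge_zero height_Qprod_ge_1) auto
    have x_c0: "x \<ge> c0"
    proof -
      have "c0 * 1 \<le> c0 * real_of_int (height Qprod) powr \<delta>" using H\<delta> c0 by (intro mult_left_mono) auto
      then show ?thesis using x by linarith
    qed
    have x_c1: "x \<ge> c1 * real_of_int (height Qprod) powr \<delta>"
    proof -
      have "c1 * real_of_int (height Qprod) powr \<delta> \<le> c0 * real_of_int (height Qprod) powr \<delta>"
        using c0 by (intro mult_right_mono) auto
      then show ?thesis using x by linarith
    qed
    have x1: "x \<ge> 1" using x_c0 c0 by linarith
    have y0: "y \<ge> 0" using y(1) by (smt (verit) powr_ge_zero)
    have x_exp: "32 * real r * real g / \<epsilon>0 \<le> ln x"
    proof -
      have "exp (32 * real r * real g / \<epsilon>0) \<le> x" using x_c0 by (simp add: c0_def)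
      then show ?thesis using x1 by (subst ln_ge_iff) auto
    qed
    then have lnx: "32 * real r * real g \<le> \<epsilon>0 * ln x" using \<epsilon>0 by (simp add: field_simps)
    have lnx0: "0 < ln x"
    proof -
      have "0 < 32 * real r * real g / \<epsilon>0" using \<epsilon>0 rg by (intro divide_pos_pos mult_pos_pos) auto
      then show ?thesis using x_exp by linarith
    qed
    define t where "t = x powr \<eta>"
    define Z where "Z = x powr \<epsilon>0"
    have x_gt: "x > 1" using lnx0 x1 by (cases "x = 1") auto
    have t2: "2 \<le> t"
    proof -
      have "2 powr (1 / \<eta>) \<le> x" using x_c0 by (simp add: c0_def)
      then have "(2 powr (1 / \<eta>)) powr \<eta> \<le> x powr \<eta>" using \<eta> by (intro powr_mono2) auto
      then show ?thesis using \<eta> by (simp add: powr_powr t_def)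
    qed
    have tx: "t \<le> x" unfolding t_def using x1 \<eta> powr_mono[of \<eta> 1 x] by simp
    have lnt: "ln t = \<eta> * ln x" and lnZ: "ln Z = \<epsilon>0 * ln x"
      unfolding t_def Z_def using x1 by (simp_all add: ln_powr)
    have Z1: "Z > 1" unfolding Z_def using x_gt \<epsilon>0 by (intro gr_one_powr) auto
    have tZ: "16 * real r * real g * (ln t + 1) \<le> ln Z"
    proof -
      have "16 * real r * real g * \<eta> = \<epsilon>0 / 2" unfolding \<eta>_def using rg by simp
      then have "16 * real r * real g * ln t = \<epsilon>0 / 2 * ln x"
        unfolding lnt by (metis mult.assoc)
      then show ?thesis unfolding lnZ distrib_left using lnx by simp
    qed
    have spf: "additive_fun (f j) \<and> sparse_values 2 (x powr (\<epsilon> / (50 * real g))) (f j)" for j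
      unfolding f_def using additive_omega_upto sparse_omega_upto[of Z] Z1 unfolding Z_def \<epsilon>0_def by blast
    have p1: "C1 * (m * y / (ln x) ^ r * (SUP k :: nat \<Rightarrow> real. tuple_sum r Q N f Z k)) \<le> sup"
      using bound fam deg M x_c1 y spf unfolding m_def Z_def \<epsilon>0_def N_def sup_def value_count_bound_def by blast
    have sup0: "0 \<le> sup" unfolding sup_def by (rule SUP_value_count_nonneg)
    have "C2 * (\<phi> * (exp (- 2 * (\<Sum>j\<in>{1..r}. M j)) * y) / S) \<le> sup"
    proof (cases "N = 0")
      \<comment> \<open>Here \<open>\<phi>\<close> is the junk value \<open>0 / 0 = 0\<close>.\<close>
      case True
      then have "\<phi> = 0" unfolding \<phi>_def using assms(2) by simp
      then show ?thesis using sup0 by simp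
    next
      case False
      define W where "W = (\<Prod>p | prime p \<and> real p \<le> t \<and> \<not> int p dvd N. \<Sum>i\<in>{0..r}. root_weight p i)"
      have W: "exp (- 2 * (real g + real g ^ 2)) * ln t ^ r * m * \<phi> \<le> W"
        using prod_sum_root_weight_ge[OF t2 False M] unfolding W_def m_def \<phi>_def deg .
      obtain k :: "nat \<Rightarrow> nat" where k: "W / (2 * (4 * sqrt (real r) + 1) ^ r * S) \<le> tuple_sum r Q N f Z (\<lambda>j. real (k j))"
        using ex_tuple_sum_omega_ge[of t x Z z] t2 tx tZ Z1 unfolding W_def S_def f_def deg by blast
      have S0: "0 \<le> S" unfolding S_def E_fun_def
        by (intro real_sqrt_ge_zero prod_nonneg) (auto intro!: add_nonneg_nonneg sum_nonneg divide_nonneg_nonneg)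
      have "exp (- 2 * (real g + real g ^ 2)) * ln t ^ r * m * \<phi> / (2 * (4 * sqrt (real r) + 1) ^ r * S)
          \<le> W / (2 * (4 * sqrt (real r) + 1) ^ r * S)"
        using W S0 sr by (intro divide_right_mono) auto
      also have "\<dots> \<le> tuple_sum r Q N f Z (\<lambda>j. real (k j))" by (rule k)
      also have "\<dots> \<le> (SUP k :: nat \<Rightarrow> real. tuple_sum r Q N f Z k)"
        by (intro cSUP_upper bdd_above_tuple_sum) simp
      finally have le: "exp (- 2 * (real g + real g ^ 2)) * ln t ^ r * m * \<phi> / (2 * (4 * sqrt (real r) + 1) ^ r * S)
          \<le> (SUP k :: nat \<Rightarrow> real. tuple_sum r Q N f Z k)" .
      have mm: "exp (- 2 * (\<Sum>j\<in>{1..r}. M j)) = m * m"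
        unfolding m_def by (simp flip: exp_add)
      \<comment> \<open>Since \<open>ln t = \<eta> ln x\<close>, the powers of the logarithm cancel
        and leave the factor \<open>\<eta> ^ r\<close> of \<open>C2\<close>; the two factors
        \<open>m\<close> come from the sieve and from the total mass.\<close>
      have "C2 * (\<phi> * (exp (- 2 * (\<Sum>j\<in>{1..r}. M j)) * y) / S) =
          C1 * (m * y / (ln x) ^ r * (exp (- 2 * (real g + real g ^ 2)) * ln t ^ r * m * \<phi> / (2 * (4 * sqrt (real r) + 1) ^ r * S)))"
        unfolding C2_def mm lnt power_mult_distrib using lnx0 by simp
      also have "\<dots> \<le> C1 * (m * y / (ln x) ^ r * (SUP k :: nat \<Rightarrow> real. tuple_sum r Q N f Z k))"
        using le C1 y0 lnx0 by (intro mult_left_mono) (auto simp: m_def)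
      also have "\<dots> \<le> sup" by (rule p1)
      finally show ?thesis .
    qed
    also have "sup \<le> (SUP k :: nat \<Rightarrow> nat. value_count r Q (\<lambda>j. omega_upto (z j)) x y (\<lambda>j. real (k j)))"
      unfolding sup_def f_def by (rule SUP_value_count_nat)
    finally show ?thesis unfolding \<phi>_def N_def S_def .
  qed
  have "omega_count_bound r g \<epsilon> \<delta> c0 C2"
    unfolding omega_count_bound_def using main by blast
  then show ?thesis using c0 C2 by blast
qed

theorem mainTheorem2:
  fixes r g V :: nat and \<epsilon> \<delta> :: real
  assumes "r \<ge> 1" and "g \<ge> 1" and "V \<ge> 1"
    and "0 < \<epsilon>" and "\<epsilon> < 1" and "0 < \<delta>" and "\<delta> < 1"
  shows "\<exists>c\<^sub>0>0. \<exists>C\<^sub>1>0. \<exists>C\<^sub>2>0.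
    \<forall>(Q :: nat \<Rightarrow> int poly) (M :: nat \<Rightarrow> real).
      poly_family r Q \<longrightarrow>
      degree (\<Prod>j\<in>{1..r}. Q j) = g \<longrightarrow>
      (\<forall>j\<in>{1..r}. mertens_bound (Q j) (M j)) \<longrightarrow>
      (let P = (\<Prod>j\<in>{1..r}. Q j);
           N = lead_coeff P * poly_disc P;
           Mtot = (\<Sum>j\<in>{1..r}. M j);
           \<epsilon>\<^sub>0 = \<epsilon> / (50 * real g)
       in
        (\<forall>(x::real) (y::real) (f :: nat \<Rightarrow> nat \<Rightarrow> real).
          x \<ge> c\<^sub>0 * real_of_int (height P) powr \<delta> \<longrightarrow> x powr \<epsilon> < y \<longrightarrow> y \<le> x \<longrightarrow>
          (\<forall>j\<in>{1..r}. additive_fun (f j) \<and> sparse_values V (x powr \<epsilon>\<^sub>0) (f j)) \<longrightarrow>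
          (SUP k :: nat \<Rightarrow> real. value_count r Q f x y k) \<ge>
            C\<^sub>1 * (exp (- Mtot) * y / (ln x) ^ r *
              (SUP k :: nat \<Rightarrow> real. tuple_sum r Q N f (x powr \<epsilon>\<^sub>0) k))) \<and>
        (\<forall>(x::real) (y::real) (z :: nat \<Rightarrow> real).
          x \<ge> c\<^sub>0 * real_of_int (height P) powr \<delta> \<longrightarrow> x powr \<epsilon> < y \<longrightarrow> y \<le> x \<longrightarrow>
          (\<forall>j\<in>{1..r}. z j \<ge> 1) \<longrightarrow>
          (SUP k :: nat \<Rightarrow> nat. value_count r Q (\<lambda>j. omega_upto (z j)) x y (\<lambda>j. real (k j))) \<ge>
            C\<^sub>2 * ((real (totient (nat \<bar>N\<bar>)) / real_of_int \<bar>N\<bar>) ^ g * (exp (- 2 * Mtot) * y) /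
              sqrt (\<Prod>j\<in>{1..r}. E_fun (omega_upto (z j)) x (root_count (Q j))))))"
proof -
  obtain c1 C1 :: real where c1: "c1 \<ge> 1" and C1: "C1 > 0" and bound1: "value_count_bound r g V \<epsilon> \<delta> c1 C1"
    using ex_value_count_bound[OF assms] by blast
  obtain c2 C2 :: real where c2: "c2 \<ge> 1" and C2: "C2 > 0" and bound2: "omega_count_bound r g \<epsilon> \<delta> c2 C2"
    using ex_omega_count_bound[OF assms(1,2,4-7)] by blast
  \<comment> \<open>Both assertions are stable under raising the threshold, so the larger of the two
    constants serves for both.\<close>
  define c0 where "c0 = max c1 c2"
  have c0: "c0 > 0" using c1 by (simp add: c0_def)
  have weaken: "c1 * h powr \<delta> \<le> x" "c2 * h powr \<delta> \<le> x" if "c0 * h powr \<delta> \<le> x" for h x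
  proof -
    have "c1 * h powr \<delta> \<le> c0 * h powr \<delta>" "c2 * h powr \<delta> \<le> c0 * h powr \<delta>"
      unfolding c0_def by (intro mult_right_mono; simp)+
    then show "c1 * h powr \<delta> \<le> x" "c2 * h powr \<delta> \<le> x" using that by linarith+
  qed
  show ?thesis
    unfolding Let_def
  proof (rule exI[of _ c0], intro conjI c0, rule exI[of _ C1], intro conjI C1, rule exI[of _ C2], intro conjI C2 allI impI)
    fix Q :: "nat \<Rightarrow> int poly" and M :: "nat \<Rightarrow> real" and x y :: real and f :: "nat \<Rightarrow> nat \<Rightarrow> real"
    assume h: "poly_family r Q" "degree (\<Prod>j\<in>{1..r}. Q j) = g" "\<forall>j\<in>{1..r}. mertens_bound (Q j) (M j)"
      "c0 * real_of_int (height (\<Prod>j\<in>{1..r}. Q j)) powr \<delta> \<le> x" "x powr \<epsilon> < y" "y \<le> x"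
      "\<forall>j\<in>{1..r}. additive_fun (f j) \<and> sparse_values V (x powr (\<epsilon> / (50 * real g))) (f j)"
    show "C1 * (exp (- (\<Sum>j\<in>{1..r}. M j)) * y / (ln x) ^ r *
          (SUP k :: nat \<Rightarrow> real. tuple_sum r Q
            (lead_coeff (\<Prod>j\<in>{1..r}. Q j) * poly_disc (\<Prod>j\<in>{1..r}. Q j)) f (x powr (\<epsilon> / (50 * real g))) k))
        \<le> (SUP k :: nat \<Rightarrow> real. value_count r Q f x y k)"
      using bound1 h weaken(1)[OF h(4)] unfolding value_count_bound_def by blast
  next
    fix Q :: "nat \<Rightarrow> int poly" and M :: "nat \<Rightarrow> real" and x y :: real and z :: "nat \<Rightarrow> real"
    assume h: "poly_family r Q" "degree (\<Prod>j\<in>{1..r}. Q j) = g" "\<forall>j\<in>{1..r}. mertens_bound (Q j) (M j)"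
      "c0 * real_of_int (height (\<Prod>j\<in>{1..r}. Q j)) powr \<delta> \<le> x" "x powr \<epsilon> < y" "y \<le> x"
    show "C2 * ((real (totient (nat \<bar>lead_coeff (\<Prod>j\<in>{1..r}. Q j) * poly_disc (\<Prod>j\<in>{1..r}. Q j)\<bar>)) /
            real_of_int \<bar>lead_coeff (\<Prod>j\<in>{1..r}. Q j) * poly_disc (\<Prod>j\<in>{1..r}. Q j)\<bar>) ^ g *
            (exp (- 2 * (\<Sum>j\<in>{1..r}. M j)) * y) /
          sqrt (\<Prod>j\<in>{1..r}. E_fun (omega_upto (z j)) x (root_count (Q j))))
        \<le> (SUP k :: nat \<Rightarrow> nat. value_count r Q (\<lambda>j. omega_upto (z j)) x y (\<lambda>j. real (k j)))"
      using bound2 h weaken(2)[OF h(4)] unfolding omega_count_bound_def by blast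
  qed
qed

end
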